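(* Let $K$ be a convex body in $\mathbb{R}^d$, let $I$ be a random point uniformly distributed in $K$ and let $B$ be a random point uniformly distributed on the boundary $\partial K$. Assume that at least one of the following holds: (i) $d=2$ and $\mathbb{E} I=\mathbb{E} B$; (ii) $K$ is a circumscribed polytope whose inscribed sphere has center $O$ with $O=\mathbb{E} I=\mathbb{E} B$. Let $I_1,I_2$ be independent random points, each uniformly distributed in $K$, and let $B_1,B_2$ be independent random points, each uniformly distributed on $\partial K$. Then for every real $p\ge 1$, $$\mathbb{E}\,|I_1-I_2|^p\le\mathbb{E}\,|B_1-B_2|^p,$$ where $|\cdot|$ is the Euclidean norm.
   Context: A convex body in $\mathbb{R}^d$ is a compact convex set with nonempty interior. "Uniformly distributed in $K$" means with law equal to Lebesgue measure restricted to $K$, normalized to be a probability measure. "Uniformly distributed on $\partial K$" means with law equal to the surface measure (the $(d-1)$-dimensional Hausdorff measure) restricted to $\partial K$, normalized to be a probability measure. A circumscribed polytope is a convex polytope (with nonempty interior) that has an inscribed sphere, i.e. a sphere contained in the polytope and tangent to all of its facets ($(d-1)$-dimensional faces). *)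

theory Defs
  imports "HOL-Probability.Probability"
begin

(* Federer's normalisation: agrees with Lebesgue measure in dimension k on R^k.  The empty set
   gets weight 0 separately because 0 ^ 0 = 1; for k = 0 this makes every nonempty set count 1. *)
definition hausdorff_gauge :: "nat \<Rightarrow> 'a::metric_space set \<Rightarrow> ennreal" where
  "hausdorff_gauge k C =
     (if C = {} then 0 else ennreal (unit_ball_vol (real k) * (diameter C / 2) ^ k))"

(* Covers are restricted to bounded sets, since diameter is unspecified on unbounded ones. *)
definition hausdorff_content :: "nat \<Rightarrow> real \<Rightarrow> 'a::metric_space set \<Rightarrow> ennreal" where
  "hausdorff_content k \<delta> A =
     (INF C \<in> {C :: nat \<Rightarrow> 'a set. A \<subseteq> (\<Union>n. C n) \<and> (\<forall>n. bounded (C n) \<and> diameter (C n) \<le> \<delta>)}.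
        \<Sum>n. hausdorff_gauge k (C n))"

definition hausdorff_outer :: "nat \<Rightarrow> 'a::metric_space set \<Rightarrow> ennreal" where
  "hausdorff_outer k A = (SUP \<delta> \<in> {0<..}. hausdorff_content k \<delta> A)"

(* measure_of yields the zero measure if its argument is not countably additive;
   lemma emeasure_hausdorff_measure below shows that this does not happen here. *)
definition hausdorff_measure :: "nat \<Rightarrow> 'a::metric_space measure" where
  "hausdorff_measure k = measure_of UNIV (sets borel) (hausdorff_outer k)"

definition convex_body :: "'a::euclidean_space set \<Rightarrow> bool" where
  "convex_body K \<longleftrightarrow> compact K \<and> convex K \<and> interior K \<noteq> {}"

definition uniform_in :: "'w measure \<Rightarrow> ('w \<Rightarrow> 'a::euclidean_space) \<Rightarrow> 'a set \<Rightarrow> bool" where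
  "uniform_in M X K \<longleftrightarrow> X \<in> borel_measurable M \<and> distr M borel X = uniform_measure lborel K"

definition uniform_on_boundary ::
    "'w measure \<Rightarrow> ('w \<Rightarrow> 'a::euclidean_space) \<Rightarrow> 'a set \<Rightarrow> bool" where
  "uniform_on_boundary M X K \<longleftrightarrow> X \<in> borel_measurable M \<and>
     distr M borel X = uniform_measure (hausdorff_measure (DIM('a) - 1)) (frontier K)"

(* The sphere with centre c and radius r is tangent to a facet F when it meets the hyperplane
   spanned by F in exactly one point and this point lies in F. *)
definition inscribed_sphere :: "'a::euclidean_space set \<Rightarrow> 'a \<Rightarrow> real \<Rightarrow> bool" where
  "inscribed_sphere K c r \<longleftrightarrow> 0 < r \<and> sphere c r \<subseteq> K \<and>
     (\<forall>F. F facet_of K \<longrightarrow> (\<exists>x\<in>F. sphere c r \<inter> affine hull F = {x}))"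

definition circumscribed_polytope_with_center :: "'a::euclidean_space set \<Rightarrow> 'a \<Rightarrow> bool" where
  "circumscribed_polytope_with_center K c \<longleftrightarrow>
     polytope K \<and> interior K \<noteq> {} \<and> (\<exists>r. inscribed_sphere K c r)"


lemma hausdorff_gauge_empty [simp]: "hausdorff_gauge k {} = 0"
  by (simp add: hausdorff_gauge_def)

lemma hausdorff_content_le:
  assumes "A \<subseteq> (\<Union>n. C n)" "\<And>n. bounded (C n)" "\<And>n. diameter (C n) \<le> \<delta>"
  shows "hausdorff_content k \<delta> A \<le> (\<Sum>n. hausdorff_gauge k (C n))"
  unfolding hausdorff_content_def using assms by (intro INF_lower) auto

lemma hausdorff_content_mono: "A \<subseteq> B \<Longrightarrow> hausdorff_content k \<delta> A \<le> hausdorff_content k \<delta> B"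
  unfolding hausdorff_content_def by (rule INF_superset_mono) auto

lemma hausdorff_content_antimono:
  "\<delta> \<le> \<epsilon> \<Longrightarrow> hausdorff_content k \<epsilon> A \<le> hausdorff_content k \<delta> A"
  unfolding hausdorff_content_def by (rule INF_superset_mono) (auto intro: order_trans)

lemma hausdorff_content_empty [simp]: "0 \<le> \<delta> \<Longrightarrow> hausdorff_content k \<delta> {} = 0"
  using hausdorff_content_le[of "{}" "\<lambda>_. {}" \<delta> k] by simp

lemma hausdorff_content_countably_subadditive:
  "hausdorff_content k \<delta> (\<Union>i. A i) \<le> (\<Sum>i. hausdorff_content k \<delta> (A i))"
proof (rule ennreal_le_epsilon)
  fix e :: real assume fin: "(\<Sum>i. hausdorff_content k \<delta> (A i)) < top" and e: "0 < e"
  have "\<exists>C. A i \<subseteq> (\<Union>n. C n) \<and> (\<forall>n. bounded (C n) \<and> diameter (C n) \<le> \<delta>) \<and>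
      (\<Sum>n. hausdorff_gauge k (C n)) \<le> hausdorff_content k \<delta> (A i) + ennreal (e * (1/2)^Suc i)" for i
  proof -
    have "hausdorff_content k \<delta> (A i) < top"
      using fin by (rule ennreal_suminf_lessD)
    then have "hausdorff_content k \<delta> (A i) < hausdorff_content k \<delta> (A i) + ennreal (e * (1/2)^Suc i)"
      using e by (simp add: ennreal_add_left_cancel_less[of _ 0, simplified])
    then show ?thesis
      unfolding hausdorff_content_def[of k \<delta> "A i"] INF_less_iff by (auto intro: less_imp_le)
  qed
  then obtain C where C: "\<And>i. A i \<subseteq> (\<Union>n. C i n)"
      "\<And>i n. bounded (C i n)" "\<And>i n. diameter (C i n) \<le> \<delta>"
      "\<And>i. (\<Sum>n. hausdorff_gauge k (C i n)) \<le> hausdorff_content k \<delta> (A i) + ennreal (e * (1/2)^Suc i)"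
    by metis
  let ?D = "\<lambda>m. case prod_decode m of (i, n) \<Rightarrow> C i n"
  have "(\<Union>i. A i) \<subseteq> (\<Union>m. ?D m)"
  proof
    fix x assume "x \<in> (\<Union>i. A i)"
    then obtain i n where "x \<in> C i n" using C(1) by blast
    then have "x \<in> ?D (prod_encode (i, n))" by simp
    then show "x \<in> (\<Union>m. ?D m)" by (rule UN_I[OF UNIV_I])
  qed
  then have "hausdorff_content k \<delta> (\<Union>i. A i) \<le> (\<Sum>m. hausdorff_gauge k (?D m))"
    by (rule hausdorff_content_le) (use C(2,3) in \<open>auto split: prod.split\<close>)
  also have "\<dots> = (\<Sum>m. (\<lambda>p. hausdorff_gauge k (C (fst p) (snd p))) (prod_decode m))"
    by (simp add: case_prod_beta)
  also have "\<dots> = (\<Sum>i. \<Sum>n. hausdorff_gauge k (C i n))"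
    by (rule suminf_ennreal_2dimen) simp
  also have "\<dots> \<le> (\<Sum>i. hausdorff_content k \<delta> (A i) + ennreal (e * (1/2)^Suc i))"
    by (intro suminf_le C) auto
  also have "\<dots> = (\<Sum>i. hausdorff_content k \<delta> (A i)) + (\<Sum>i. ennreal (e * (1/2)^Suc i))"
    by (rule suminf_add[symmetric]) auto
  also have "(\<Sum>i. ennreal (e * (1/2)^Suc i)) = ennreal e"
    using sums_mult[OF power_half_series, of e] e by (intro suminf_ennreal_eq) auto
  finally show "hausdorff_content k \<delta> (\<Union>i. A i) \<le> (\<Sum>i. hausdorff_content k \<delta> (A i)) + ennreal e" .
qed

lemma outer_measure_space_hausdorff_outer:
  "outer_measure_space UNIV (hausdorff_outer k :: 'a::metric_space set \<Rightarrow> ennreal)"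
  unfolding outer_measure_space_def
proof (intro conjI)
  have "hausdorff_outer k ({} :: 'a set) = (SUP \<delta> \<in> {0::real<..}. 0)"
    unfolding hausdorff_outer_def by (intro SUP_cong) auto
  then show "positive UNIV (hausdorff_outer k :: 'a set \<Rightarrow> ennreal)"
    by (simp add: positive_def)
  show "increasing UNIV (hausdorff_outer k :: 'a set \<Rightarrow> ennreal)"
    by (auto simp: increasing_def hausdorff_outer_def intro!: SUP_mono' hausdorff_content_mono)
  show "countably_subadditive UNIV (hausdorff_outer k :: 'a set \<Rightarrow> ennreal)"
    unfolding countably_subadditive_def
  proof (intro allI impI)
    fix A :: "nat \<Rightarrow> 'a set"
    show "hausdorff_outer k (\<Union>i. A i) \<le> (\<Sum>i. hausdorff_outer k (A i))"
      unfolding hausdorff_outer_def[of k "\<Union>i. A i"]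
    proof (rule SUP_least)
      fix \<delta> :: real assume "\<delta> \<in> {0<..}"
      then have "(\<Sum>i. hausdorff_content k \<delta> (A i)) \<le> (\<Sum>i. hausdorff_outer k (A i))"
        by (intro suminf_le) (auto simp: hausdorff_outer_def intro: SUP_upper)
      with hausdorff_content_countably_subadditive
      show "hausdorff_content k \<delta> (\<Union>i. A i) \<le> (\<Sum>i. hausdorff_outer k (A i))"
        by (rule order_trans)
    qed
  qed
qed

lemma hausdorff_outer_empty [simp]: "hausdorff_outer k {} = 0"
  using outer_measure_space_hausdorff_outer by (auto simp: outer_measure_space_def positive_def)

lemma hausdorff_outer_mono: "A \<subseteq> B \<Longrightarrow> hausdorff_outer k A \<le> hausdorff_outer k B"
  using outer_measure_space_hausdorff_outer by (auto simp: outer_measure_space_def increasing_def)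

lemma hausdorff_outer_Un:
  fixes A B :: "'a::metric_space set"
  shows "hausdorff_outer k (A \<union> B) \<le> hausdorff_outer k A + hausdorff_outer k B"
proof -
  have "ring_of_sets UNIV (UNIV :: 'a set set)"
    using ring_of_sets_Pow[of "UNIV :: 'a set"] by simp
  then have "subadditive UNIV (hausdorff_outer k :: 'a set \<Rightarrow> ennreal)"
    using outer_measure_space_hausdorff_outer[of k, where 'a = 'a] unfolding outer_measure_space_def
    by (intro ring_of_sets.countably_subadditive_subadditive) simp_all
  then have "hausdorff_outer k (A \<union> (B - A)) \<le> hausdorff_outer k A + hausdorff_outer k (B - A)"
    unfolding subadditive_def by blast
  also have "\<dots> \<le> hausdorff_outer k A + hausdorff_outer k B"
    by (intro add_left_mono hausdorff_outer_mono) auto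
  finally show ?thesis by simp
qed

lemma hausdorff_outer_UN:
  "hausdorff_outer k (\<Union>i::nat. A i) \<le> (\<Sum>i. hausdorff_outer k (A i))"
proof -
  have "hausdorff_outer k (\<Union>i. A i) = hausdorff_outer k (\<Union>i. disjointed A i)"
    by (simp add: UN_disjointed_eq)
  also have "\<dots> \<le> (\<Sum>i. hausdorff_outer k (disjointed A i))"
    using outer_measure_space_hausdorff_outer[of k] disjoint_family_disjointed[of A]
    by (auto simp: outer_measure_space_def countably_subadditive_def)
  also have "\<dots> \<le> (\<Sum>i. hausdorff_outer k (A i))"
    by (intro suminf_le hausdorff_outer_mono disjointed_subset) auto
  finally show ?thesis .
qed

lemma hausdorff_outer_separated:
  assumes e: "0 < e" and sep: "\<And>a b. a \<in> A \<Longrightarrow> b \<in> B \<Longrightarrow> e \<le> dist a b"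
  shows "hausdorff_outer k A + hausdorff_outer k B \<le> hausdorff_outer k (A \<union> B)"
proof -
  have small: "hausdorff_content k \<delta> A + hausdorff_content k \<delta> B \<le> hausdorff_content k \<delta> (A \<union> B)"
    if "\<delta> < e" for \<delta>
    unfolding hausdorff_content_def[of k \<delta> "A \<union> B"]
  proof (rule INF_greatest)
    fix C assume "C \<in> {C :: nat \<Rightarrow> 'a set. A \<union> B \<subseteq> (\<Union>n. C n) \<and>
        (\<forall>n. bounded (C n) \<and> diameter (C n) \<le> \<delta>)}"
    then have C: "A \<union> B \<subseteq> (\<Union>n. C n)" "\<And>n. bounded (C n)" "\<And>n. diameter (C n) \<le> \<delta>"
      by auto
    let ?D = "\<lambda>n. if C n \<inter> A \<noteq> {} then C n else {}"
    let ?E = "\<lambda>n. if C n \<inter> A \<noteq> {} then {} else C n"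
    have diam: "diameter (C n) \<ge> 0" for n
      using C(2) by (rule diameter_ge_0)
    have \<delta>0: "0 \<le> \<delta>" using diam[of 0] C(3)[of 0] by simp
    have "hausdorff_content k \<delta> A \<le> (\<Sum>n. hausdorff_gauge k (?D n))"
    proof (rule hausdorff_content_le)
      show "A \<subseteq> (\<Union>n. ?D n)"
      proof
        fix x assume "x \<in> A"
        then obtain n where "x \<in> C n" using C(1) by blast
        with \<open>x \<in> A\<close> have "x \<in> ?D n" by auto
        then show "x \<in> (\<Union>n. ?D n)" by blast
      qed
    qed (use C \<delta>0 in auto)
    moreover have "hausdorff_content k \<delta> B \<le> (\<Sum>n. hausdorff_gauge k (?E n))"
    proof (rule hausdorff_content_le)
      show "B \<subseteq> (\<Union>n. ?E n)"
      proof
        fix x assume "x \<in> B"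
        then obtain n where n: "x \<in> C n" using C(1) by blast
        have "C n \<inter> A = {}"
        proof (rule ccontr)
          assume "C n \<inter> A \<noteq> {}"
          then obtain a where a: "a \<in> C n" "a \<in> A" by blast
          have "dist a x \<le> diameter (C n)"
            using C(2) a(1) n by (rule diameter_bounded_bound)
          with C(3)[of n] sep[OF a(2) \<open>x \<in> B\<close>] that show False by simp
        qed
        with n have "x \<in> ?E n" by auto
        then show "x \<in> (\<Union>n. ?E n)" by blast
      qed
    qed (use C \<delta>0 in auto)
    ultimately have "hausdorff_content k \<delta> A + hausdorff_content k \<delta> B \<le>
        (\<Sum>n. hausdorff_gauge k (?D n)) + (\<Sum>n. hausdorff_gauge k (?E n))"
      by (rule add_mono)
    also have "\<dots> = (\<Sum>n. hausdorff_gauge k (?D n) + hausdorff_gauge k (?E n))"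
      by (rule suminf_add) auto
    also have "\<dots> = (\<Sum>n. hausdorff_gauge k (C n))"
      by (rule suminf_cong) auto
    finally show "hausdorff_content k \<delta> A + hausdorff_content k \<delta> B \<le> (\<Sum>n. hausdorff_gauge k (C n))" .
  qed
  have "hausdorff_outer k A + hausdorff_outer k B =
      (SUP \<delta>\<in>{0<..}. hausdorff_content k \<delta> A + hausdorff_content k \<delta> B)"
    unfolding hausdorff_outer_def
  proof (rule SUP_add_directed_ennreal[symmetric])
    fix i j :: real assume "i \<in> {0<..}" "j \<in> {0<..}"
    then show "\<exists>l\<in>{0<..}. hausdorff_content k i A + hausdorff_content k j B
        \<le> hausdorff_content k l A + hausdorff_content k l B"
      by (intro bexI[of _ "min i j"] add_mono hausdorff_content_antimono) auto
  qed
  also have "\<dots> \<le> hausdorff_outer k (A \<union> B)"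
  proof (rule SUP_least)
    fix \<delta> :: real assume "\<delta> \<in> {0<..}"
    then have pos: "0 < min \<delta> (e/2)" using e by simp
    have "hausdorff_content k \<delta> A + hausdorff_content k \<delta> B \<le>
        hausdorff_content k (min \<delta> (e/2)) A + hausdorff_content k (min \<delta> (e/2)) B"
      by (intro add_mono hausdorff_content_antimono) auto
    also have "\<dots> \<le> hausdorff_content k (min \<delta> (e/2)) (A \<union> B)"
      using e by (intro small) auto
    also have "\<dots> \<le> hausdorff_outer k (A \<union> B)"
      unfolding hausdorff_outer_def using pos by (intro SUP_upper) auto
    finally show "hausdorff_content k \<delta> A + hausdorff_content k \<delta> B \<le> hausdorff_outer k (A \<union> B)" .
  qed
  finally show ?thesis .
qed

lemma hausdorff_outer_sum_separated:
  fixes D :: "nat \<Rightarrow> 'a::metric_space set"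
  assumes sep: "\<And>i j. i < j \<Longrightarrow> j < n \<Longrightarrow> \<exists>e>0. \<forall>a\<in>D i. \<forall>b\<in>D j. e \<le> dist a b"
  shows "(\<Sum>i<n. hausdorff_outer k (D i)) \<le> hausdorff_outer k (\<Union>i<n. D i)"
  using assms
proof (induction n)
  case (Suc n)
  have "\<forall>i<n. \<exists>e>0. \<forall>a\<in>D i. \<forall>b\<in>D n. e \<le> dist a b"
    using Suc.prems by auto
  then obtain e where e: "\<And>i. i < n \<Longrightarrow> 0 < e i \<and> (\<forall>a\<in>D i. \<forall>b\<in>D n. e i \<le> dist a b)"
    by metis
  define e' where "e' = Min (insert 1 (e ` {..<n}))"
  have e': "0 < e'" "\<And>i. i < n \<Longrightarrow> e' \<le> e i"
    using e by (auto simp: e'_def)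
  have "(\<Sum>i<Suc n. hausdorff_outer k (D i)) \<le> hausdorff_outer k (\<Union>i<n. D i) + hausdorff_outer k (D n)"
    using Suc by (auto intro!: add_mono)
  also have "\<dots> \<le> hausdorff_outer k ((\<Union>i<n. D i) \<union> D n)"
    using e e' by (intro hausdorff_outer_separated[of e']) (auto intro: order_trans[OF e'(2)])
  also have "(\<Union>i<n. D i) \<union> D n = (\<Union>i<Suc n. D i)"
    by (auto simp: less_Suc_eq)
  finally show ?case .
qed auto

lemma closed_in_lambda_system_hausdorff_outer:
  fixes F :: "'a::metric_space set"
  assumes "closed F"
  shows "F \<in> lambda_system UNIV UNIV (hausdorff_outer k)"
proof (cases "F = {}")
  case True
  then show ?thesis by (simp add: lambda_system_def)
next
  case False
  have "hausdorff_outer k (F \<inter> X) + hausdorff_outer k (- F \<inter> X) \<le> hausdorff_outer k X"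
    (is "?H (F \<inter> X) + ?H ?Y \<le> ?H X") for X
  proof (cases "?H X = top")
    case True then show ?thesis by simp
  next
    case fin: False
    define d where "d x = infdist x F" for x
    have d_lip: "d x \<le> d y + dist x y" for x y
      unfolding d_def by (rule infdist_triangle)
    have d_F: "d x \<le> dist x y" if "y \<in> F" for x y
      unfolding d_def using that by (rule infdist_le)
    have d_pos: "0 < d x" if "x \<notin> F" for x
      using that assms False in_closed_iff_infdist_zero[of F x] infdist_nonneg[of x F]
      by (auto simp: d_def less_le)
    define Z where "Z n = {x \<in> X. 1 / Suc n \<le> d x}" for n
    define D where "D n = {x \<in> X. 1 / Suc (Suc n) \<le> d x \<and> d x < 1 / Suc n}" for n
    have sepD: "\<exists>e>0. \<forall>a\<in>D i. \<forall>b\<in>D j. e \<le> dist a b" if "Suc i < j" for i j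
    proof (intro exI[of _ "1 / Suc (Suc i) - 1 / Suc j"] conjI ballI)
      show "0 < 1 / real (Suc (Suc i)) - 1 / real (Suc j)"
        using that by (simp add: frac_less2)
      fix a b assume "a \<in> D i" "b \<in> D j"
      then show "1 / real (Suc (Suc i)) - 1 / real (Suc j) \<le> dist a b"
        using d_lip[of a b] by (auto simp: D_def)
    qed
    have parity: "(\<Sum>i<n. ?H (D (2 * i + c))) \<le> ?H X" for n c
    proof -
      have "(\<Sum>i<n. ?H (D (2 * i + c))) \<le> ?H (\<Union>i<n. D (2 * i + c))"
        by (intro hausdorff_outer_sum_separated sepD) auto
      also have "\<dots> \<le> ?H X"
        by (intro hausdorff_outer_mono) (auto simp: D_def)
      finally show ?thesis .
    qed
    have partial: "(\<Sum>i<n. ?H (D i)) \<le> ?H X + ?H X" for n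
    proof -
      have "(\<Sum>i<n. ?H (D i)) \<le> (\<Sum>i<2*n. ?H (D i))"
        by (intro sum_mono2) auto
      also have "\<dots> = (\<Sum>i<n. ?H (D (2 * i + 0))) + (\<Sum>i<n. ?H (D (2 * i + 1)))"
        by (induction n) (auto simp: algebra_simps)
      also have "\<dots> \<le> ?H X + ?H X"
        by (intro add_mono parity)
      finally show ?thesis .
    qed
    have "(\<Sum>i. ?H (D i)) \<le> ?H X + ?H X"
      by (intro suminf_le_const partial) auto
    then have sum_fin: "(\<Sum>i. ?H (D i)) \<noteq> top"
      using fin by (auto simp: top_unique)
    show ?thesis
    proof (rule ennreal_le_epsilon)
      fix e :: real assume "0 < e"
      have "(\<lambda>n. (\<Sum>i<n. ?H (D i)) + ennreal e) \<longlonglongrightarrow> (\<Sum>i. ?H (D i)) + ennreal e"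
        by (intro tendsto_add summable_LIMSEQ tendsto_const) auto
      moreover have "(\<Sum>i. ?H (D i)) < (\<Sum>i. ?H (D i)) + ennreal e"
        using sum_fin \<open>0 < e\<close> by (simp add: ennreal_add_left_cancel_less[of _ 0, simplified] less_top)
      ultimately have "eventually (\<lambda>n. (\<Sum>i. ?H (D i)) < (\<Sum>i<n. ?H (D i)) + ennreal e) sequentially"
        by (rule order_tendstoD)
      then obtain n where n: "(\<Sum>i. ?H (D i)) \<le> (\<Sum>i<n. ?H (D i)) + ennreal e"
        by (auto simp: eventually_sequentially intro: less_imp_le)
      have tail: "(\<Sum>i. ?H (D (i + n))) \<le> ennreal e"
      proof -
        have fin_n: "(\<Sum>i<n. ?H (D i)) \<noteq> top"
          by (rule neq_top_trans[OF _ partial]) (use fin in simp)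
        have "(\<Sum>i<n. ?H (D i)) + (\<Sum>i. ?H (D (i + n))) \<le> (\<Sum>i<n. ?H (D i)) + ennreal e"
          using n suminf_offset[of "\<lambda>i. ?H (D i)" n] by (simp add: add.commute)
        then show ?thesis
          using fin_n by (simp add: ennreal_add_left_cancel_le)
      qed
      have cover: "?Y \<subseteq> Z n \<union> (\<Union>i. D (i + n))"
      proof
        fix x assume x: "x \<in> ?Y"
        then have "0 < d x" using d_pos by auto
        then obtain m0 where m0: "1 / real (Suc m0) < d x"
          by (metis nat_approx_posE)
        define m where "m = (LEAST m. 1 / real (Suc m) \<le> d x)"
        have m: "1 / real (Suc m) \<le> d x"
          unfolding m_def using less_imp_le[OF m0] by (rule LeastI)
        show "x \<in> Z n \<union> (\<Union>i. D (i + n))"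
        proof (cases "m \<le> n")
          case True
          then have "1 / real (Suc n) \<le> 1 / real (Suc m)" by (simp add: field_simps)
          with m x show ?thesis by (auto simp: Z_def)
        next
          case False
          then have i: "m = Suc ((m - Suc n) + n)" by simp
          then obtain i where i: "m = Suc (i + n)" by blast
          have "\<not> 1 / real (Suc (i + n)) \<le> d x"
            using not_less_Least[of "i + n" "\<lambda>m. 1 / real (Suc m) \<le> d x"] i
            by (simp add: m_def)
          with m x i have "x \<in> D (i + n)" by (auto simp: D_def)
          then show ?thesis by blast
        qed
      qed
      have "?H ?Y \<le> ?H (Z n) + ?H (\<Union>i. D (i + n))"
        using hausdorff_outer_mono[OF cover] hausdorff_outer_Un order_trans by blast
      also have "\<dots> \<le> ?H (Z n) + ennreal e"
        by (intro add_left_mono order_trans[OF hausdorff_outer_UN tail])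
      finally have "?H (F \<inter> X) + ?H ?Y \<le> ?H (F \<inter> X) + ?H (Z n) + ennreal e"
        by (simp add: add_left_mono add.assoc)
      also have "?H (F \<inter> X) + ?H (Z n) \<le> ?H (F \<inter> X \<union> Z n)"
      proof (rule hausdorff_outer_separated[of "1 / Suc n"])
        fix a b assume "a \<in> F \<inter> X" "b \<in> Z n"
        then show "1 / real (Suc n) \<le> dist a b"
          using d_F[of a b] by (auto simp: Z_def dist_commute)
      qed auto
      also have "?H (F \<inter> X \<union> Z n) \<le> ?H X"
        by (intro hausdorff_outer_mono) (auto simp: Z_def)
      finally show "?H (F \<inter> X) + ?H ?Y \<le> ?H X + ennreal e"
        by (simp add: add_right_mono)
    qed
  qed
  moreover have "hausdorff_outer k X \<le> hausdorff_outer k (F \<inter> X) + hausdorff_outer k (- F \<inter> X)" for X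
    using hausdorff_outer_Un[of k "F \<inter> X" "- F \<inter> X"] by (simp add: Int_Un_distrib2[symmetric])
  ultimately show ?thesis
    by (auto simp: lambda_system_def Compl_eq_Diff_UNIV intro: antisym)
qed

lemma sets_hausdorff_measure [simp, measurable_cong]: "sets (hausdorff_measure k) = sets borel"
  and space_hausdorff_measure [simp]: "space (hausdorff_measure k) = UNIV"
  using sigma_algebra.sets_measure_of_eq[of UNIV "sets borel"] sets.sigma_algebra_axioms[of borel]
  by (auto simp: hausdorff_measure_def)

lemma emeasure_hausdorff_measure:
  assumes "A \<in> sets borel"
  shows "emeasure (hausdorff_measure k) A = hausdorff_outer k A"
proof -
  let ?L = "lambda_system UNIV UNIV (hausdorff_outer k :: 'a set \<Rightarrow> ennreal)"
  have ms: "measure_space UNIV ?L (hausdorff_outer k)"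
    using sigma_algebra.caratheodory_lemma[OF sigma_algebra_Pow, of "UNIV :: 'a set"]
      outer_measure_space_hausdorff_outer[of k] by simp
  then interpret L: sigma_algebra UNIV ?L
    by (simp add: measure_space_def)
  have "sets (borel :: 'a measure) \<subseteq> ?L"
    unfolding borel_eq_closed
    using closed_in_lambda_system_hausdorff_outer[of _ k]
    by (auto intro!: L.sigma_sets_subset)
  then have "measure_space UNIV (sets borel) (hausdorff_outer k :: 'a set \<Rightarrow> ennreal)"
    using ms sets.sigma_algebra_axioms[of "borel :: 'a measure"]
    by (auto simp: measure_space_def positive_def countably_additive_def subset_eq)
  then show ?thesis
    using assms unfolding hausdorff_measure_def
    by (intro emeasure_measure_of_sigma)
       (auto simp: measure_space_def)
qed

end

theory Submission
  imports Defs
begin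

text \<open>It suffices that \<open>E |I - y|\<^sup>p \<le> E |B - y|\<^sup>p\<close> for every point \<open>y\<close>: replace \<open>I\<^sub>1\<close> and \<open>I\<^sub>2\<close>
  by \<open>B\<^sub>1\<close> and \<open>B\<^sub>2\<close> one after the other.

  For a polytope circumscribed about a sphere with centre \<open>c\<close>, the cone with apex \<open>c\<close> over a piece of
  the boundary has volume proportional to the surface measure of the piece. Hence the radial
  projection of \<open>I\<close> to the boundary is distributed like \<open>B\<close> and is independent of the Minkowski
  functional of \<open>I\<close>; the inequality follows by convexity along rays and Jensen's inequality at
  \<open>c = E B\<close>. The proportionality comes from uniqueness of translation-invariant measures on a hyperplane.

  In the plane \<open>|x|\<^sup>p\<close> is, up to a constant, the average of \<open>|x \<bullet> w|\<^sup>p\<close> over the unit ball, so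
  that only the projections of \<open>I\<close> and \<open>B\<close> to a line matter. These have equal means, and their
  distribution functions cross exactly once, since on the side where the width of \<open>K\<close> decreases the ratio
  of arc length to area of the caps of \<open>K\<close> increases. So the projections are in convex order.\<close>

text \<open>Hausdorff measure is accessible only through covers, so the proof avoids computing it.
  For polytopes its isometry invariance does the work. Cone volume and surface measure, as functions
  of a piece of a facet hyperplane, are both translation invariant, because translating the base of
  a cone shears the cone; hence they are proportional. All facets lie at the same distance from the
  centre, so a reflection exchanging two normals shows that the factor is the same for all facets.
  That the boundary has positive finite measure is read off from the law of \<open>B\<close> being a
  probability measure.

  In the plane lengths must be compared with areas, and two one-sided bounds suffice: projection
  onto a chord bounds an arc from below, a Lipschitz parametrisation from above. Both are linearised
  with the slope of the same supporting line at the cut, so that the estimates before and beyond the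
  cut fit together. To compare the caps at two cuts only the widths there matter: if the width does
  not grow from left to right, the right caps are compared, otherwise the left ones in a mirror
  image.\<close>

abbreviation H :: "nat \<Rightarrow> 'a::metric_space set \<Rightarrow> ennreal" where "H \<equiv> hausdorff_outer"

abbreviation vol :: "'a::euclidean_space set \<Rightarrow> ennreal" where "vol \<equiv> emeasure lborel"

abbreviation perp :: "'a::euclidean_space \<Rightarrow> 'a set" where "perp a \<equiv> {v. a \<bullet> v = 0}"

section \<open>Hausdorff measure and Lipschitz maps\<close>

lemma diameter_image_le:
  fixes f :: "'a::metric_space \<Rightarrow> 'b::metric_space"
  assumes lip: "\<And>x y. x \<in> A \<Longrightarrow> y \<in> A \<Longrightarrow> dist (f x) (f y) \<le> dist x y" and "bounded A"
  shows "bounded (f ` A) \<and> diameter (f ` A) \<le> diameter A"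
proof (cases "A = {}")
  case False
  then obtain a where a: "a \<in> A" by blast
  have le: "dist (f x) (f y) \<le> diameter A" if "x \<in> A" "y \<in> A" for x y
    using lip[OF that] diameter_bounded_bound[OF \<open>bounded A\<close> that] by simp
  then have "bounded (f ` A)"
    using a by (auto simp: bounded_def)
  moreover have "diameter (f ` A) \<le> diameter A"
    unfolding diameter_def[of "f ` A"] using a le by (auto intro!: cSUP_least)
  ultimately show ?thesis ..
qed simp

text \<open>The condition on empty sets is for \<open>k = 0\<close>: a singleton and the empty set
  have the same diameter, but gauges 1 and 0.\<close>

lemma hausdorff_gauge_mono_diameter:
  assumes "bounded C" "diameter C \<le> diameter D" "D = {} \<Longrightarrow> C = {}"
  shows "hausdorff_gauge k C \<le> hausdorff_gauge k D"
  using assms diameter_ge_0[OF assms(1)]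
  by (auto simp: hausdorff_gauge_def intro!: ennreal_leI mult_left_mono power_mono)

lemma hausdorff_outer_image_le:
  fixes f :: "'a::metric_space \<Rightarrow> 'b::metric_space"
  assumes lip: "\<And>x y. x \<in> A \<Longrightarrow> y \<in> A \<Longrightarrow> dist (f x) (f y) \<le> dist x y"
  shows "H k (f ` A) \<le> H k A"
proof -
  have "hausdorff_content k \<delta> (f ` A) \<le> hausdorff_content k \<delta> A" for \<delta>
    unfolding hausdorff_content_def[of k \<delta> A]
  proof (rule INF_greatest)
    fix C assume "C \<in> {C :: nat \<Rightarrow> 'a set. A \<subseteq> (\<Union>n. C n) \<and>
        (\<forall>n. bounded (C n) \<and> diameter (C n) \<le> \<delta>)}"
    then have C: "A \<subseteq> (\<Union>n. C n)" "\<And>n. bounded (C n)" "\<And>n. diameter (C n) \<le> \<delta>"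
      by auto
    have D: "bounded (f ` (C n \<inter> A)) \<and> diameter (f ` (C n \<inter> A)) \<le> diameter (C n)" for n
      using diameter_image_le[of "C n \<inter> A" f] lip C(2)[of n] diameter_subset[of "C n \<inter> A" "C n"]
      by (force intro: bounded_subset)
    \<comment> \<open>Cover sets are cut down to \<open>A\<close> before mapping, since
      \<open>f\<close> is controlled on \<open>A\<close> only.\<close>
    have "hausdorff_content k \<delta> (f ` A) \<le> (\<Sum>n. hausdorff_gauge k (f ` (C n \<inter> A)))"
    proof (rule hausdorff_content_le)
      show "f ` A \<subseteq> (\<Union>n. f ` (C n \<inter> A))"
        using C(1) by blast
      show "diameter (f ` (C n \<inter> A)) \<le> \<delta>" for n
        using D[of n] C(3)[of n] by simp
    qed (use D in simp)
    also have "\<dots> \<le> (\<Sum>n. hausdorff_gauge k (C n))"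
      using D by (intro suminf_le hausdorff_gauge_mono_diameter) auto
    finally show "hausdorff_content k \<delta> (f ` A) \<le> (\<Sum>n. hausdorff_gauge k (C n))" .
  qed
  then show ?thesis
    unfolding hausdorff_outer_def by (intro SUP_mono) auto
qed

lemma hausdorff_outer_isometric_image:
  fixes f :: "'a::metric_space \<Rightarrow> 'b::metric_space"
  assumes iso: "\<And>x y. x \<in> A \<Longrightarrow> y \<in> A \<Longrightarrow> dist (f x) (f y) = dist x y"
  shows "H k (f ` A) = H k A"
proof (rule antisym)
  show "H k (f ` A) \<le> H k A"
    using iso by (intro hausdorff_outer_image_le) auto
  have "inj_on f A"
    using iso by (auto simp: inj_on_def) (metis dist_eq_0_iff)
  then have "H k (inv_into A f ` f ` A) \<le> H k (f ` A)"
    using iso by (intro hausdorff_outer_image_le) (auto simp: inv_into_f_f)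
  then show "H k A \<le> H k (f ` A)"
    using \<open>inj_on f A\<close> by simp
qed

lemma hausdorff_content_singleton:
  assumes "0 < k" "0 \<le> \<delta>"
  shows "hausdorff_content k \<delta> {x} = 0"
proof -
  have "hausdorff_content k \<delta> {x} \<le> (\<Sum>n. hausdorff_gauge k {x})"
    using assms by (intro hausdorff_content_le) auto
  also have "\<dots> = 0"
    using assms by (simp add: hausdorff_gauge_def zero_power)
  finally show ?thesis by simp
qed

lemma hausdorff_outer_finite:
  assumes "0 < k" "finite A"
  shows "H k A = 0"
  using assms(2)
proof induction
  case (insert x A)
  have "H k {x} = 0"
    unfolding hausdorff_outer_def using assms(1) by (simp add: hausdorff_content_singleton)
  then show ?case
    using hausdorff_outer_Un[of k "{x}" A] insert by simp
qed simp

lemma hausdorff_gauge_Suc_0: "hausdorff_gauge (Suc 0) C = (if C = {} then 0 else ennreal (diameter C))"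
  by (simp add: hausdorff_gauge_def unit_ball_vol_1)

lemma hausdorff_outer_1_interval_le:
  fixes a b :: real
  assumes "a \<le> b"
  shows "H 1 {a..b} \<le> ennreal (b - a)"
  unfolding hausdorff_outer_def
proof (rule SUP_least)
  fix \<delta> :: real assume "\<delta> \<in> {0<..}"
  then have \<delta>: "0 < \<delta>" by simp
  \<comment> \<open>The strict inequality makes \<open>n\<close> positive even when
    \<open>a = b\<close>, so the interval can be cut into \<open>n\<close> equal pieces.\<close>
  obtain n :: nat where n: "(b - a) / \<delta> < n" using reals_Archimedean2 by blast
  define e where "e = (b - a) / n"
  have n0: "0 < n" using n assms \<delta> by (cases n) (auto simp: field_simps)
  then have e: "0 \<le> e" "e \<le> \<delta>" "n * e = b - a"
    using n assms \<delta> by (auto simp: e_def field_simps)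
  define C where "C i = (if i < n then {a + i * e .. a + (i + 1) * e} else {})" for i :: nat
  have diam: "diameter (C i) = (if i < n then e else 0)" for i
    using e by (auto simp: C_def algebra_simps)
  have "{a..b} \<subseteq> (\<Union>i. C i)"
  proof
    fix x assume x: "x \<in> {a..b}"
    define P where "P i \<longleftrightarrow> x \<le> a + (real i + 1) * e" for i :: nat
    have "P (n - 1)" using e(3) x n0 by (auto simp: P_def of_nat_diff algebra_simps)
    define i where "i = (LEAST i. P i)"
    have Pi: "P i" unfolding i_def using \<open>P (n - 1)\<close> by (rule LeastI)
    have "i \<le> n - 1" unfolding i_def using \<open>P (n - 1)\<close> by (rule Least_le)
    have "a + i * e \<le> x"
    proof (cases i)
      case 0 then show ?thesis using x by simp
    next
      case (Suc j)
      then have "\<not> P j" using not_less_Least[of j P] by (auto simp: i_def)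
      then show ?thesis using Suc by (simp add: P_def algebra_simps)
    qed
    moreover have "x \<le> a + (i + 1) * e"
      using Pi by (simp add: P_def add.commute)
    ultimately have "x \<in> C i"
      using \<open>i \<le> n - 1\<close> n0 by (simp add: C_def)
    then show "x \<in> (\<Union>i. C i)" by blast
  qed
  then have "hausdorff_content 1 \<delta> {a..b} \<le> (\<Sum>i. hausdorff_gauge 1 (C i))"
    using e \<delta> diam by (intro hausdorff_content_le) (auto simp: C_def)
  also have "\<dots> = (\<Sum>i<n. hausdorff_gauge 1 (C i))"
    by (intro suminf_finite) (auto simp: C_def)
  also have "\<dots> \<le> (\<Sum>i<n. ennreal e)"
    using diam by (intro sum_mono) (auto simp: hausdorff_gauge_Suc_0)
  also have "\<dots> = ennreal (b - a)"
    using e by (simp add: ennreal_of_nat_eq_real_of_nat flip: ennreal_mult)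
  finally show "hausdorff_content 1 \<delta> {a..b} \<le> ennreal (b - a)" .
qed

text \<open>A bounded set of reals lies in the compact interval from its infimum to its supremum,
  which is no longer than its diameter. These intervals, unlike the cover sets, are measurable, and
  countable subadditivity of Lebesgue measure applies to them. Scale 1 is enough, because the outer
  measure is a supremum over all scales.\<close>

lemma hausdorff_outer_1_ge_length:
  fixes a b :: real
  assumes "a \<le> b" "{a<..<b} \<subseteq> A"
  shows "ennreal (b - a) \<le> H 1 A"
proof -
  have "ennreal (b - a) \<le> hausdorff_content 1 1 A"
    unfolding hausdorff_content_def
  proof (rule INF_greatest)
    fix C assume "C \<in> {C :: nat \<Rightarrow> real set. A \<subseteq> (\<Union>n. C n) \<and> (\<forall>n. bounded (C n) \<and> diameter (C n) \<le> 1)}"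
    then have C: "A \<subseteq> (\<Union>n. C n)" "\<And>n. bounded (C n)"
      by auto
    define D where "D n = (if C n = {} then {} else {Inf (C n)..Sup (C n)})" for n
    have bdd: "bdd_below (C n)" "bdd_above (C n)" for n
      using C(2) by (auto intro: bounded_imp_bdd_below bounded_imp_bdd_above)
    have CD: "C n \<subseteq> D n" for n
      using bdd[of n] by (auto simp: D_def intro: cInf_lower cSup_upper)
    have D: "vol (D n) \<le> hausdorff_gauge 1 (C n)" for n
    proof (cases "C n = {}")
      case False
      then have le: "Inf (C n) \<le> Sup (C n)"
        using bdd by (meson cInf_le_cSup)
      have "Sup (C n) - Inf (C n) \<le> diameter (C n)"
      proof -
        have "y \<le> Inf (C n) + diameter (C n)" if y: "y \<in> C n" for y
        proof -
          have "y - diameter (C n) \<le> x" if "x \<in> C n" for x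
            using diameter_bounded_bound[OF C(2) y that] by (simp add: dist_real_def)
          then have "y - diameter (C n) \<le> Inf (C n)"
            using False by (intro cInf_greatest)
          then show ?thesis by simp
        qed
        then have "Sup (C n) \<le> Inf (C n) + diameter (C n)"
          using False by (intro cSup_least)
        then show ?thesis by simp
      qed
      moreover have "vol (D n) = ennreal (Sup (C n) - Inf (C n))"
        using False le by (simp add: D_def)
      ultimately show ?thesis
        using False by (simp add: hausdorff_gauge_Suc_0 ennreal_leI)
    qed (simp add: D_def)
    have "ennreal (b - a) = vol {a<..<b}"
      using assms by simp
    also have "\<dots> \<le> vol (\<Union>n. D n)"
    proof (rule emeasure_mono)
      show "{a<..<b} \<subseteq> (\<Union>n. D n)"
        using assms C(1) CD by blast
    qed (auto simp: D_def)
    also have "\<dots> \<le> (\<Sum>n. vol (D n))"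
      by (intro emeasure_subadditive_countably) (auto simp: D_def)
    also have "\<dots> \<le> (\<Sum>n. hausdorff_gauge 1 (C n))"
      using D by (intro suminf_le) auto
    finally show "ennreal (b - a) \<le> (\<Sum>n. hausdorff_gauge 1 (C n))" .
  qed
  also have "\<dots> \<le> H 1 A"
    unfolding hausdorff_outer_def by (intro SUP_upper) auto
  finally show ?thesis .
qed

section \<open>Translation-invariant measures\<close>

text \<open>The classical uniqueness argument for Haar measure. The double integral of
  \<open>indicator A x * indicator B (x + y)\<close> is evaluated once with \<open>y\<close> first,
  using the invariance of \<open>\<nu>\<close>, and once after shifting \<open>x\<close> by
  \<open>y\<close>, using the invariance of \<open>\<mu>\<close> and the symmetry of
  \<open>A\<close>. The measures live on the whole space and are concentrated on \<open>V\<close>,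
  so no separate type for the subspace is required; the product form avoids dividing by a value that
  may be 0 or infinite.\<close>

lemma invariant_measures_proportional:
  fixes \<mu> \<nu> :: "'a::euclidean_space measure"
  assumes sets_\<mu> [measurable_cong]: "sets \<mu> = sets borel" and sets_\<nu> [measurable_cong]: "sets \<nu> = sets borel"
    and "sigma_finite_measure \<mu>" and "sigma_finite_measure \<nu>"
    and V: "subspace V"
    and AE_\<mu>: "AE x in \<mu>. x \<in> V" and AE_\<nu>: "AE x in \<nu>. x \<in> V"
    and inv_\<mu>: "\<And>v C. v \<in> V \<Longrightarrow> C \<in> sets borel \<Longrightarrow> emeasure \<mu> ((\<lambda>x. x + v) -` C) = emeasure \<mu> C"
    and inv_\<nu>: "\<And>v C. v \<in> V \<Longrightarrow> C \<in> sets borel \<Longrightarrow> emeasure \<nu> ((\<lambda>x. x + v) -` C) = emeasure \<nu> C"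
    and A [measurable]: "A \<in> sets borel" and sym: "\<And>x. x \<in> A \<Longrightarrow> - x \<in> A"
    and B [measurable]: "B \<in> sets borel"
  shows "emeasure \<mu> A * emeasure \<nu> B = emeasure \<mu> B * emeasure \<nu> A"
proof -
  interpret \<mu>: sigma_finite_measure \<mu> by fact
  interpret \<nu>: sigma_finite_measure \<nu> by fact
  interpret pair_sigma_finite \<mu> \<nu> ..
  have space: "space \<mu> = UNIV" "space \<nu> = UNIV"
    using sets_eq_imp_space_eq[OF sets_\<mu>] sets_eq_imp_space_eq[OF sets_\<nu>] by auto
  have neg: "- v \<in> V" if "v \<in> V" for v
    using V that by (simp add: subspace_neg)
  have "emeasure \<mu> A * emeasure \<nu> B = (\<integral>\<^sup>+x. indicator A x * emeasure \<nu> B \<partial>\<mu>)"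
    by (simp add: nn_integral_multc sets_\<mu>)
  also have "\<dots> = (\<integral>\<^sup>+x. \<integral>\<^sup>+y. indicator A x * indicator B (x + y) \<partial>\<nu> \<partial>\<mu>)"
  proof (rule nn_integral_cong_AE)
    show "AE x in \<mu>. indicator A x * emeasure \<nu> B = (\<integral>\<^sup>+y. indicator A x * indicator B (x + y) \<partial>\<nu>)"
      using AE_\<mu>
    proof eventually_elim
      case (elim x)
      have "(\<integral>\<^sup>+y. indicator A x * indicator B (x + y) \<partial>\<nu>) =
          indicator A x * (\<integral>\<^sup>+y. indicator ((\<lambda>y. y + x) -` B) y \<partial>\<nu>)"
        by (subst nn_integral_cmult[symmetric]) (auto intro!: nn_integral_cong simp: indicator_def add.commute)
      also have "(\<integral>\<^sup>+y. indicator ((\<lambda>y. y + x) -` B) y \<partial>\<nu>) = emeasure \<nu> ((\<lambda>y. y + x) -` B)"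
        by (rule nn_integral_indicator) (use measurable_sets_borel[of "\<lambda>y. y + x" borel B] in \<open>simp add: sets_\<nu>\<close>)
      finally show ?case
        using inv_\<nu>[OF elim B] by simp
    qed
  qed
  also have "\<dots> = (\<integral>\<^sup>+y. \<integral>\<^sup>+x. indicator A x * indicator B (x + y) \<partial>\<mu> \<partial>\<nu>)"
    by (rule Fubini'[symmetric]) simp
  also have "\<dots> = (\<integral>\<^sup>+y. \<integral>\<^sup>+x. indicator A (x - y) * indicator B x \<partial>\<mu> \<partial>\<nu>)"
  proof (rule nn_integral_cong_AE)
    show "AE y in \<nu>. (\<integral>\<^sup>+x. indicator A x * indicator B (x + y) \<partial>\<mu>) =
        (\<integral>\<^sup>+x. indicator A (x - y) * indicator B x \<partial>\<mu> :: ennreal)"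
      using AE_\<nu>
    proof eventually_elim
      case (elim y)
      have shift: "distr \<mu> borel (\<lambda>x. x + y) = \<mu>"
      proof (rule measure_eqI)
        fix C assume "C \<in> sets (distr \<mu> borel (\<lambda>x. x + y))"
        then show "emeasure (distr \<mu> borel (\<lambda>x. x + y)) C = emeasure \<mu> C"
          using inv_\<mu>[OF elim] by (simp add: emeasure_distr space)
      qed (simp add: sets_\<mu>)
      have "(\<integral>\<^sup>+x. indicator A (x - y) * indicator B x \<partial>\<mu> :: ennreal) =
          (\<integral>\<^sup>+x. indicator A (x - y) * indicator B x \<partial>distr \<mu> borel (\<lambda>x. x + y))"
        by (simp only: shift)
      also have "\<dots> = (\<integral>\<^sup>+x. indicator A x * indicator B (x + y) \<partial>\<mu>)"
        by (subst nn_integral_distr) auto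
      finally show ?case ..
    qed
  qed
  also have "\<dots> = (\<integral>\<^sup>+x. \<integral>\<^sup>+y. indicator A (x - y) * indicator B x \<partial>\<nu> \<partial>\<mu>)"
    by (rule Fubini') simp
  also have "\<dots> = (\<integral>\<^sup>+x. emeasure \<nu> A * indicator B x \<partial>\<mu>)"
  proof (rule nn_integral_cong_AE)
    show "AE x in \<mu>. (\<integral>\<^sup>+y. indicator A (x - y) * indicator B x \<partial>\<nu>) = emeasure \<nu> A * indicator B x"
      using AE_\<mu>
    proof eventually_elim
      case (elim x)
      have eq: "x - y \<in> A \<longleftrightarrow> y + - x \<in> A" for y
        using sym[of "x - y"] sym[of "y - x"] by auto
      have "(\<integral>\<^sup>+y. indicator A (x - y) * indicator B x \<partial>\<nu>) =
          (\<integral>\<^sup>+y. indicator ((\<lambda>y. y + - x) -` A) y \<partial>\<nu>) * indicator B x"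
        by (subst nn_integral_multc[symmetric])
          (auto intro!: nn_integral_cong simp: indicator_def eq simp del: add_uminus_conv_diff)
      also have "(\<integral>\<^sup>+y. indicator ((\<lambda>y. y + - x) -` A) y \<partial>\<nu>) = emeasure \<nu> ((\<lambda>y. y + - x) -` A)"
        by (rule nn_integral_indicator) (use measurable_sets_borel[of "\<lambda>y. y + - x" borel A] in \<open>simp add: sets_\<nu>\<close>)
      finally show ?case
        using inv_\<nu>[OF neg[OF elim] A] by simp
    qed
  qed
  also have "\<dots> = emeasure \<mu> B * emeasure \<nu> A"
    by (simp add: nn_integral_multc mult.commute sets_\<mu>)
  finally show ?thesis .
qed

section \<open>Lebesgue measure under linear isometries and shears\<close>

lemma emeasure_lborel_translate:
  fixes v :: "'a::euclidean_space"
  assumes "C \<in> sets borel"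
  shows "vol ((\<lambda>x. x + v) -` C) = vol C"
proof -
  have "vol ((\<lambda>x. x + v) -` C) = emeasure (distr lborel borel ((+) v)) C"
    using assms by (subst emeasure_distr) (auto simp: vimage_def add.commute)
  then show ?thesis by (simp add: lborel_distr_plus)
qed

text \<open>Replaces a determinant: the image of Lebesgue measure under \<open>f\<close> is
  translation invariant, hence proportional to Lebesgue measure, and the unit ball fixes the factor.
  The types on the two sides may differ, which allows a passage from an abstract plane to pairs of
  reals.\<close>

lemma emeasure_lborel_linear_vimage:
  fixes f :: "'a::euclidean_space \<Rightarrow> 'b::euclidean_space"
  assumes f: "linear f" and f': "linear f'" and inv: "\<And>x. f' (f x) = x" "\<And>y. f (f' y) = y"
    and B: "B \<in> sets borel"
  shows "vol (f -` B) * vol (ball (0::'b) 1) =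
    vol (f -` ball 0 1) * vol B"
proof -
  have cont: "continuous_on UNIV f" "continuous_on UNIV f'"
    using f f' by (auto simp: linear_continuous_on linear_conv_bounded_linear)
  then have [measurable]: "f \<in> borel_measurable borel" "f' \<in> borel_measurable borel"
    by (auto intro: borel_measurable_continuous_onI)
  let ?\<nu> = "distr lborel borel f"
  have \<nu>: "emeasure ?\<nu> C = vol (f -` C)" if "C \<in> sets borel" for C
    using that by (simp add: emeasure_distr)
  have fin: "emeasure ?\<nu> (cball 0 r) < \<infinity>" for r
  proof -
    have "f -` cball 0 r = f' ` cball 0 r"
      using inv by (auto intro: rev_image_eqI)
    moreover have "bounded (f' ` cball 0 r)"
      using f' by (intro bounded_linear_image) (auto simp: linear_conv_bounded_linear)
    ultimately show ?thesis
      using emeasure_bounded_finite by (simp add: \<nu>)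
  qed
  have "vol (ball (0::'b) 1) * emeasure ?\<nu> B = vol B * emeasure ?\<nu> (ball 0 1)"
  proof (rule invariant_measures_proportional[where V = UNIV])
    show "sigma_finite_measure ?\<nu>"
    proof (rule sigma_finite_measure.intro)
      have "(\<Union>n::nat. cball 0 (real n)) = (UNIV :: 'b set)"
        using real_arch_simple by auto
      then show "\<exists>A. countable A \<and> A \<subseteq> sets ?\<nu> \<and> \<Union> A = space ?\<nu> \<and> (\<forall>a\<in>A. emeasure ?\<nu> a \<noteq> \<infinity>)"
        using fin by (intro exI[of _ "range (\<lambda>n::nat. cball 0 (real n))"]) (auto simp: less_top)
    qed
    show "emeasure ?\<nu> ((\<lambda>x. x + v) -` C) = emeasure ?\<nu> C" if C [measurable]: "C \<in> sets borel" for v C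
    proof -
      have "(\<lambda>x. x + v) -` C \<in> sets borel"
        using measurable_sets_borel[of "\<lambda>y. y + v" borel C] by simp
      then have "emeasure ?\<nu> ((\<lambda>x. x + v) -` C) = vol ((\<lambda>x. x + f' v) -` f -` C)"
        using inv by (subst \<nu>) (auto simp: vimage_def linear_add[OF f])
      also have "\<dots> = emeasure ?\<nu> C"
        using C measurable_sets_borel[of f borel C] by (simp add: emeasure_lborel_translate \<nu>)
      finally show ?thesis .
    qed
  qed (use B in \<open>auto simp: lborel.sigma_finite_measure_axioms emeasure_lborel_translate\<close>)
  then show ?thesis
    using B by (simp add: \<nu> mult.commute)
qed

lemma emeasure_lborel_ball_pos:
  assumes "0 < r"
  shows "0 < vol (ball c r)"
  using assms by (simp add: emeasure_ball unit_ball_vol_pos)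

lemma emeasure_lborel_isometry_vimage:
  fixes f :: "'a::euclidean_space \<Rightarrow> 'b::euclidean_space"
  assumes f: "linear f" and f': "linear f'" and inv: "\<And>x. f' (f x) = x" "\<And>y. f (f' y) = y"
    and norm: "\<And>x. norm (f x) = norm x" and dim: "DIM('a) = DIM('b)"
    and B: "B \<in> sets borel"
  shows "vol (f -` B) = vol B"
proof -
  have "vol (f -` B) * vol (ball (0::'b) 1) =
    vol (f -` ball 0 1) * vol B"
    by (rule emeasure_lborel_linear_vimage[OF f f' inv B])
  moreover have "f -` ball 0 1 = ball 0 1"
    using norm by auto
  moreover have "vol (ball (0::'a) 1) = vol (ball (0::'b) 1)"
    using dim by (simp add: emeasure_ball)
  ultimately have "vol (ball (0::'b) 1) * vol (f -` B) = vol (ball (0::'b) 1) * vol B"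
    by (simp add: mult.commute)
  then show ?thesis
    using emeasure_lborel_ball_pos[of 1 "0::'b"] emeasure_lborel_ball_finite[of "0::'b" 1]
    by (subst (asm) ennreal_mult_cancel_left) auto
qed

text \<open>The Householder reflection in the hyperplane orthogonal to \<open>n\<close>. For
  \<open>n = 0\<close> it is the identity.\<close>

definition reflect_along :: "'a::euclidean_space \<Rightarrow> 'a \<Rightarrow> 'a" where
  "reflect_along n x = x - (2 * (x \<bullet> n) / (n \<bullet> n)) *\<^sub>R n"

lemma linear_reflect_along: "linear (reflect_along n)"
  by (rule linearI) (auto simp: reflect_along_def algebra_simps inner_add_left add_divide_distrib)

lemma reflect_along_involution [simp]: "reflect_along n (reflect_along n x) = x"
  by (cases "n = 0") (auto simp: reflect_along_def algebra_simps inner_diff_left)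

lemma inner_reflect_along [simp]: "reflect_along n x \<bullet> reflect_along n y = x \<bullet> y"
  by (cases "n = 0") (auto simp: reflect_along_def algebra_simps inner_diff_left inner_diff_right inner_commute)

lemma norm_reflect_along [simp]: "norm (reflect_along n x) = norm x"
  by (simp add: norm_eq_sqrt_inner)

lemma emeasure_lborel_reflect_along_vimage:
  "B \<in> sets borel \<Longrightarrow> vol (reflect_along n -` B) = vol B"
  by (rule emeasure_lborel_isometry_vimage[where f' = "reflect_along n"]) (auto simp: linear_reflect_along)

text \<open>For vectors of equal norm the square of \<open>norm (a - b)\<close> is
  \<open>2 * (a \<bullet> (a - b))\<close>, so exactly \<open>a - b\<close> is subtracted from
  \<open>a\<close>. Such reflections take the place of rotations throughout.\<close>

lemma reflect_along_swap:
  assumes "norm a = norm b"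
  shows "reflect_along (a - b) a = b"
proof (cases "a = b")
  case True then show ?thesis by (simp add: reflect_along_def)
next
  case False
  have "a \<bullet> a = b \<bullet> b" using assms by (simp add: norm_eq_sqrt_inner)
  then have "(a - b) \<bullet> (a - b) = 2 * (a \<bullet> (a - b))"
    by (simp add: inner_diff_left inner_diff_right inner_commute)
  moreover have "(a - b) \<bullet> (a - b) \<noteq> 0" using False by simp
  ultimately have "2 * (a \<bullet> (a - b)) / ((a - b) \<bullet> (a - b)) = 1"
    by (metis divide_self)
  then show ?thesis by (simp only: reflect_along_def scaleR_one diff_diff_eq2 add_diff_cancel_left')
qed

text \<open>The scaling constants of the shears along \<open>v\<close> and \<open>- v\<close> are reciprocal, and they are equal
  because a reflection conjugates the two shears.\<close>

lemma emeasure_lborel_shear_vimage: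
  fixes a v :: "'a::euclidean_space"
  assumes orth: "a \<bullet> v = 0" and B: "B \<in> sets borel"
  shows "vol ((\<lambda>x. x + (a \<bullet> x) *\<^sub>R v) -` B) = vol B"
proof (cases "a = 0")
  case False
  define s where "s t x = x + (t * (a \<bullet> x)) *\<^sub>R v" for t :: real and x
  have lin: "linear (s t)" for t
    by (rule linearI) (auto simp: s_def algebra_simps inner_add_right)
  have inv: "s (- t) (s t x) = x" for t x
    using orth by (simp add: s_def inner_add_right)
  have meas: "s t -` C \<in> sets borel" if "C \<in> sets borel" for t C
    using measurable_sets_borel[OF borel_measurable_continuous_onI that, of "s t"] lin[of t]
    by (simp add: linear_continuous_on linear_conv_bounded_linear)
  let ?b = "ball (0::'a) 1"
  let ?k = "\<lambda>t. vol (s t -` ?b)"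
  have b: "vol ?b \<noteq> 0" "vol ?b \<noteq> top"
    using emeasure_lborel_ball_pos[of 1 "0::'a"] emeasure_lborel_ball_finite[of "0::'a" 1] by auto
  have scale: "vol (s t -` C) * vol ?b = ?k t * vol C"
    if "C \<in> sets borel" for t C
    by (rule emeasure_lborel_linear_vimage[OF lin[of t] lin[of "- t"] inv inv[of "- t", simplified] that])
  have conj: "s (- t) x = reflect_along a (s t (reflect_along a x))" for t x
    using orth False by (simp add: s_def reflect_along_def inner_diff_left inner_diff_right inner_add_left
        inner_commute algebra_simps)
  have "s (- 1) -` ?b = reflect_along a -` s 1 -` ?b"
    using norm_reflect_along by (auto simp: conj)
  then have "?k (- 1) = ?k 1"
    using emeasure_lborel_reflect_along_vimage[OF meas[of ?b 1], of a] by simp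
  moreover have "s (- 1) -` s 1 -` ?b = ?b"
    using inv[of "- 1"] by auto
  ultimately have "?k 1 * ?k 1 = vol ?b * vol ?b"
    using scale[OF meas[of ?b 1], of "- 1"] by simp
  moreover have "?k 1 \<noteq> top"
  proof -
    have "s 1 -` ?b = s (- 1) ` ?b"
      using inv[of 1] inv[of "- 1"] by (auto intro: rev_image_eqI)
    moreover have "bounded (s (- 1) ` ?b)"
      using lin by (intro bounded_linear_image) (auto simp: linear_conv_bounded_linear)
    ultimately show ?thesis
      using emeasure_bounded_finite[of "s (- 1) ` ?b"] by simp
  qed
  ultimately have "?k 1 = vol ?b"
    using b by (cases "?k 1"; cases "vol ?b")
      (auto simp: ennreal_mult[symmetric] intro: power2_eq_imp_eq simp: power2_eq_square)
  then have "vol ?b * vol (s 1 -` B) = vol ?b * vol B"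
    using scale[OF B, of 1] by (simp add: mult.commute)
  then have "vol (s 1 -` B) = vol B"
    using b by (subst (asm) ennreal_mult_cancel_left) auto
  then show ?thesis by (simp add: s_def[abs_def])
qed simp

section \<open>Cones over pieces of a hyperplane\<close>

text \<open>The cone with apex 0 and height \<open>r\<close> in direction \<open>a\<close>, without
  its apex. The base is described relative to its centre \<open>r *\<^sub>R a\<close>, which moves
  it into the linear hyperplane \<open>perp a\<close>, where translations act.\<close>

definition cone_over :: "'a::euclidean_space \<Rightarrow> real \<Rightarrow> 'a set \<Rightarrow> 'a set" where
  "cone_over a r C = {x. 0 < a \<bullet> x \<and> a \<bullet> x \<le> r \<and> (r / (a \<bullet> x)) *\<^sub>R x - r *\<^sub>R a \<in> C}"

lemma cone_over_measurable [measurable]: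
  assumes [measurable]: "C \<in> sets borel"
  shows "cone_over a r C \<in> sets borel"
  unfolding cone_over_def by measurable

lemma bounded_cone_over:
  assumes "norm a = 1" "0 < r" "bounded C"
  shows "bounded (cone_over a r C)"
proof -
  obtain b where b: "\<And>y. y \<in> C \<Longrightarrow> norm y \<le> b" using assms by (auto simp: bounded_iff)
  have "norm x \<le> b + r" if "x \<in> cone_over a r C" for x
  proof -
    let ?y = "(r / (a \<bullet> x)) *\<^sub>R x - r *\<^sub>R a"
    have x: "0 < a \<bullet> x" "a \<bullet> x \<le> r" "norm ?y \<le> b"
      using that b by (auto simp: cone_over_def)
    have "norm x \<le> norm ((r / (a \<bullet> x)) *\<^sub>R x)"
      using x assms(2) mult_right_mono[of 1 "r / (a \<bullet> x)" "norm x"] by simp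
    also have "\<dots> = norm (?y + r *\<^sub>R a)" by simp
    also have "\<dots> \<le> norm ?y + norm (r *\<^sub>R a)" by (rule norm_triangle_ineq)
    finally show ?thesis using x assms by simp
  qed
  then show ?thesis by (auto simp: bounded_iff)
qed

lemma sigma_finite_measure_cballI:
  assumes "sets M = sets (borel :: 'a::euclidean_space measure)"
    and "\<And>n::nat. emeasure M (cball 0 n) \<noteq> \<infinity>"
  shows "sigma_finite_measure M"
proof (rule sigma_finite_measure.intro)
  have "(\<Union>n::nat. cball 0 (real n)) = (UNIV :: 'a set)"
    using real_arch_simple by auto
  moreover have "space M = UNIV"
    using sets_eq_imp_space_eq[OF assms(1)] by simp
  ultimately show "\<exists>A. countable A \<and> A \<subseteq> sets M \<and> \<Union> A = space M \<and> (\<forall>a\<in>A. emeasure M a \<noteq> \<infinity>)"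
    using assms by (intro exI[of _ "range (\<lambda>n::nat. cball 0 (real n))"]) auto
qed

lemma hausdorff_outer_translate: "H k ((+) v ` C) = H k (C :: 'a::euclidean_space set)"
  by (rule hausdorff_outer_isometric_image) simp

text \<open>By compactness a large disc is covered by finitely many translates of a small one. The
  small disc will come from inside a facet, so that finiteness is inherited from the boundary of the
  polytope.\<close>

lemma hausdorff_outer_hyperplane_cball_finite:
  fixes a :: "'a::euclidean_space"
  assumes "0 < e" and fin: "H k (perp a \<inter> ball 0 e) < \<infinity>"
  shows "H k (perp a \<inter> cball 0 R) < \<infinity>"
proof -
  let ?V = "perp a"
  have "compact (?V \<inter> cball 0 R)"
    by (intro closed_Int_compact closed_hyperplane compact_cball)
  moreover have "?V \<inter> cball 0 R \<subseteq> (\<Union>x\<in>?V \<inter> cball 0 R. ball x e)"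
    using \<open>0 < e\<close> by auto
  ultimately obtain D where D: "D \<subseteq> ?V \<inter> cball 0 R" "finite D" "?V \<inter> cball 0 R \<subseteq> (\<Union>x\<in>D. ball x e)"
    by (elim compactE_image) auto
  have each: "H k (?V \<inter> ball x e) < \<infinity>" if "x \<in> D" for x
  proof -
    have "?V \<inter> ball x e = (+) x ` (?V \<inter> ball 0 e)"
    proof (intro equalityI subsetI)
      fix y assume "y \<in> ?V \<inter> ball x e"
      then have "y - x \<in> ?V \<inter> ball 0 e"
        using D(1) \<open>x \<in> D\<close> by (auto simp: inner_diff_right dist_norm norm_minus_commute)
      then show "y \<in> (+) x ` (?V \<inter> ball 0 e)" by (rule rev_image_eqI) simp
    qed (use D(1) \<open>x \<in> D\<close> in \<open>auto simp: inner_add_right dist_norm\<close>)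
    then show ?thesis using fin by (simp add: hausdorff_outer_translate)
  qed
  have "H k (\<Union>x\<in>D. ?V \<inter> ball x e) < \<infinity>"
    using \<open>finite D\<close> each
  proof (induction D)
    case (insert x D)
    have "H k (\<Union>y\<in>insert x D. ?V \<inter> ball y e) \<le>
        H k (?V \<inter> ball x e) + H k (\<Union>y\<in>D. ?V \<inter> ball y e)"
      using hausdorff_outer_Un by simp
    also have "\<dots> < \<infinity>" using insert by simp
    finally show ?case .
  qed simp
  moreover have "H k (?V \<inter> cball 0 R) \<le> H k (\<Union>x\<in>D. ?V \<inter> ball x e)"
    using D(3) by (intro hausdorff_outer_mono) auto
  ultimately show ?thesis by (rule order.strict_trans1[rotated])
qed

text \<open>At height \<open>a \<bullet> x\<close> the cone is the base shrunk by the factor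
  \<open>(a \<bullet> x) / r\<close>. Moving the base by \<open>v\<close> therefore moves this slice
  by the same fraction of \<open>v\<close>, which is a shear.\<close>

lemma cone_over_translate:
  assumes "0 < r" "norm a = 1" "a \<bullet> v = 0"
  shows "cone_over a r ((\<lambda>x. x + v) -` C) = (\<lambda>x. x + (a \<bullet> x) *\<^sub>R ((1 / r) *\<^sub>R v)) -` cone_over a r C"
proof -
  have "(r / (a \<bullet> x)) *\<^sub>R (x + (a \<bullet> x) *\<^sub>R ((1 / r) *\<^sub>R v)) - r *\<^sub>R a = (r / (a \<bullet> x)) *\<^sub>R x - r *\<^sub>R a + v"
    if "0 < a \<bullet> x" for x
    using that assms by (simp add: scaleR_add_right)
  then show ?thesis
    using assms by (auto simp: cone_over_def inner_add_right diff_add_eq)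
qed

text \<open>Both sides are translation-invariant measures on \<open>perp a\<close>: cone volume by
  shear invariance, Hausdorff measure by isometry invariance. The closed unit ball serves as the
  symmetric reference set.\<close>

lemma emeasure_cone_over_proportional:
  fixes a :: "'a::euclidean_space"
  assumes a: "norm a = 1" and r: "0 < r" and e: "0 < e"
    and fin: "H k (perp a \<inter> ball 0 e) < \<infinity>"
    and B [measurable]: "B \<in> sets borel" and BV: "B \<subseteq> perp a"
  shows "vol (cone_over a r B) * H k (perp a \<inter> cball 0 1) =
    vol (cone_over a r (cball 0 1)) * H k B"
proof -
  let ?V = "perp a"
  have V [measurable]: "?V \<in> sets borel"
    by (intro borel_closed closed_hyperplane)
  \<comment> \<open>Lebesgue measure of a slab, pushed to the hyperplane by central projection from
    the apex. The density removes the points at height 0 or below, where the projection makes no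
    sense.\<close>
  define \<mu> where "\<mu> = distr (density lborel (indicator {x. 0 < a \<bullet> x \<and> a \<bullet> x \<le> r})) borel
    (\<lambda>x. (r / (a \<bullet> x)) *\<^sub>R x - r *\<^sub>R a)"
  define \<nu> where "\<nu> = density (hausdorff_measure k) (indicator ?V)"
  have sets_eq [simp]: "sets \<mu> = sets borel" "sets \<nu> = sets borel"
    by (simp_all add: \<mu>_def \<nu>_def)
  have \<mu>: "emeasure \<mu> C = vol (cone_over a r C)" if [measurable]: "C \<in> sets borel" for C
  proof -
    let ?S = "{x. 0 < a \<bullet> x \<and> a \<bullet> x \<le> r}" and ?T = "(\<lambda>x. (r / (a \<bullet> x)) *\<^sub>R x - r *\<^sub>R a) -` C"
    have T [measurable]: "?T \<in> sets borel"
      using measurable_sets_borel[of "\<lambda>x. (r / (a \<bullet> x)) *\<^sub>R x - r *\<^sub>R a" borel C] by simp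
    have "emeasure \<mu> C = (\<integral>\<^sup>+x. indicator ?S x * indicator ?T x \<partial>lborel)"
      unfolding \<mu>_def by (subst emeasure_distr) (auto simp: emeasure_density)
    also have "\<dots> = (\<integral>\<^sup>+x. indicator (cone_over a r C) x \<partial>lborel)"
      by (intro nn_integral_cong) (auto simp: cone_over_def indicator_def)
    finally show ?thesis by simp
  qed
  have \<nu>: "emeasure \<nu> C = H k (?V \<inter> C)" if [measurable]: "C \<in> sets borel" for C
    unfolding \<nu>_def by (subst emeasure_density)
      (auto simp: emeasure_hausdorff_measure indicator_inter_arith[symmetric])
  have "emeasure \<mu> (cball 0 1) * emeasure \<nu> B = emeasure \<mu> B * emeasure \<nu> (cball 0 1)"
  proof (rule invariant_measures_proportional[where V = ?V])
    show "sigma_finite_measure \<mu>"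
      using emeasure_bounded_finite[OF bounded_cone_over[OF a r bounded_cball]]
      by (intro sigma_finite_measure_cballI) (auto simp: \<mu> less_top)
    show "sigma_finite_measure \<nu>"
      using hausdorff_outer_hyperplane_cball_finite[OF e fin]
      by (intro sigma_finite_measure_cballI) (auto simp: \<nu> less_top)
    have "cone_over a r (- ?V) = {}"
      using a by (auto simp: cone_over_def inner_diff_right dot_square_norm)
    then have "emeasure \<mu> (- ?V) = 0"
      by (simp add: \<mu>)
    then show "AE x in \<mu>. x \<in> ?V"
      by (intro AE_I[of _ _ "- ?V"]) auto
    have "emeasure \<nu> (- ?V) = 0"
      by (simp add: \<nu>)
    then show "AE x in \<nu>. x \<in> ?V"
      by (intro AE_I[of _ _ "- ?V"]) auto
    fix v and C :: "'a set" assume v: "v \<in> ?V" and C [measurable]: "C \<in> sets borel"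
    have [measurable]: "(\<lambda>x. x + v) -` C \<in> sets borel"
      using measurable_sets_borel[of "\<lambda>y. y + v" borel C] by simp
    have "a \<bullet> ((1 / r) *\<^sub>R v) = 0" using v by simp
    from emeasure_lborel_shear_vimage[OF this, of "cone_over a r C"]
    show "emeasure \<mu> ((\<lambda>x. x + v) -` C) = emeasure \<mu> C"
      using v r a by (simp add: \<mu> cone_over_translate)
    have "?V \<inter> C = (+) v ` (?V \<inter> (\<lambda>x. x + v) -` C)"
    proof (intro equalityI subsetI)
      fix y assume "y \<in> ?V \<inter> C"
      then have "y - v \<in> ?V \<inter> (\<lambda>x. x + v) -` C"
        using v by (auto simp: inner_diff_right)
      then show "y \<in> (+) v ` (?V \<inter> (\<lambda>x. x + v) -` C)" by (rule rev_image_eqI) simp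
    qed (use v in \<open>auto simp: inner_add_right add.commute\<close>)
    then show "emeasure \<nu> ((\<lambda>x. x + v) -` C) = emeasure \<nu> C"
      by (simp add: \<nu> hausdorff_outer_translate)
  qed (auto simp: subspace_hyperplane)
  moreover have "?V \<inter> B = B" using BV by auto
  ultimately show ?thesis by (simp add: \<mu> \<nu>)
qed

text \<open>The reflection that exchanges the normals maps one disc isometrically onto the other.
  With the analogous fact for cones this makes the factor between volume and surface independent of
  the facet.\<close>

lemma hausdorff_outer_hyperplane_disc_eq:
  fixes a b :: "'a::euclidean_space"
  assumes "norm a = norm b"
  shows "H k (perp a \<inter> cball 0 R) = H k (perp b \<inter> cball 0 R)"
proof -
  let ?f = "reflect_along (a - b)"
  have ab: "?f a = b" using assms by (rule reflect_along_swap)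
  have "perp b \<inter> cball 0 R = ?f ` (perp a \<inter> cball 0 R)"
  proof (intro equalityI subsetI)
    fix y assume "y \<in> perp b \<inter> cball 0 R"
    then have "?f y \<in> perp a \<inter> cball 0 R"
      using inner_reflect_along[of "a - b" a "?f y"] ab by simp
    then show "y \<in> ?f ` (perp a \<inter> cball 0 R)" by (rule rev_image_eqI) simp
  next
    fix y assume "y \<in> ?f ` (perp a \<inter> cball 0 R)"
    then obtain v where v: "y = ?f v" "a \<bullet> v = 0" "norm v \<le> R" by auto
    then show "y \<in> perp b \<inter> cball 0 R"
      using inner_reflect_along[of "a - b" a v] ab by simp
  qed
  moreover have "dist (?f x) (?f y) = dist x y" for x y
    using linear_diff[OF linear_reflect_along, of "a - b" x y] by (metis dist_norm norm_reflect_along)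
  ultimately show ?thesis
    using hausdorff_outer_isometric_image by metis
qed

text \<open>Here it matters that both cones have the same height \<open>r\<close>, that is, that all
  facets are tangent to one sphere.\<close>

lemma emeasure_cone_over_disc_eq:
  fixes a b :: "'a::euclidean_space"
  assumes "norm a = norm b"
  shows "vol (cone_over a r (cball 0 1)) = vol (cone_over b r (cball 0 1))"
proof -
  let ?f = "reflect_along (a - b)"
  have ab: "?f a = b" using assms by (rule reflect_along_swap)
  have ip: "b \<bullet> ?f x = a \<bullet> x" for x
    using inner_reflect_along[of "a - b" a x] ab by simp
  have "?f (t *\<^sub>R x - r *\<^sub>R a) = t *\<^sub>R ?f x - r *\<^sub>R b" for t x
    using linear_reflect_along[of "a - b"] ab by (simp add: linear_diff linear_cmul)
  then have "norm (t *\<^sub>R ?f x - r *\<^sub>R b) = norm (t *\<^sub>R x - r *\<^sub>R a)" for t x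
    by (metis norm_reflect_along)
  then have "cone_over a r (cball 0 1) = ?f -` cone_over b r (cball 0 1)"
    by (auto simp: cone_over_def ip)
  then show ?thesis by (simp add: emeasure_lborel_reflect_along_vimage)
qed

lemma emeasure_cone_over_disc_pos:
  fixes a :: "'a::euclidean_space"
  assumes a: "norm a = 1" and r: "0 < r"
  shows "0 < vol (cone_over a r (cball 0 1))"
proof -
  \<comment> \<open>The bound \<open>r / 4\<close> keeps the height of \<open>x\<close> above
    \<open>r / 4\<close>, so projecting to height \<open>r\<close> magnifies by a factor of at most
    4. Points of the ball are within \<open>2 * \<delta>\<close> of the axis, and
    \<open>1 / 8\<close> makes \<open>4 * (2 * \<delta>)\<close> at most 1.\<close>
  define \<delta> where "\<delta> = min (r / 4) (1 / 8)"
  have \<delta>: "0 < \<delta>" "\<delta> \<le> r / 4" "\<delta> \<le> 1 / 8" using r by (auto simp: \<delta>_def)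
  have aa: "a \<bullet> a = 1" using a by (simp add: dot_square_norm)
  have "ball ((r / 2) *\<^sub>R a) \<delta> \<subseteq> cone_over a r (cball 0 1)"
  proof
    fix x assume "x \<in> ball ((r / 2) *\<^sub>R a) \<delta>"
    then have x: "norm (x - (r / 2) *\<^sub>R a) < \<delta>" by (simp add: dist_norm norm_minus_commute)
    have "\<bar>a \<bullet> (x - (r / 2) *\<^sub>R a)\<bar> < \<delta>"
      using Cauchy_Schwarz_ineq2[of a "x - (r / 2) *\<^sub>R a"] a x by simp
    then have t: "\<bar>a \<bullet> x - r / 2\<bar> < \<delta>" by (simp add: inner_diff_right aa)
    let ?t = "a \<bullet> x"
    have t': "r / 4 < ?t" "?t \<le> r" using t \<delta> r by linarith+
    have "norm (x - ?t *\<^sub>R a) \<le> norm (x - (r / 2) *\<^sub>R a) + norm ((r / 2) *\<^sub>R a - ?t *\<^sub>R a)"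
      using norm_triangle_ineq[of "x - (r / 2) *\<^sub>R a" "(r / 2) *\<^sub>R a - ?t *\<^sub>R a"] by simp
    also have "norm ((r / 2) *\<^sub>R a - ?t *\<^sub>R a) = \<bar>r / 2 - ?t\<bar>"
      using a by (simp flip: scaleR_diff_left)
    finally have d: "norm (x - ?t *\<^sub>R a) \<le> 2 * \<delta>" using x t by simp
    have "(r / ?t) *\<^sub>R x - r *\<^sub>R a = (r / ?t) *\<^sub>R (x - ?t *\<^sub>R a)"
      using t' r by (simp add: scaleR_diff_right)
    then have "norm ((r / ?t) *\<^sub>R x - r *\<^sub>R a) = (r / ?t) * norm (x - ?t *\<^sub>R a)"
      using t' r by simp
    also have "\<dots> \<le> 4 * (2 * \<delta>)"
      using d t' r by (intro mult_mono) (auto simp: field_simps)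
    finally have "norm ((r / ?t) *\<^sub>R x - r *\<^sub>R a) \<le> 1" using \<delta> by simp
    then show "x \<in> cone_over a r (cball 0 1)"
      using t' r by (simp add: cone_over_def)
  qed
  then have "vol (ball ((r / 2) *\<^sub>R a) \<delta>) \<le> vol (cone_over a r (cball 0 1))"
    by (intro emeasure_mono) auto
  with emeasure_lborel_ball_pos[OF \<delta>(1), of "(r / 2) *\<^sub>R a"] show ?thesis by simp
qed

section \<open>Circumscribed polytopes\<close>

text \<open>Each point of the ball lies on a diameter, whose two ends belong to the sphere; for the
  centre any direction will do.\<close>

lemma cball_subset_convex_sphere:
  assumes "convex K" "sphere c r \<subseteq> K" "0 < r"
  shows "cball c r \<subseteq> (K :: 'a::euclidean_space set)"
proof
  fix x assume "x \<in> cball c r"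
  obtain u where u: "norm u = 1" "x = c + norm (x - c) *\<^sub>R u"
  proof (cases "x = c")
    case True
    then show ?thesis using that norm_Basis[OF SOME_Basis] by fastforce
  next
    case False
    then show ?thesis by (intro that[of "sgn (x - c)"]) (auto simp: norm_sgn sgn_div_norm)
  qed
  define s where "s = norm (x - c)"
  have s: "0 \<le> s" "s \<le> r" using \<open>x \<in> cball c r\<close> by (auto simp: s_def dist_norm norm_minus_commute)
  have "c + r *\<^sub>R u \<in> K" "c - r *\<^sub>R u \<in> K"
    using assms(2,3) u by (auto simp: dist_norm)
  then have "((r + s) / (2 * r)) *\<^sub>R (c + r *\<^sub>R u) + ((r - s) / (2 * r)) *\<^sub>R (c - r *\<^sub>R u) \<in> K"
    using assms(3) s by (intro convexD[OF assms(1)]) (auto simp: field_simps)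
  moreover have "x = ((r + s) / (2 * r)) *\<^sub>R (c + r *\<^sub>R u) + ((r - s) / (2 * r)) *\<^sub>R (c - r *\<^sub>R u)"
  proof -
    have "((r + s) / (2 * r)) *\<^sub>R (c + r *\<^sub>R u) + ((r - s) / (2 * r)) *\<^sub>R (c - r *\<^sub>R u) =
        ((r + s) / (2 * r) + (r - s) / (2 * r)) *\<^sub>R c + ((r + s) / (2 * r) * r - (r - s) / (2 * r) * r) *\<^sub>R u"
      by (simp add: algebra_simps)
    moreover have "(r + s) / (2 * r) + (r - s) / (2 * r) = 1" "(r + s) / (2 * r) * r - (r - s) / (2 * r) * r = s"
      using assms(3) by (auto simp: field_simps)
    ultimately show ?thesis using u(2) by (simp add: s_def)
  qed
  ultimately show "x \<in> K"
    by (simp only:)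
qed

text \<open>Tangency puts every facet hyperplane at distance exactly \<open>r\<close> from
  \<open>c\<close>: \<open>c + r *\<^sub>R a\<close> lies in \<open>K\<close>, which gives one
  inequality, and the point of contact with Cauchy-Schwarz gives the other. The disc in the last
  conclusion comes from the relative interior of the facet.\<close>

lemma circumscribed_polytope_normals:
  fixes K :: "'a::euclidean_space set"
  assumes K: "polytope K" "interior K \<noteq> {}" and sph: "inscribed_sphere K c r"
  obtains N where "finite N" "\<And>a. a \<in> N \<Longrightarrow> norm a = 1"
    "\<And>a. a \<in> N \<Longrightarrow> K \<subseteq> {x. a \<bullet> (x - c) \<le> r}"
    "frontier K \<subseteq> (\<Union>a\<in>N. {x. a \<bullet> (x - c) = r})"
    "\<And>a. a \<in> N \<Longrightarrow> \<exists>x0 e. 0 < e \<and> a \<bullet> (x0 - c) = r \<and> ball x0 e \<inter> {x. a \<bullet> (x - c) = r} \<subseteq> K"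
proof -
  have poly: "polyhedron K" using K by (simp add: polytope_imp_polyhedron)
  have r: "0 < r" and sub: "sphere c r \<subseteq> K"
    and tangent: "\<And>F. F facet_of K \<Longrightarrow> \<exists>x\<in>F. sphere c r \<inter> affine hull F = {x}"
    using sph by (auto simp: inscribed_sphere_def)
  define Q where "Q F a \<longleftrightarrow> norm a = 1 \<and> K \<subseteq> {x. a \<bullet> (x - c) \<le> r} \<and> F = K \<inter> {x. a \<bullet> (x - c) = r} \<and>
      (\<exists>x0 e. 0 < e \<and> a \<bullet> (x0 - c) = r \<and> ball x0 e \<inter> {x. a \<bullet> (x - c) = r} \<subseteq> K)" for F a
  have "\<exists>a. Q F a" if F: "F facet_of K" for F
  proof -
    obtain a0 b0 where ab0: "a0 \<noteq> 0" "K \<subseteq> {x. a0 \<bullet> x \<le> b0}" "F = K \<inter> {x. a0 \<bullet> x = b0}"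
      using facet_of_polyhedron[OF poly F] .
    define a where "a = a0 /\<^sub>R norm a0"
    define b where "b = b0 / norm a0"
    have a: "norm a = 1" "a \<noteq> 0" using ab0 by (auto simp: a_def)
    have aK: "K \<subseteq> {x. a \<bullet> x \<le> b}" and aF: "F = K \<inter> {x. a \<bullet> x = b}"
      using ab0 by (auto simp: a_def b_def field_simps)
    obtain x1 where x1: "x1 \<in> F" "x1 \<in> sphere c r" using tangent[OF F] by blast
    have "c + r *\<^sub>R a \<in> K" using sub a r by (auto simp: dist_norm)
    then have "a \<bullet> c + r \<le> b"
      using aK a by (auto simp: inner_add_right dot_square_norm)
    moreover have "b \<le> a \<bullet> c + r"
    proof -
      have "b = a \<bullet> c + a \<bullet> (x1 - c)" using x1 aF by (simp add: inner_diff_right)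
      also have "a \<bullet> (x1 - c) \<le> norm a * norm (x1 - c)" by (rule norm_cauchy_schwarz)
      also have "\<dots> = r" using a x1 by (simp add: dist_norm norm_minus_commute)
      finally show ?thesis by simp
    qed
    ultimately have b: "b = a \<bullet> c + r" by simp
    \<comment> \<open>A facet has codimension 1, so its affine hull fills the supporting hyperplane
      and a relatively open piece of the facet is an open piece of that hyperplane.\<close>
    have "aff_dim (affine hull F) = aff_dim {x. a \<bullet> x = b}"
      using F K(2) a by (simp add: facet_of_def aff_dim_nonempty_interior)
    moreover have "affine hull F \<subseteq> {x. a \<bullet> x = b}"
      using aF by (intro hull_minimal affine_hyperplane) auto
    ultimately have hull: "affine hull F = {x. a \<bullet> x = b}"
      using x1 by (intro affine_dim_equal) (auto simp: affine_hyperplane)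
    have "convex F"
      using F K(1) by (meson facet_of_imp_face_of face_of_imp_convex polytope_imp_convex)
    then have "rel_interior F \<noteq> {}" using x1 by (auto simp: rel_interior_eq_empty)
    then obtain x0 e where "x0 \<in> F" "0 < e" "ball x0 e \<inter> affine hull F \<subseteq> F"
      unfolding rel_interior_ball by auto
    then have "0 < e \<and> a \<bullet> (x0 - c) = r \<and> ball x0 e \<inter> {x. a \<bullet> (x - c) = r} \<subseteq> K"
      unfolding hull using aF b by (auto simp: inner_diff_right)
    moreover have "K \<subseteq> {x. a \<bullet> (x - c) \<le> r}" "F = K \<inter> {x. a \<bullet> (x - c) = r}"
      using aK aF b by (auto simp: inner_diff_right)
    ultimately show ?thesis using a unfolding Q_def by blast
  qed
  then obtain nrm where nrm: "\<And>F. F facet_of K \<Longrightarrow> Q F (nrm F)"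
    by metis
  have "rel_frontier K = frontier K"
    using K(2) by (simp add: rel_frontier_nonempty_interior)
  then have "frontier K = \<Union> {F. F facet_of K}"
    using rel_frontier_of_polyhedron[OF poly] by simp
  then have "frontier K \<subseteq> (\<Union>a\<in>nrm ` {F. F facet_of K}. {x. a \<bullet> (x - c) = r})"
  proof (intro subsetI)
    fix x assume "x \<in> frontier K"
    then obtain F where F: "F facet_of K" "x \<in> F"
      using \<open>frontier K = \<Union> {F. F facet_of K}\<close> by auto
    then have "x \<in> K \<inter> {x. nrm F \<bullet> (x - c) = r}"
      using nrm[OF F(1)] unfolding Q_def by metis
    then show "x \<in> (\<Union>a\<in>nrm ` {F. F facet_of K}. {x. a \<bullet> (x - c) = r})"
      using F(1) by auto
  qed
  moreover have "finite (nrm ` {F. F facet_of K})"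
    using K(1) finite_polytope_facets by blast
  ultimately show ?thesis
  proof (intro that[of "nrm ` {F. F facet_of K}"])
    fix a assume "a \<in> nrm ` {F. F facet_of K}"
    then obtain F where "Q F a" using nrm by auto
    then show "norm a = 1" "K \<subseteq> {x. a \<bullet> (x - c) \<le> r}"
      "\<exists>x0 e. 0 < e \<and> a \<bullet> (x0 - c) = r \<and> ball x0 e \<inter> {x. a \<bullet> (x - c) = r} \<subseteq> K"
      unfolding Q_def by auto
  qed
qed

text \<open>The last two assumptions are supplied by the hypothesis that normalised surface measure
  is a probability measure.\<close>

locale circumscribed =
  fixes K :: "'a::euclidean_space set" and c :: 'a and r :: real and N :: "'a set" and k :: nat
  assumes compact: "compact K" and r: "0 < r" and c: "c \<in> interior K"
    and N: "finite N" and norm_N: "\<And>a. a \<in> N \<Longrightarrow> norm a = 1"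
    and K_le: "\<And>a x. a \<in> N \<Longrightarrow> x \<in> K \<Longrightarrow> a \<bullet> (x - c) \<le> r"
    and frontier_eq: "frontier K \<subseteq> (\<Union>a\<in>N. {x. a \<bullet> (x - c) = r})"
    and disc: "\<And>a. a \<in> N \<Longrightarrow> \<exists>x0 e. 0 < e \<and> a \<bullet> (x0 - c) = r \<and> ball x0 e \<inter> {x. a \<bullet> (x - c) = r} \<subseteq> K"
    and H_pos: "H k (frontier K) \<noteq> 0"
    and H_fin: "H k (frontier K) < \<infinity>"
begin

text \<open>Since all facets are at distance \<open>r\<close> from \<open>c\<close>, the gauge of
  \<open>K\<close> about \<open>c\<close> is this finite maximum over the facet normals; in this
  form measurability and homogeneity are immediate.\<close>

definition minkowski :: "'a \<Rightarrow> real" where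
  "minkowski x = Max ((\<lambda>a. (a \<bullet> (x - c)) / r) ` N)"

definition radial :: "'a \<Rightarrow> 'a" where
  "radial x = c + (1 / minkowski x) *\<^sub>R (x - c)"

lemma ray:
  assumes "x \<noteq> c"
  obtains d a where "0 < d" "c + d *\<^sub>R (x - c) \<in> frontier K" "a \<in> N" "a \<bullet> (x - c) = r / d"
    "\<And>e. 0 \<le> e \<Longrightarrow> e < d \<Longrightarrow> c + e *\<^sub>R (x - c) \<in> interior K"
proof -
  obtain d where d: "0 < d" "c + d *\<^sub>R (x - c) \<in> frontier K"
      "\<And>e. 0 \<le> e \<Longrightarrow> e < d \<Longrightarrow> c + e *\<^sub>R (x - c) \<in> interior K"
    using ray_to_frontier[OF compact_imp_bounded[OF compact] c, of "x - c"] assms by auto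
  moreover obtain a where "a \<in> N" and a: "a \<bullet> (c + d *\<^sub>R (x - c) - c) = r"
    using subsetD[OF frontier_eq d(2)] by blast
  moreover from a have "d * (a \<bullet> (x - c)) = r"
    by simp
  then have "a \<bullet> (x - c) = r / d"
    using d(1) by (metis less_irrefl nonzero_mult_div_cancel_left)
  ultimately show ?thesis by (intro that[of d a])
qed

lemma N_nonempty: "N \<noteq> {}"
proof -
  obtain u :: 'a where "u \<noteq> 0" using nonzero_Basis[OF SOME_Basis] by blast
  then show ?thesis using ray[of "c + u"] by auto
qed

lemma minkowski_ge: "a \<in> N \<Longrightarrow> (a \<bullet> (x - c)) / r \<le> minkowski x"
  unfolding minkowski_def using N by (intro Max_ge) auto

lemma minkowski_le_iff: "minkowski x \<le> t \<longleftrightarrow> (\<forall>a\<in>N. (a \<bullet> (x - c)) / r \<le> t)"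
  unfolding minkowski_def using N N_nonempty by (subst Max_le_iff) auto

lemma minkowski_scale:
  assumes "0 \<le> t"
  shows "minkowski (c + t *\<^sub>R (x - c)) = t * minkowski x"
proof -
  have "mono ((*) t)" using assms by (auto simp: mono_def mult_left_mono)
  then show ?thesis
    unfolding minkowski_def using N N_nonempty by (simp add: mono_Max_commute image_image)
qed

lemma minkowski_measurable [measurable]: "minkowski \<in> borel_measurable borel"
  unfolding minkowski_def using N by measurable

lemma radial_measurable [measurable]: "radial \<in> borel_measurable borel"
  unfolding radial_def by measurable

lemma K_closed: "closed K" using compact by (rule compact_imp_closed)

lemma frontier_K: "x \<in> frontier K \<Longrightarrow> x \<in> K"
  using K_closed frontier_subset_closed by blast

lemma minkowski_le_1: "x \<in> K \<Longrightarrow> minkowski x \<le> 1"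
  unfolding minkowski_le_iff using K_le r by auto

lemma minkowski_frontier: "x \<in> frontier K \<Longrightarrow> minkowski x = 1"
proof (rule antisym)
  assume x: "x \<in> frontier K"
  then show "minkowski x \<le> 1" by (intro minkowski_le_1 frontier_K)
  obtain a where "a \<in> N" "a \<bullet> (x - c) = r" using subsetD[OF frontier_eq x] by blast
  then show "1 \<le> minkowski x" using minkowski_ge[of a x] r by simp
qed

lemma minkowski_pos: "x \<noteq> c \<Longrightarrow> 0 < minkowski x"
proof -
  assume "x \<noteq> c"
  then obtain d a where "0 < d" "a \<in> N" "a \<bullet> (x - c) = r / d" using ray by metis
  then show ?thesis using minkowski_ge[of a x] r by (smt (verit) divide_pos_pos)
qed

lemma minkowski_ray:
  assumes "x \<noteq> c"
  shows "c + (1 / minkowski x) *\<^sub>R (x - c) \<in> frontier K"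
    and "\<And>e. 0 \<le> e \<Longrightarrow> e < 1 / minkowski x \<Longrightarrow> c + e *\<^sub>R (x - c) \<in> interior K"
proof -
  obtain d where d: "0 < d" "c + d *\<^sub>R (x - c) \<in> frontier K"
      "\<And>e. 0 \<le> e \<Longrightarrow> e < d \<Longrightarrow> c + e *\<^sub>R (x - c) \<in> interior K"
    using ray[OF assms] by metis
  have "d * minkowski x = 1"
    using minkowski_frontier[OF d(2)] minkowski_scale[of d x] d(1) by simp
  then have "1 / minkowski x = d"
    using d(1) by (metis divide_eq_eq mult_zero_right zero_neq_one)
  with d show "c + (1 / minkowski x) *\<^sub>R (x - c) \<in> frontier K"
    and "\<And>e. 0 \<le> e \<Longrightarrow> e < 1 / minkowski x \<Longrightarrow> c + e *\<^sub>R (x - c) \<in> interior K" by auto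
qed

lemma radial_frontier: "x \<noteq> c \<Longrightarrow> radial x \<in> frontier K"
  unfolding radial_def by (rule minkowski_ray)

lemma in_K_if_minkowski:
  assumes "x \<noteq> c" "minkowski x \<le> 1"
  shows "x \<in> K"
proof (cases "minkowski x = 1")
  case True
  then show ?thesis using minkowski_ray(1)[OF assms(1)] frontier_K by simp
next
  case False
  then have "1 < 1 / minkowski x" using assms minkowski_pos[OF assms(1)] by simp
  then show ?thesis using minkowski_ray(2)[OF assms(1), of 1] interior_subset by auto
qed

lemma frontier_if_minkowski: "minkowski x = 1 \<Longrightarrow> x \<in> frontier K"
  using minkowski_ray(1)[of x] minkowski_scale[of 0 x] by (cases "x = c") auto

text \<open>The part of \<open>K\<close> seen from \<open>c\<close> through \<open>S\<close>. The
  centre lies on no particular ray and \<open>radial\<close> maps it to itself, so it is left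
  out.\<close>

definition sector :: "'a set \<Rightarrow> 'a set" where
  "sector S = {x \<in> K - {c}. radial x \<in> S}"

lemma sector_measurable [measurable]: "S \<in> sets borel \<Longrightarrow> sector S \<in> sets borel"
proof -
  assume [measurable]: "S \<in> sets borel"
  have [measurable]: "K \<in> sets borel" using K_closed by simp
  show ?thesis unfolding sector_def by measurable
qed

lemma sector_frontier: "sector (S \<inter> frontier K) = sector S"
  using radial_frontier by (auto simp: sector_def)

text \<open>On rays that leave \<open>K\<close> through the facet of \<open>a\<close> the maximum in
  \<open>minkowski\<close> is attained at \<open>a\<close>. Radial projection is then the central
  projection used in \<open>cone_over\<close>.\<close>

lemma sector_facet:
  assumes a: "a \<in> N" and S: "S \<subseteq> frontier K" "S \<subseteq> {x. a \<bullet> (x - c) = r}"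
  shows "sector S = (\<lambda>x. x - c) -` cone_over a r ((\<lambda>v. v + (c + r *\<^sub>R a)) -` S)"
proof (intro equalityI subsetI)
  fix x assume "x \<in> sector S"
  then have x: "x \<in> K" "x \<noteq> c" "radial x \<in> S" by (auto simp: sector_def)
  have "a \<bullet> (radial x - c) = r" using x S by auto
  then have ax: "a \<bullet> (x - c) = r * minkowski x"
    using minkowski_pos[OF x(2)] by (simp add: radial_def nonzero_divide_eq_eq)
  then have "(r / (a \<bullet> (x - c))) *\<^sub>R (x - c) - r *\<^sub>R a + (c + r *\<^sub>R a) = radial x"
    using r by (simp add: radial_def)
  then show "x \<in> (\<lambda>x. x - c) -` cone_over a r ((\<lambda>v. v + (c + r *\<^sub>R a)) -` S)"
    using ax r minkowski_pos[OF x(2)] minkowski_le_1[OF x(1)] x(3) by (simp add: cone_over_def)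
next
  fix x assume "x \<in> (\<lambda>x. x - c) -` cone_over a r ((\<lambda>v. v + (c + r *\<^sub>R a)) -` S)"
  then have t: "0 < a \<bullet> (x - c)" "a \<bullet> (x - c) \<le> r"
    and y: "c + (r / (a \<bullet> (x - c))) *\<^sub>R (x - c) \<in> S"
    by (auto simp: cone_over_def add.commute)
  let ?t = "a \<bullet> (x - c)"
  \<comment> \<open>The projected point is on the boundary, where the gauge is 1; homogeneity gives
    the gauge of \<open>x\<close> itself.\<close>
  have "r / ?t * minkowski x = 1"
    using minkowski_frontier[of "c + (r / ?t) *\<^sub>R (x - c)"] y S minkowski_scale[of "r / ?t" x] t r by auto
  then have g: "1 / minkowski x = r / ?t" "minkowski x = ?t / r"
    using t r by (auto simp: field_simps)
  have "x \<noteq> c" using t by auto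
  moreover have "x \<in> K" using \<open>x \<noteq> c\<close> g t r by (intro in_K_if_minkowski) auto
  moreover have "radial x \<in> S" using y g by (simp add: radial_def)
  ultimately show "x \<in> sector S" by (simp add: sector_def)
qed

text \<open>The constants refer to one fixed normal \<open>b\<close> and not to the facet containing
  \<open>S\<close>, so that the identities for different facets can be added.\<close>

lemma emeasure_sector_facet:
  assumes a: "a \<in> N" and b: "b \<in> N" and S: "S \<subseteq> frontier K" "S \<subseteq> {x. a \<bullet> (x - c) = r}"
    and [measurable]: "S \<in> sets borel"
  shows "vol (sector S) * H k (perp b \<inter> cball 0 1) =
    vol (cone_over b r (cball 0 1)) * H k S"
proof -
  define y where "y = c + r *\<^sub>R a"
  let ?C = "(\<lambda>v. v + y) -` S"
  have na: "norm a = 1" and nb: "norm a = norm b" using a b norm_N by auto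
  have ay: "a \<bullet> y = a \<bullet> c + r" using na by (simp add: y_def inner_add_right dot_square_norm)
  have C [measurable]: "?C \<in> sets borel"
    using measurable_sets_borel[of "\<lambda>v. v + y" borel S] by simp
  have "vol (sector S) = vol ((\<lambda>x. x + - c) -` cone_over a r ?C)"
    using sector_facet[OF a S] by (simp add: y_def)
  also have "\<dots> = vol (cone_over a r ?C)"
    by (rule emeasure_lborel_translate) measurable
  finally have 1: "vol (sector S) = vol (cone_over a r ?C)" .
  have "S = (+) y ` ?C"
  proof (intro equalityI subsetI)
    fix x assume "x \<in> S"
    then have "x - y \<in> ?C" by simp
    then show "x \<in> (+) y ` ?C" by (rule rev_image_eqI) simp
  qed (auto simp: add.commute)
  then have 2: "H k S = H k ?C"
    using hausdorff_outer_translate by metis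
  obtain x0 e where e: "0 < e" "a \<bullet> (x0 - c) = r" "ball x0 e \<inter> {x. a \<bullet> (x - c) = r} \<subseteq> K"
    using disc[OF a] by blast
  \<comment> \<open>A small disc of the facet hyperplane inside \<open>K\<close> has gauge 1, hence
    lies in the boundary, and its Hausdorff measure is finite.\<close>
  have "(+) x0 ` (perp a \<inter> ball 0 e) \<subseteq> frontier K"
  proof (rule image_subsetI)
    fix v assume v: "v \<in> perp a \<inter> ball 0 e"
    then have r': "a \<bullet> (x0 + v - c) = r" using e(2) by (simp add: inner_diff_right inner_add_right)
    then have "x0 + v \<in> K" using v e(3) by (auto simp: dist_norm)
    then have "minkowski (x0 + v) = 1"
      using minkowski_le_1 minkowski_ge[OF a, of "x0 + v"] r' r by (simp add: antisym)
    then show "x0 + v \<in> frontier K" by (rule frontier_if_minkowski)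
  qed
  then have "H k (perp a \<inter> ball 0 e) \<le> H k (frontier K)"
    using hausdorff_outer_mono hausdorff_outer_translate by metis
  then have "H k (perp a \<inter> ball 0 e) < \<infinity>"
    using H_fin by (rule order.strict_trans1)
  moreover have "?C \<subseteq> perp a"
    using S(2) ay by (auto simp: inner_diff_right inner_add_right)
  ultimately have "vol (cone_over a r ?C) * H k (perp a \<inter> cball 0 1) =
    vol (cone_over a r (cball 0 1)) * H k ?C"
    using emeasure_cone_over_proportional[OF na r e(1) _ C] by blast
  then show ?thesis
    unfolding 1 2 using hausdorff_outer_hyperplane_disc_eq[OF nb] emeasure_cone_over_disc_eq[OF nb] by metis
qed

text \<open>A boundary piece is split along the facet hyperplanes, one normal at a time. Removing
  each hyperplane before treating the next takes care of the overlaps.\<close>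

lemma emeasure_sector_proportional:
  assumes b: "b \<in> N" and S: "S \<in> sets borel" "S \<subseteq> frontier K"
  shows "vol (sector S) * H k (perp b \<inter> cball 0 1) =
    vol (cone_over b r (cball 0 1)) * H k S"
proof -
  have "vol (sector S) * H k (perp b \<inter> cball 0 1) =
    vol (cone_over b r (cball 0 1)) * H k S"
    if "finite N'" "N' \<subseteq> N" "S \<in> sets borel" "S \<subseteq> frontier K" "S \<subseteq> (\<Union>a\<in>N'. {x. a \<bullet> (x - c) = r})" for N' S
    using that
  proof (induction N' arbitrary: S)
    case empty
    then show ?case by (simp add: sector_def)
  next
    case (insert a N')
    let ?P = "{x. a \<bullet> (x - c) = r}"
    have P: "?P \<in> sets borel" by measurable
    note [measurable] = insert.prems(2) P
    have "sector S = sector (S \<inter> ?P) \<union> sector (S - ?P)" "sector (S \<inter> ?P) \<inter> sector (S - ?P) = {}"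
      by (auto simp: sector_def)
    then have 1: "vol (sector S) = vol (sector (S \<inter> ?P)) + vol (sector (S - ?P))"
      by (simp add: plus_emeasure)
    have "emeasure (hausdorff_measure k) S = emeasure (hausdorff_measure k) (S \<inter> ?P) + emeasure (hausdorff_measure k) (S - ?P)"
      by (subst plus_emeasure) (auto simp: Int_Diff_Un)
    then have 2: "H k S = H k (S \<inter> ?P) + H k (S - ?P)"
      by (simp add: emeasure_hausdorff_measure)
    have "vol (sector (S - ?P)) * H k (perp b \<inter> cball 0 1) =
        vol (cone_over b r (cball 0 1)) * H k (S - ?P)"
      using insert.prems by (intro insert.IH) auto
    moreover have "vol (sector (S \<inter> ?P)) * H k (perp b \<inter> cball 0 1) =
        vol (cone_over b r (cball 0 1)) * H k (S \<inter> ?P)"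
      using insert.prems by (intro emeasure_sector_facet[of a] b) auto
    ultimately show ?case unfolding 1 2 by (simp add: distrib_left distrib_right)
  qed
  from this[of N S] show ?thesis using N S frontier_eq by blast
qed

text \<open>Comparison with the whole boundary, whose sector is \<open>K\<close> up to the point
  \<open>c\<close>, eliminates the unknown disc constants. Only the cone volume \<open>?p\<close>
  has to be cancelled.\<close>

lemma emeasure_sector:
  assumes S [measurable]: "S \<in> sets borel"
  shows "vol (sector S) * H k (frontier K) =
    vol K * H k (S \<inter> frontier K)"
proof -
  obtain b where b: "b \<in> N" using N_nonempty by blast
  let ?q = "H k (perp b \<inter> cball 0 1)" and ?p = "vol (cone_over b r (cball 0 1))"
  have fr [measurable]: "frontier K \<in> sets borel" by simp
  have "sector (frontier K) = K - {c}" using radial_frontier by (auto simp: sector_def)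
  moreover have "vol (K - {c}) = vol K"
    using K_closed by (subst emeasure_Diff) (auto intro!: interior_subset[THEN subsetD] c)
  ultimately have 1: "vol K * ?q = ?p * H k (frontier K)"
    using emeasure_sector_proportional[OF b fr] by simp
  have 2: "vol (sector S) * ?q = ?p * H k (S \<inter> frontier K)"
    using emeasure_sector_proportional[OF b, of "S \<inter> frontier K"] by (simp add: sector_frontier)
  have p: "?p \<noteq> 0" "?p \<noteq> top"
    using emeasure_cone_over_disc_pos[OF norm_N[OF b] r]
      emeasure_bounded_finite[OF bounded_cone_over[OF norm_N[OF b] r bounded_cball, of 0 1]] by auto
  have "?p * (vol (sector S) * H k (frontier K)) =
      vol (sector S) * (?p * H k (frontier K))"
    by (simp add: mult_ac)
  also have "\<dots> = vol (sector S) * ?q * vol K"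
    unfolding 1[symmetric] by (simp only: mult_ac)
  also have "\<dots> = ?p * (vol K * H k (S \<inter> frontier K))"
    by (simp add: 2 mult_ac)
  finally show ?thesis using p by (subst (asm) ennreal_mult_cancel_left) auto
qed

end

section \<open>Radial and gauge parts of the uniform distribution\<close>

context circumscribed
begin

lemma sector_D: "x \<in> sector S \<Longrightarrow> 0 < minkowski x \<and> minkowski x \<le> 1 \<and> x \<noteq> c \<and> x \<in> K"
  using minkowski_pos minkowski_le_1 by (auto simp: sector_def)

text \<open>The homothety with centre \<open>c\<close> and ratio \<open>t\<close> keeps directions
  and multiplies the gauge by \<open>t\<close>, so it maps the sector onto the part with gauge at
  most \<open>t\<close>.\<close>

lemma emeasure_sector_scaled:
  assumes [measurable]: "S \<in> sets borel" and t: "0 < t" "t \<le> 1"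
  shows "vol {x \<in> sector S. minkowski x \<le> t} = ennreal (t ^ DIM('a)) * vol (sector S)"
proof -
  let ?A = "{x \<in> sector S. minkowski x \<le> t}"
  let ?T = "\<lambda>x. (1 - t) *\<^sub>R c + t *\<^sub>R x"
  have T: "?T x = c + t *\<^sub>R (x - c)" for x by (simp add: algebra_simps)
  have [measurable]: "?A \<in> sets borel"
    using sector_measurable[of S] by measurable
  have pre: "?T -` ?A = sector S"
  proof (intro set_eqI)
    fix x
    have g: "minkowski (?T x) = t * minkowski x" using t minkowski_scale[of t x] by (simp only: T)
    have neq: "?T x \<noteq> c \<longleftrightarrow> x \<noteq> c" using t by (simp only: T) simp
    have rad: "radial (?T x) = radial x"
      using t by (simp add: radial_def g) (simp only: T, simp)
    have "?T x \<in> ?A \<longleftrightarrow> ?T x \<in> K \<and> x \<noteq> c \<and> radial x \<in> S \<and> minkowski x \<le> 1"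
      using t by (simp add: sector_def neq rad g)
    moreover have "t * minkowski x \<le> 1" if "minkowski x \<le> 1"
      using order_trans[OF mult_left_mono[OF that, of t], of 1] t by (simp only: mult_1_right less_imp_le)
    ultimately have "?T x \<in> ?A \<longleftrightarrow> x \<in> sector S"
      using in_K_if_minkowski[of x] in_K_if_minkowski[of "?T x"] minkowski_le_1[of x] neq g t
      by (auto simp: sector_def)
    then show "x \<in> ?T -` ?A \<longleftrightarrow> x \<in> sector S" by simp
  qed
  have "vol ?A = emeasure (density (distr lborel borel ?T) (\<lambda>_. ennreal (\<bar>t\<bar> ^ DIM('a)))) ?A"
    using t by (subst lborel_affine[of t "(1 - t) *\<^sub>R c"]) auto
  also have "\<dots> = ennreal (t ^ DIM('a)) * vol (sector S)"
  proof -
    have "emeasure (distr lborel borel ?T) ?A = vol (?T -` ?A)"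
      by (subst emeasure_distr) auto
    then show ?thesis
      using t unfolding pre by (simp add: emeasure_density_const)
  qed
  finally show ?thesis .
qed

text \<open>The mean of \<open>1 - minkowski\<close> over \<open>K\<close>; what matters is that it is the same on every sector.\<close>

definition shrink :: ennreal where
  "shrink = (\<integral>\<^sup>+t. indicator {0<..1} t * ennreal (t ^ DIM('a)) \<partial>lborel)"

lemma shrink_le_1: "shrink \<le> 1"
proof -
  have "shrink \<le> (\<integral>\<^sup>+t. indicator {0<..(1::real)} t \<partial>lborel)"
    unfolding shrink_def
    by (intro nn_integral_mono) (auto simp: indicator_def ennreal_le_1 intro: power_le_one)
  then show ?thesis by simp
qed

text \<open>Layer cake: \<open>1 - minkowski x\<close> is the length of the set of those
  \<open>t\<close> in (0, 1] with \<open>minkowski x \<le> t\<close>. After Fubini the inner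
  integral is the volume of the sector scaled by \<open>t\<close>, whence a factor independent of
  \<open>S\<close>.\<close>

lemma nn_integral_sector_complement:
  assumes S [measurable]: "S \<in> sets borel"
  shows "(\<integral>\<^sup>+x. indicator (sector S) x * ennreal (1 - minkowski x) \<partial>lborel) = shrink * vol (sector S)"
proof -
  note [measurable] = sector_measurable[OF S]
  let ?f = "\<lambda>x t. indicator (sector S) x * (indicator {0<..1} t * (if minkowski x \<le> t then 1 else 0)) :: ennreal"
  have "(\<integral>\<^sup>+x. indicator (sector S) x * ennreal (1 - minkowski x) \<partial>lborel) =
      (\<integral>\<^sup>+x. \<integral>\<^sup>+t. ?f x t \<partial>lborel \<partial>lborel)"
  proof (intro nn_integral_cong)
    fix x
    show "indicator (sector S) x * ennreal (1 - minkowski x) =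
      (\<integral>\<^sup>+t. ?f x t \<partial>lborel)"
    proof (cases "x \<in> sector S")
      case True
      note x = sector_D[OF True]
      have "(\<integral>\<^sup>+t. ?f x t \<partial>lborel) =
          (\<integral>\<^sup>+t. indicator {minkowski x..1} t \<partial>lborel)"
        using True x by (intro nn_integral_cong) (auto simp: indicator_def)
      then show ?thesis using True x by simp
    qed simp
  qed
  also have "\<dots> = (\<integral>\<^sup>+t. \<integral>\<^sup>+x. ?f x t \<partial>lborel \<partial>lborel)"
    by (rule lborel_pair.Fubini'[symmetric]) measurable
  also have "\<dots> = (\<integral>\<^sup>+t. (indicator {0<..1} t * ennreal (t ^ DIM('a))) * vol (sector S) \<partial>lborel)"
  proof (intro nn_integral_cong)
    fix t :: real
    show "(\<integral>\<^sup>+x. ?f x t \<partial>lborel) =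
        (indicator {0<..1} t * ennreal (t ^ DIM('a))) * vol (sector S)"
    proof (cases "t \<in> {0<..1}")
      case True
      have "(\<integral>\<^sup>+x. ?f x t \<partial>lborel) =
          (\<integral>\<^sup>+x. indicator {x \<in> sector S. minkowski x \<le> t} x \<partial>lborel)"
        using True by (intro nn_integral_cong) (auto simp: indicator_def)
      also have "\<dots> = vol {x \<in> sector S. minkowski x \<le> t}"
        by (intro nn_integral_indicator) simp
      finally show ?thesis using True emeasure_sector_scaled[OF S, of t] by simp
    qed simp
  qed
  also have "\<dots> = shrink * vol (sector S)"
    unfolding shrink_def by (rule nn_integral_multc) simp
  finally show ?thesis .
qed

abbreviation \<nu> :: "'a measure" where "\<nu> \<equiv> uniform_measure (hausdorff_measure k) (frontier K)"

lemma frontier_borel [measurable]: "frontier K \<in> sets borel"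
  by simp

lemma emeasure_lborel_K: "vol K \<noteq> 0" "vol K \<noteq> top"
proof -
  obtain e where "0 < e" "ball c e \<subseteq> K" using c by (auto simp: mem_interior)
  then have "vol (ball c e) \<le> vol K" "0 < vol (ball c e)"
    using K_closed emeasure_lborel_ball_pos by (auto intro!: emeasure_mono)
  then show "vol K \<noteq> 0" by auto
  show "vol K \<noteq> top"
    using emeasure_bounded_finite[OF compact_imp_bounded[OF compact]] by auto
qed

lemma emeasure_sector_eq:
  assumes [measurable]: "S \<in> sets borel"
  shows "vol (sector S) = vol K * emeasure \<nu> S"
proof -
  let ?h = "H k (frontier K)"
  have "emeasure \<nu> S = H k (S \<inter> frontier K) / ?h"
    by (simp add: emeasure_hausdorff_measure Int_commute)
  then have "vol K * emeasure \<nu> S = (vol K * H k (S \<inter> frontier K)) / ?h"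
    by (simp add: ennreal_times_divide)
  also have "\<dots> = vol (sector S) * ?h / ?h"
    by (simp add: emeasure_sector)
  also have "\<dots> = vol (sector S)"
    using H_pos H_fin by (simp add: ennreal_mult_divide_eq less_top)
  finally show ?thesis ..
qed

text \<open>The independence of direction and gauge in the form in which it is applied: the mean
  gauge is the same on all sectors, so volume weighted with \<open>minkowski\<close> has a multiple
  of surface measure as its image under \<open>radial\<close>.\<close>

lemma nn_integral_sector_radial:
  assumes [measurable]: "f \<in> borel_measurable borel"
  shows "(\<integral>\<^sup>+x. indicator (sector UNIV) x * (ennreal (minkowski x) * f (radial x)) \<partial>lborel) =
    (1 - shrink) * vol K * (\<integral>\<^sup>+x. f x \<partial>\<nu>)"
proof -
  let ?V = "vol K"
  note [measurable] = sector_measurable[of UNIV, simplified]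
  define \<rho> where "\<rho> = distr (density lborel (\<lambda>x. indicator (sector UNIV) x * ennreal (minkowski x))) borel radial"
  have "\<rho> = scale_measure ((1 - shrink) * ?V) \<nu>"
  proof (rule measure_eqI)
    fix S assume "S \<in> sets \<rho>"
    then have S [measurable]: "S \<in> sets borel" by (simp add: \<rho>_def)
    note [measurable] = sector_measurable[OF S]
    let ?v = "vol (sector S)"
    have "radial -` S \<in> sets borel"
      using measurable_sets_borel[OF radial_measurable S] by simp
    then have "emeasure \<rho> S = (\<integral>\<^sup>+x. indicator (sector UNIV) x * ennreal (minkowski x) * indicator (radial -` S) x \<partial>lborel)"
      unfolding \<rho>_def by (subst emeasure_distr) (auto simp: emeasure_density)
    also have "\<dots> = (\<integral>\<^sup>+x. indicator (sector S) x * ennreal (minkowski x) \<partial>lborel)"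
      by (intro nn_integral_cong) (auto simp: indicator_def sector_def)
    \<comment> \<open>The complementary integral is added on both sides and cancelled at the end,
      where it is finite, because subtraction of extended nonnegative numbers truncates.\<close>
    finally have "emeasure \<rho> S + shrink * ?v = (\<integral>\<^sup>+x. indicator (sector S) x * ennreal (minkowski x) \<partial>lborel) +
        (\<integral>\<^sup>+x. indicator (sector S) x * ennreal (1 - minkowski x) \<partial>lborel)"
      by (simp add: nn_integral_sector_complement)
    also have "\<dots> = (\<integral>\<^sup>+x. indicator (sector S) x * ennreal (minkowski x) + indicator (sector S) x * ennreal (1 - minkowski x) \<partial>lborel)"
      by (rule nn_integral_add[symmetric]) measurable
    also have "\<dots> = (\<integral>\<^sup>+x. indicator (sector S) x \<partial>lborel)"
    proof (intro nn_integral_cong)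
      fix x
      have "ennreal (minkowski x) + ennreal (1 - minkowski x) = 1" if "x \<in> sector S"
        using sector_D[OF that] by (subst ennreal_plus[symmetric]) auto
      then show "indicator (sector S) x * ennreal (minkowski x) + indicator (sector S) x * ennreal (1 - minkowski x) = indicator (sector S) x"
        by (auto simp: indicator_def)
    qed
    also have "\<dots> = ((1 - shrink) + shrink) * ?v"
      using shrink_le_1 by (simp add: diff_add_cancel_ennreal)
    finally have "shrink * ?v + emeasure \<rho> S = shrink * ?v + (1 - shrink) * ?v"
      by (simp add: distrib_right add.commute)
    moreover have "shrink * ?v \<noteq> top"
    proof -
      have "?v \<le> ?V" using K_closed by (intro emeasure_mono) (auto simp: sector_def)
      then show ?thesis
        using emeasure_lborel_K(2) shrink_le_1 by (auto simp: ennreal_mult_eq_top_iff top_unique)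
    qed
    ultimately have "emeasure \<rho> S = (1 - shrink) * ?v"
      by (simp add: ennreal_add_left_cancel)
    then show "emeasure \<rho> S = emeasure (scale_measure ((1 - shrink) * ?V) \<nu>) S"
      by (simp add: emeasure_sector_eq mult.assoc)
  qed (simp add: \<rho>_def)
  then have "(\<integral>\<^sup>+x. f x \<partial>\<rho>) = (1 - shrink) * ?V * (\<integral>\<^sup>+x. f x \<partial>\<nu>)"
    by (simp add: nn_integral_scale_measure)
  moreover have "(\<integral>\<^sup>+x. f x \<partial>\<rho>) =
      (\<integral>\<^sup>+x. indicator (sector UNIV) x * (ennreal (minkowski x) * f (radial x)) \<partial>lborel)"
    unfolding \<rho>_def by (simp add: nn_integral_distr nn_integral_density mult.assoc)
  ultimately show ?thesis by simp
qed

text \<open>Convexity on the segment from \<open>c\<close> to \<open>radial x\<close> bounds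
  \<open>f x\<close> by a mixture with weight \<open>minkowski x\<close>. Averaging over
  \<open>K\<close> gives weight \<open>1 - shrink\<close> to the boundary mean of \<open>f\<close>
  and weight \<open>shrink\<close> to \<open>f c\<close>, which the last assumption bounds by the
  same mean.\<close>

lemma nn_integral_uniform_le:
  fixes f :: "'a \<Rightarrow> real"
  assumes [measurable]: "f \<in> borel_measurable borel" and f_nonneg: "\<And>x. 0 \<le> f x"
    and conv: "\<And>x t. 0 \<le> t \<Longrightarrow> t \<le> 1 \<Longrightarrow> f (c + t *\<^sub>R (x - c)) \<le> t * f x + (1 - t) * f c"
    and centre: "ennreal (f c) \<le> (\<integral>\<^sup>+x. f x \<partial>\<nu>)"
  shows "(\<integral>\<^sup>+x. f x \<partial>uniform_measure lborel K) \<le> (\<integral>\<^sup>+x. f x \<partial>\<nu>)"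
proof -
  let ?V = "vol K" and ?e = "\<integral>\<^sup>+x. f x \<partial>\<nu>"
  have [measurable]: "K \<in> sets borel" using K_closed by simp
  note [measurable] = sector_measurable[of UNIV, simplified]
  have "(\<integral>\<^sup>+x. ennreal (f x) * indicator K x \<partial>lborel) \<le> (\<integral>\<^sup>+x. indicator (sector UNIV) x * (ennreal (minkowski x) * f (radial x)) +
      indicator (sector UNIV) x * ennreal (1 - minkowski x) * f c \<partial>lborel)"
  \<comment> \<open>The point \<open>c\<close> is in no sector and is discarded as a null
    set.\<close>
  proof (rule nn_integral_mono_AE, rule AE_mp[OF AE_lborel_singleton[of c]], rule AE_I2, rule impI)
    fix x assume "x \<noteq> c"
    show "ennreal (f x) * indicator K x \<le> indicator (sector UNIV) x * (ennreal (minkowski x) * f (radial x)) +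
      indicator (sector UNIV) x * ennreal (1 - minkowski x) * f c"
    proof (cases "x \<in> K")
      case True
      with \<open>x \<noteq> c\<close> have x: "x \<in> sector UNIV" by (simp add: sector_def)
      note g = sector_D[OF x]
      have "f x = f (c + minkowski x *\<^sub>R (radial x - c))"
        using g by (simp add: radial_def)
      also have "\<dots> \<le> minkowski x * f (radial x) + (1 - minkowski x) * f c"
        using g by (intro conv) auto
      finally have "ennreal (f x) \<le> ennreal (minkowski x * f (radial x) + (1 - minkowski x) * f c)"
        by (rule ennreal_leI)
      then show ?thesis
        using g x True f_nonneg by (simp add: ennreal_plus ennreal_mult)
    qed simp
  qed
  also have "\<dots> = (\<integral>\<^sup>+x. indicator (sector UNIV) x * (ennreal (minkowski x) * f (radial x)) \<partial>lborel) +
      (\<integral>\<^sup>+x. indicator (sector UNIV) x * ennreal (1 - minkowski x) * f c \<partial>lborel)"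
    by (rule nn_integral_add) measurable
  also have "(\<integral>\<^sup>+x. indicator (sector UNIV) x * (ennreal (minkowski x) * f (radial x)) \<partial>lborel) = (1 - shrink) * ?V * ?e"
    by (rule nn_integral_sector_radial[of "\<lambda>x. ennreal (f x)"]) measurable
  also have "(\<integral>\<^sup>+x. indicator (sector UNIV) x * ennreal (1 - minkowski x) * f c \<partial>lborel) =
      (\<integral>\<^sup>+x. indicator (sector UNIV) x * ennreal (1 - minkowski x) \<partial>lborel) * f c"
    by (rule nn_integral_multc) measurable
  also have "\<dots> = shrink * vol (sector UNIV) * f c"
    by (simp add: nn_integral_sector_complement)
  also have "\<dots> \<le> shrink * ?V * ?e"
    using centre K_closed by (intro mult_mono emeasure_mono) (auto simp: sector_def)
  also have "(1 - shrink) * ?V * ?e + shrink * ?V * ?e = ((1 - shrink) + shrink) * ?V * ?e"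
    by (simp only: distrib_right)
  also have "\<dots> = ?e * ?V"
    using shrink_le_1 by (simp add: diff_add_cancel_ennreal mult.commute)
  finally have le: "(\<integral>\<^sup>+x. ennreal (f x) * indicator K x \<partial>lborel) \<le> ?e * ?V"
    by (simp add: add_left_mono)
  have "(\<integral>\<^sup>+x. f x \<partial>uniform_measure lborel K) = (\<integral>\<^sup>+x. ennreal (f x) * indicator K x \<partial>lborel) / ?V"
    by (subst nn_integral_uniform_measure) auto
  also have "\<dots> \<le> ?e * ?V / ?V"
    using le by (rule divide_right_mono_ennreal)
  also have "\<dots> = ?e"
    using emeasure_lborel_K by (simp add: ennreal_mult_divide_eq)
  finally show ?thesis .
qed

end

section \<open>Boundary arcs of planar convex bodies\<close>

text \<open>The next two bounds hold because \<open>sqrt (d\<^sup>2 + e\<^sup>2) - e\<close> is decreasing in \<open>e\<close>.\<close>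

lemma sqrt_sum_squares_le_slope:
  fixes d e m :: real
  assumes "0 \<le> d" "m * d \<le> e"
  shows "sqrt (d\<^sup>2 + e\<^sup>2) \<le> (sqrt (1 + m\<^sup>2) - m) * d + e"
proof -
  define q where "q = sqrt (1 + m\<^sup>2)"
  have q: "q\<^sup>2 = 1 + m\<^sup>2" "m \<le> q" "0 \<le> q"
    using real_sqrt_le_mono[of "m\<^sup>2" "1 + m\<^sup>2"] by (auto simp: q_def)
  define f where "f = e - m * d"
  have f: "0 \<le> f" "e = f + m * d" using assms by (auto simp: f_def)
  have "d\<^sup>2 + e\<^sup>2 = q\<^sup>2 * d\<^sup>2 + 2 * (m * (d * f)) + f\<^sup>2"
    unfolding f(2) q(1) by (simp add: power2_eq_square algebra_simps)
  also have "\<dots> \<le> q\<^sup>2 * d\<^sup>2 + 2 * (q * (d * f)) + f\<^sup>2"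
    using q f assms by (simp add: mult_right_mono)
  also have "\<dots> = (q * d + f)\<^sup>2" by (simp add: power2_eq_square algebra_simps)
  finally have "sqrt (d\<^sup>2 + e\<^sup>2) \<le> q * d + f"
    using q f assms by (intro real_le_lsqrt) auto
  then show ?thesis by (simp add: f_def q_def algebra_simps)
qed

lemma sqrt_sum_squares_ge_slope:
  fixes d e m :: real
  assumes "0 \<le> d" "e \<le> m * d"
  shows "(sqrt (1 + m\<^sup>2) - m) * d + e \<le> sqrt (d\<^sup>2 + e\<^sup>2)"
proof -
  define q where "q = sqrt (1 + m\<^sup>2)"
  have q: "q\<^sup>2 = 1 + m\<^sup>2" "m \<le> q"
    using real_sqrt_le_mono[of "m\<^sup>2" "1 + m\<^sup>2"] by (auto simp: q_def)
  define f where "f = m * d - e"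
  have f: "0 \<le> f" "e = m * d - f" using assms by (auto simp: f_def)
  have "(q * d - f)\<^sup>2 = q\<^sup>2 * d\<^sup>2 - 2 * (q * (d * f)) + f\<^sup>2"
    by (simp add: power2_eq_square algebra_simps)
  also have "\<dots> \<le> q\<^sup>2 * d\<^sup>2 - 2 * (m * (d * f)) + f\<^sup>2"
    using q f assms by (simp add: mult_right_mono)
  also have "\<dots> = d\<^sup>2 + e\<^sup>2"
    unfolding f(2) q(1) by (simp add: power2_eq_square algebra_simps)
  finally have "q * d - f \<le> sqrt (d\<^sup>2 + e\<^sup>2)"
    by (rule real_le_rsqrt)
  then show ?thesis by (simp add: f_def q_def algebra_simps)
qed

text \<open>The parameter \<open>(sqrt (1 + m\<^sup>2) - m) * x + f x\<close> makes the graph a 1-Lipschitz curve. The sign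
  \<open>sg\<close> covers the upper and the lower boundary arc of a body at once.\<close>

lemma hausdorff_outer_graph_le:
  fixes f :: "real \<Rightarrow> real"
  assumes "s \<le> t" and sign: "\<bar>sg\<bar> = 1"
    and slope: "\<And>x x'. s \<le> x \<Longrightarrow> x \<le> x' \<Longrightarrow> x' \<le> t \<Longrightarrow> m * (x' - x) \<le> f x' - f x"
  shows "H 1 ((\<lambda>x. (x, sg * f x)) ` {s..t}) \<le> ennreal ((sqrt (1 + m\<^sup>2) - m) * (t - s) + (f t - f s))"
proof -
  define \<tau> where "\<tau> x = (sqrt (1 + m\<^sup>2) - m) * x + f x" for x
  have chord: "dist (x, sg * f x) (x', sg * f x') \<le> \<tau> x' - \<tau> x" if "s \<le> x" "x \<le> x'" "x' \<le> t" for x x'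
  proof -
    have "\<bar>sg * f x - sg * f x'\<bar> = \<bar>f x' - f x\<bar>"
      using sign by (simp add: abs_mult abs_minus_commute flip: right_diff_distrib)
    then have "dist (x, sg * f x) (x', sg * f x') = sqrt ((x' - x)\<^sup>2 + (f x' - f x)\<^sup>2)"
      by (simp add: dist_Pair_Pair dist_real_def power2_commute)
    also have "\<dots> \<le> (sqrt (1 + m\<^sup>2) - m) * (x' - x) + (f x' - f x)"
      using that slope[OF that] by (intro sqrt_sum_squares_le_slope) auto
    finally show ?thesis by (simp add: \<tau>_def algebra_simps)
  qed
  have lip: "dist (x, sg * f x) (x', sg * f x') \<le> dist (\<tau> x) (\<tau> x')" if "x \<in> {s..t}" "x' \<in> {s..t}" for x x'
    using chord[of x x'] chord[of x' x] that by (cases "x \<le> x'") (auto simp: dist_real_def dist_commute)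
  have inj: "inj_on \<tau> {s..t}"
    using lip by (force simp: inj_on_def)
  have "(\<lambda>x. (x, sg * f x)) ` {s..t} = (\<lambda>u. let x = inv_into {s..t} \<tau> u in (x, sg * f x)) ` \<tau> ` {s..t}"
    using inj by (auto simp: image_image Let_def intro!: image_cong)
  also have "H 1 \<dots> \<le> H 1 (\<tau> ` {s..t})"
    using lip inj by (intro hausdorff_outer_image_le) (auto simp: Let_def)
  \<comment> \<open>Continuity of \<open>f\<close> is not assumed, so the image of
    \<open>\<tau>\<close> is merely included in the interval between its end values; an upper bound
    asks for no more.\<close>
  also have "\<dots> \<le> H 1 {\<tau> s..\<tau> t}"
  proof (intro hausdorff_outer_mono image_subsetI)
    fix x assume "x \<in> {s..t}"
    then show "\<tau> x \<in> {\<tau> s..\<tau> t}"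
      using order_trans[OF zero_le_dist chord, of s x] order_trans[OF zero_le_dist chord, of x t] by auto
  qed
  also have "\<dots> \<le> ennreal (\<tau> t - \<tau> s)"
    using order_trans[OF zero_le_dist chord, of s t] \<open>s \<le> t\<close> by (intro hausdorff_outer_1_interval_le) auto
  also have "\<tau> t - \<tau> s = (sqrt (1 + m\<^sup>2) - m) * (t - s) + (f t - f s)"
    by (simp add: \<tau>_def algebra_simps)
  finally show ?thesis .
qed

text \<open>Orthogonal projection onto the line through \<open>P\<close> and \<open>Q\<close> is
  1-Lipschitz. From each point of the chord the ray in direction \<open>n\<close> meets the
  boundary, so the projected boundary covers the chord. \<open>W\<close> records where these exit
  points lie, which later makes several such arcs disjoint.\<close>

lemma dist_le_hausdorff_outer_frontier:
  fixes K :: "'a::euclidean_space set"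
  assumes K: "compact K" "convex K" "P \<in> K" "Q \<in> K" and n: "n \<noteq> 0" "n \<bullet> (Q - P) = 0"
    and exit: "\<And>th \<tau>. 0 < th \<Longrightarrow> th < 1 \<Longrightarrow> 0 \<le> \<tau> \<Longrightarrow> P + th *\<^sub>R (Q - P) + \<tau> *\<^sub>R n \<in> frontier K \<Longrightarrow>
      P + th *\<^sub>R (Q - P) + \<tau> *\<^sub>R n \<in> W"
  shows "ennreal (dist P Q) \<le> H 1 (frontier K \<inter> W)"
proof (cases "P = Q")
  case False
  define l where "l = norm (Q - P)"
  have l: "0 < l" "dist P Q = l" using False by (auto simp: l_def dist_norm norm_minus_commute)
  define p where "p x = (x - P) \<bullet> (Q - P) / l" for x
  have "{0<..<l} \<subseteq> p ` (frontier K \<inter> W)"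
  proof
    fix s assume s: "s \<in> {0<..<l}"
    define z where "z = P + (s / l) *\<^sub>R (Q - P)"
    have "z = (1 - s / l) *\<^sub>R P + (s / l) *\<^sub>R Q" by (simp add: z_def algebra_simps)
    then have "z \<in> K" using K s l by (auto intro!: convexD simp: divide_le_eq_1)
    obtain \<tau> where \<tau>: "0 \<le> \<tau>" "z + \<tau> *\<^sub>R n \<in> frontier K"
    proof (cases "z \<in> interior K")
      case True
      then show ?thesis
        using ray_to_frontier[OF compact_imp_bounded[OF K(1)] True n(1)] that by (metis less_imp_le)
    next
      \<comment> \<open>A chord point on the boundary is its own exit point, with parameter
        0.\<close>
      case False
      then show ?thesis
        using \<open>z \<in> K\<close> closure_subset that[of 0] by (auto simp: frontier_def)
    qed
    have "z + \<tau> *\<^sub>R n \<in> W"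
      unfolding z_def using \<tau> s l by (intro exit) (auto simp: z_def)
    moreover have "p (z + \<tau> *\<^sub>R n) = s"
    proof -
      have "(z + \<tau> *\<^sub>R n - P) \<bullet> (Q - P) = (s / l) * ((Q - P) \<bullet> (Q - P)) + \<tau> * (n \<bullet> (Q - P))"
        by (simp add: z_def inner_add_left)
      also have "\<dots> = s * l" using n l by (simp add: l_def dot_square_norm power2_eq_square)
      finally show ?thesis using l by (simp add: p_def)
    qed
    ultimately show "s \<in> p ` (frontier K \<inter> W)" using \<tau> by (metis IntI imageI)
  qed
  then have "ennreal (l - 0) \<le> H 1 (p ` (frontier K \<inter> W))"
    using l by (intro hausdorff_outer_1_ge_length) auto
  also have "\<dots> \<le> H 1 (frontier K \<inter> W)"
  proof (rule hausdorff_outer_image_le)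
    fix x y
    have "p x - p y = (x - y) \<bullet> (Q - P) / l"
      by (simp add: p_def inner_diff_left diff_divide_distrib)
    also have "\<bar>\<dots>\<bar> \<le> norm (x - y) * norm (Q - P) / l"
      using Cauchy_Schwarz_ineq2[of "x - y" "Q - P"] l by (simp add: divide_right_mono)
    also have "\<dots> = norm (x - y)" using l by (simp add: l_def)
    finally show "dist (p x) (p y) \<le> dist x y" by (simp add: dist_real_def dist_norm)
  qed
  finally show ?thesis using l by simp
qed simp

text \<open>With \<open>sg\<close> equal to 1 or -1 the points \<open>(t, p)\<close> and
  \<open>(y, q)\<close> are the upper or the lower ends of two vertical slices. The normal rays of
  the chord leave \<open>K\<close> strictly between the two vertical lines: crossing one of them
  inside \<open>K\<close> would produce a point of that slice beyond its end.\<close>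

lemma arc_length_ge_chord:
  fixes K :: "(real \<times> real) set"
  assumes K: "compact K" "convex K" and PQ: "(t, p) \<in> K" "(y, q) \<in> K" "t < y" and sign: "sg * sg = (1::real)"
    and p: "\<And>v. (t, v) \<in> K \<Longrightarrow> sg * v \<le> sg * p" and q: "\<And>v. (y, v) \<in> K \<Longrightarrow> sg * v \<le> sg * q"
  shows "ennreal (sqrt ((y - t)\<^sup>2 + (q - p)\<^sup>2)) \<le> H 1 (frontier K \<inter>
    {z. t < fst z \<and> fst z < y \<and> 0 \<le> sg * ((snd z - p) * (y - t) - (q - p) * (fst z - t))})"
    (is "_ \<le> H 1 (frontier K \<inter> ?W)")
proof -
  define d where "d = y - t"
  define e where "e = q - p"
  let ?n = "(- (sg * e), sg * d)"
  have d: "0 < d" using PQ by (simp add: d_def)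
  have sg: "sg \<noteq> 0" using sign by auto
  have "ennreal (dist (t, p) (y, q)) \<le> H 1 (frontier K \<inter> ?W)"
  proof (rule dist_le_hausdorff_outer_frontier[OF K PQ(1,2)])
    show "?n \<noteq> 0" using d sg by (simp add: zero_prod_def)
    show "?n \<bullet> ((y, q) - (t, p)) = 0" by (simp add: d_def e_def inner_Pair)
    fix th \<tau> :: real assume th: "0 < th" "th < 1" and \<tau>: "0 \<le> \<tau>"
    let ?z = "(t, p) + th *\<^sub>R ((y, q) - (t, p)) + \<tau> *\<^sub>R ?n"
    define Z where "Z \<sigma> = (t + th * d - \<sigma> * (sg * e), p + th * e + \<sigma> * (sg * d))" for \<sigma>
    have Z: "?z = Z \<tau>"
      by (simp add: Z_def d_def e_def)
    assume "?z \<in> frontier K"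
    then have ZK: "Z \<tau> \<in> K"
      unfolding Z using frontier_subset_closed[OF compact_imp_closed[OF K(1)]] by auto
    have "Z 0 = (1 - th) *\<^sub>R (t, p) + th *\<^sub>R (y, q)"
      by (simp add: Z_def d_def e_def algebra_simps)
    then have Z0: "Z 0 \<in> K"
      using th convexD[OF K(2) PQ(1,2), of "1 - th" th] by simp
    have mid: "Z \<sigma> \<in> K" if "0 < \<sigma>" "\<sigma> \<le> \<tau>" for \<sigma>
    proof -
      have eq: "Z \<sigma> = (1 - \<sigma> / \<tau>) *\<^sub>R Z 0 + (\<sigma> / \<tau>) *\<^sub>R Z \<tau>"
        using that by (simp add: Z_def field_simps)
      show ?thesis unfolding eq
        using that by (intro convexD[OF K(2) Z0 ZK]) (auto simp: field_simps)
    qed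
    have "t < fst (Z \<tau>)"
    proof (rule ccontr)
      assume "\<not> t < fst (Z \<tau>)"
      then have le: "th * d \<le> \<tau> * (sg * e)" by (simp add: Z_def)
      have "0 < th * d" using th d by simp
      then have pos: "0 < sg * e" using le \<tau> by (meson less_le_trans zero_less_mult_pos2 mult_nonneg_nonpos not_le)
      \<comment> \<open>The parameter at which the normal ray crosses the vertical line at abscissa
        \<open>t\<close>. The other end of the strip is handled in the same way.\<close>
      define \<sigma> where "\<sigma> = th * d / (sg * e)"
      have \<sigma>: "0 < \<sigma>" "\<sigma> \<le> \<tau>" "\<sigma> * (sg * e) = th * d"
        using pos le \<open>0 < th * d\<close> by (auto simp: \<sigma>_def divide_le_eq)
      have "(t, p + th * e + \<sigma> * (sg * d)) \<in> K"
        using mid[OF \<sigma>(1,2)] \<sigma>(3) by (simp add: Z_def)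
      from p[OF this] have "th * (sg * e) + (sg * sg) * (\<sigma> * d) \<le> 0"
        by (simp add: algebra_simps)
      moreover have "0 < th * (sg * e)" "0 < \<sigma> * d" using th pos \<sigma> d by auto
      ultimately show False using sign by simp
    qed
    moreover have "fst (Z \<tau>) < y"
    proof (rule ccontr)
      assume "\<not> fst (Z \<tau>) < y"
      then have le: "(1 - th) * d \<le> \<tau> * (- (sg * e))" by (simp add: Z_def d_def algebra_simps)
      have "0 < (1 - th) * d" using th d by simp
      then have pos: "0 < - (sg * e)" using le \<tau> by (meson less_le_trans zero_less_mult_pos2 mult_nonneg_nonpos not_le)
      define \<sigma> where "\<sigma> = (1 - th) * d / (- (sg * e))"
      have \<sigma>: "0 < \<sigma>" "\<sigma> \<le> \<tau>" "\<sigma> * (- (sg * e)) = (1 - th) * d"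
        using divide_pos_pos[OF \<open>0 < (1 - th) * d\<close> pos] pos_divide_le_eq[OF pos] le pos
        unfolding \<sigma>_def by (blast, blast, metis less_irrefl nonzero_divide_eq_eq)
      have "t + th * d - \<sigma> * (sg * e) = y" using \<sigma>(3) by (simp add: d_def algebra_simps)
      then have "(y, p + th * e + \<sigma> * (sg * d)) \<in> K"
        using mid[OF \<sigma>(1,2)] by (simp add: Z_def)
      from q[OF this] have "(1 - th) * (- (sg * e)) + (sg * sg) * (\<sigma> * d) \<le> 0"
        by (simp add: e_def algebra_simps)
      moreover have "0 < (1 - th) * (- (sg * e))" "0 < \<sigma> * d"
        using th pos \<sigma>(1) d by (intro mult_pos_pos; simp)+
      ultimately show False using sign by simp
    qed
    moreover have "sg * ((snd (Z \<tau>) - p) * d - e * (fst (Z \<tau>) - t)) = (sg * sg) * \<tau> * (d\<^sup>2 + e\<^sup>2)"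
      by (simp add: Z_def algebra_simps power2_eq_square)
    then have "0 \<le> sg * ((snd (Z \<tau>) - p) * d - e * (fst (Z \<tau>) - t))"
      using sign \<tau> by simp
    ultimately show "?z \<in> ?W"
      unfolding Z by (simp add: d_def e_def)
  qed
  then show ?thesis
    by (simp add: dist_Pair_Pair dist_real_def power2_commute)
qed

lemma divide_diff_combination:
  fixes p q x :: real
  assumes "p \<noteq> q"
  shows "(x - q) / (p - q) * p + (1 - (x - q) / (p - q)) * q = x"
proof -
  have "(x - q) / (p - q) * (p - q) = x - q" using assms by simp
  then show ?thesis by (simp only: right_diff_distrib left_diff_distrib mult_1_left)
qed

text \<open>The two conclusions feed the two slope bounds for arcs: to the right of \<open>t\<close>
  chords from \<open>t\<close> have slope at most \<open>m\<close>, and to the left of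
  \<open>t\<close> all chords have slope at least \<open>m\<close>.\<close>

lemma concave_supergradient:
  fixes f :: "real \<Rightarrow> real"
  assumes f: "concave_on {a..b} f" and t: "a < t" "t < b"
  obtains m where "\<And>x. x \<in> {a..b} \<Longrightarrow> f x \<le> f t + m * (x - t)"
    "\<And>x x'. a \<le> x \<Longrightarrow> x \<le> x' \<Longrightarrow> x' \<le> t \<Longrightarrow> m * (x' - x) \<le> f x' - f x"
proof -
  \<comment> \<open>This is the right derivative of \<open>f\<close> at \<open>t\<close>, written
    for the convex function \<open>- f\<close>.\<close>
  define m where "m = - Inf ((\<lambda>x. (- f t - - f x) / (t - x)) ` ({t<..} \<inter> {a..b}))"
  have "- f t + Inf ((\<lambda>x. (- f t - - f x) / (t - x)) ` ({t<..} \<inter> {a..b})) * (x - t) \<le> - f x"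
    if "x \<in> {a..b}" for x
    using convex_le_Inf_differential[OF f[unfolded concave_on_def] _ that, of t] t by simp
  then have m: "f x \<le> f t + m * (x - t)" if "x \<in> {a..b}" for x
    using that unfolding m_def by fastforce
  have "m * (x' - x) \<le> f x' - f x" if x: "a \<le> x" "x \<le> x'" "x' \<le> t" for x x'
  proof (cases "x = x' \<or> x' = t")
    case True
    then show ?thesis using m[of x] x t by (auto simp: algebra_simps)
  next
    case False
    then have lt: "x < x'" "x' < t" using x by auto
    define u where "u = (t - x') / (t - x)"
    have u: "0 \<le> u" "u \<le> 1" "u * x + (1 - u) * t = x'" "0 < u"
      using lt by (auto simp: u_def divide_simps) (auto simp: algebra_simps)
    have "u * f x + (1 - u) * f t \<le> f x'"
      using convex_onD[OF f[unfolded concave_on_def], of "1 - u" x t] u(1-3) x t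
      by (simp add: algebra_simps)
    moreover have "(1 - u) * f x' + (1 - u) * (m * (t - x')) \<le> (1 - u) * f t"
      using mult_left_mono[OF m[of x'], of "1 - u"] u x t by (auto simp: algebra_simps)
    ultimately have "(1 - u) * (m * (t - x')) \<le> u * (f x' - f x)" by (simp add: algebra_simps)
    moreover have "(1 - u) * (t - x') = u * (x' - x)"
      using u(3) by (simp add: algebra_simps)
    ultimately have "u * (m * (x' - x)) \<le> u * (f x' - f x)"
      by (metis mult.assoc mult.commute)
    then show ?thesis using u(4) by simp
  qed
  with m show ?thesis by (rule that)
qed

section \<open>Vertical slices of a planar convex body\<close>

locale planar_body =
  fixes K :: "(real \<times> real) set"
  assumes compact: "compact K" and convex: "convex K" and interior: "interior K \<noteq> {}"
begin

definition xmin :: real where "xmin = Inf (fst ` K)"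
definition xmax :: real where "xmax = Sup (fst ` K)"
text \<open>Outside the interval from \<open>xmin\<close> to \<open>xmax\<close> the slices are
  empty and the values of \<open>upper\<close> and \<open>lower\<close> carry no meaning; integrals
  of the width are therefore restricted to this interval.\<close>

definition upper :: "real \<Rightarrow> real" where "upper x = Sup {y. (x, y) \<in> K}"
definition lower :: "real \<Rightarrow> real" where "lower x = Inf {y. (x, y) \<in> K}"
definition width :: "real \<Rightarrow> real" where "width x = upper x - lower x"

lemma K_closed: "closed K" using compact by (rule compact_imp_closed)

lemma convexK: "(x, y) \<in> K \<Longrightarrow> (x', y') \<in> K \<Longrightarrow> 0 \<le> u \<Longrightarrow> 0 \<le> v \<Longrightarrow> u + v = 1 \<Longrightarrow>
    (u * x + v * x', u * y + v * y') \<in> K"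
  using convexD[OF convex, of "(x, y)" "(x', y')" u v] by simp

lemma compact_fst: "compact (fst ` K)"
  using compact by (intro compact_continuous_image continuous_intros)

lemma compact_slice: "compact {y. (x, y) \<in> K}"
proof -
  have "{y. (x, y) \<in> K} = snd ` (K \<inter> {x} \<times> UNIV)" by force
  then show ?thesis
    using compact by (auto intro!: compact_continuous_image continuous_intros compact_Int_closed closed_Times)
qed

lemma fst_K: "fst ` K = {xmin..xmax}"
proof -
  have ne: "fst ` K \<noteq> {}" using interior interior_subset by auto
  have cl: "closed (fst ` K)" and bdd: "bdd_below (fst ` K)" "bdd_above (fst ` K)"
    using compact_fst by (auto intro: compact_imp_closed bounded_imp_bdd_below bounded_imp_bdd_above compact_imp_bounded)
  have "convex (fst ` K)" using convex by (intro convex_linear_image) (auto simp: linear_fst)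
  moreover have "xmin \<in> fst ` K" "xmax \<in> fst ` K"
    unfolding xmin_def xmax_def
    by (rule closed_contains_Inf[OF ne bdd(1) cl], rule closed_contains_Sup[OF ne bdd(2) cl])
  ultimately have "{xmin..xmax} \<subseteq> fst ` K"
    by (metis atLeastatMost_empty_iff closed_segment_eq_real_ivl convex_contains_segment empty_subsetI)
  moreover have "fst ` K \<subseteq> {xmin..xmax}"
    unfolding xmin_def xmax_def using cInf_lower[OF _ bdd(1)] cSup_upper[OF _ bdd(2)] by fastforce
  ultimately show ?thesis by (rule equalityI[rotated])
qed

lemma K_range: "(x, y) \<in> K \<Longrightarrow> xmin \<le> x \<and> x \<le> xmax"
  using fst_K by (metis atLeastAtMost_iff fst_conv imageI)

lemma slice_nonempty: "xmin \<le> x \<Longrightarrow> x \<le> xmax \<Longrightarrow> {y. (x, y) \<in> K} \<noteq> {}"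
  using fst_K by (force simp: set_eq_iff image_iff)

lemma slice_bdd: "bdd_below {y. (x, y) \<in> K}" "bdd_above {y. (x, y) \<in> K}" "closed {y. (x, y) \<in> K}"
  using compact_slice[of x]
  by (auto intro: compact_imp_closed bounded_imp_bdd_below bounded_imp_bdd_above compact_imp_bounded)

lemma slice_bounds: "(x, y) \<in> K \<Longrightarrow> lower x \<le> y \<and> y \<le> upper x"
  unfolding upper_def lower_def using cInf_lower[OF _ slice_bdd(1)] cSup_upper[OF _ slice_bdd(2)] by blast

lemma upper_lower_in:
  assumes "xmin \<le> x" "x \<le> xmax"
  shows "(x, upper x) \<in> K" "(x, lower x) \<in> K"
  using closed_contains_Inf[OF slice_nonempty[OF assms] slice_bdd(1,3)]
    closed_contains_Sup[OF slice_nonempty[OF assms] slice_bdd(2,3)]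
  unfolding upper_def lower_def by blast+

lemma slice_eq:
  assumes "xmin \<le> x" "x \<le> xmax"
  shows "{y. (x, y) \<in> K} = {lower x..upper x}"
proof -
  have "y \<in> {y. (x, y) \<in> K}" if "y \<in> {lower x..upper x}" for y
  proof (cases "lower x = upper x")
    case True
    then show ?thesis using that upper_lower_in[OF assms] by auto
  next
    case False
    define v where "v = (y - lower x) / (upper x - lower x)"
    have v: "0 \<le> v" "v \<le> 1" "(1 - v) * lower x + v * upper x = y"
      using that False divide_diff_combination[of "upper x" "lower x" y]
      by (auto simp: v_def divide_le_eq add.commute)
    have "((1 - v) * x + v * x, (1 - v) * lower x + v * upper x) \<in> K"
      using upper_lower_in[OF assms] v by (intro convexK) auto
    moreover have "(1 - v) * x + v * x = x" by (simp add: algebra_simps)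
    ultimately show ?thesis using v by simp
  qed
  moreover have "y \<in> {lower x..upper x}" if "y \<in> {y. (x, y) \<in> K}" for y
    using slice_bounds[of x y] that by simp
  ultimately show ?thesis by (intro equalityI subsetI)
qed

lemma upper_concave: "concave_on {xmin..xmax} upper"
  unfolding concave_on_iff
proof (intro conjI ballI allI impI)
  fix x y u v :: real assume *: "x \<in> {xmin..xmax}" "y \<in> {xmin..xmax}" "0 \<le> u" "0 \<le> v" "u + v = 1"
  have "(u * x + v * y, u * upper x + v * upper y) \<in> K"
    using * upper_lower_in by (intro convexK) auto
  then show "u * upper x + v * upper y \<le> upper (u *\<^sub>R x + v *\<^sub>R y)"
    using slice_bounds by simp
qed simp

lemma lower_convex: "convex_on {xmin..xmax} lower"
  unfolding convex_on_def
proof (intro conjI ballI allI impI)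
  fix x y u v :: real assume *: "x \<in> {xmin..xmax}" "y \<in> {xmin..xmax}" "0 \<le> u" "0 \<le> v" "u + v = 1"
  have "(u * x + v * y, u * lower x + v * lower y) \<in> K"
    using * upper_lower_in by (intro convexK) auto
  then show "lower (u *\<^sub>R x + v *\<^sub>R y) \<le> u * lower x + v * lower y"
    using slice_bounds by simp
qed simp

lemma width_concave: "concave_on {xmin..xmax} width"
  using convex_on_add[OF lower_convex upper_concave[unfolded concave_on_def]]
  by (simp add: concave_on_def width_def[abs_def])

text \<open>\<open>K\<close> contains a vertical segment over some \<open>x0\<close>. Any
  \<open>x\<close> strictly between the extremes is a combination of \<open>x0\<close>, with
  positive weight \<open>u\<close>, and an end of the range; joining the segment to a point over
  that end leaves a segment over \<open>x\<close> that is \<open>u\<close> times as long.\<close>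

lemma width_pos:
  assumes x: "xmin < x" "x < xmax"
  shows "0 < width x"
proof -
  obtain z e where z: "0 < e" "ball z e \<subseteq> K" using interior by (auto simp: mem_interior)
  obtain x0 y0 where z0: "z = (x0, y0)" by (cases z)
  have "dist (x0, y0) (x0, y0 + e / 2) < e"
    using z(1) by (simp add: dist_Pair_Pair dist_real_def)
  then have K0: "(x0, y0) \<in> K" "(x0, y0 + e / 2) \<in> K"
    using z unfolding z0 by auto
  have "\<exists>u x1. 0 < u \<and> u \<le> 1 \<and> xmin \<le> x1 \<and> x1 \<le> xmax \<and> x = u * x0 + (1 - u) * x1"
  proof (cases x0 x rule: linorder_cases)
    case less
    then show ?thesis using x
      using divide_diff_combination[of x0 xmax x]
      by (intro exI[of _ "(x - xmax) / (x0 - xmax)"] exI[of _ xmax])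
        (auto simp: divide_le_eq zero_less_divide_iff)
  next
    case equal
    then show ?thesis using x by (intro exI[of _ 1] exI[of _ xmax]) auto
  next
    case greater
    then show ?thesis using x
      using divide_diff_combination[of x0 xmin x]
      by (intro exI[of _ "(x - xmin) / (x0 - xmin)"] exI[of _ xmin])
        (auto simp: divide_le_eq zero_less_divide_iff)
  qed
  then obtain u x1 where u: "0 < u" "u \<le> 1" "xmin \<le> x1" "x1 \<le> xmax" "x = u * x0 + (1 - u) * x1"
    by blast
  have "(x, u * y0 + (1 - u) * upper x1) \<in> K" "(x, u * (y0 + e / 2) + (1 - u) * upper x1) \<in> K"
    unfolding u(5) using u K0 upper_lower_in by (auto intro!: convexK simp del: distrib_left)
  then have "lower x \<le> u * y0 + (1 - u) * upper x1" "u * (y0 + e / 2) + (1 - u) * upper x1 \<le> upper x"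
    using slice_bounds by blast+
  moreover have "0 < u * (e / 2)" using u z by simp
  ultimately show ?thesis by (simp add: width_def algebra_simps)
qed

text \<open>Concave and convex functions are continuous inside their domain, so over the open
  interval the region strictly between \<open>lower\<close> and \<open>upper\<close> is open. Hence
  the boundary there consists of the two graphs.\<close>

lemma interior_slice:
  assumes "xmin < x" "x < xmax" "lower x < y" "y < upper x"
  shows "(x, y) \<in> interior K"
proof -
  have sub: "{xmin<..<xmax} \<subseteq> {xmin..xmax}" by auto
  have "continuous_on {xmin<..<xmax} (\<lambda>x. - upper x)" "continuous_on {xmin<..<xmax} lower"
    using upper_concave lower_convex
    by (auto intro!: convex_on_continuous convex_on_subset[OF _ sub] simp: concave_on_def)
  then have ct: "continuous_on {xmin<..<xmax} upper" "continuous_on {xmin<..<xmax} lower"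
    using continuous_on_minus by fastforce+
  let ?S = "{xmin<..<xmax} \<times> (UNIV :: real set)"
  have "continuous_on ?S (\<lambda>z. (snd z - lower (fst z), upper (fst z) - snd z))"
    by (intro continuous_intros continuous_on_compose2[OF ct(1)] continuous_on_compose2[OF ct(2)]) auto
  then have "open (?S \<inter> (\<lambda>z. (snd z - lower (fst z), upper (fst z) - snd z)) -` ({0<..} \<times> {0<..}))"
    by (intro continuous_open_preimage open_Times) auto
  moreover have "?S \<inter> (\<lambda>z. (snd z - lower (fst z), upper (fst z) - snd z)) -` ({0<..} \<times> {0<..}) \<subseteq> K"
  proof
    fix z assume z: "z \<in> ?S \<inter> (\<lambda>z. (snd z - lower (fst z), upper (fst z) - snd z)) -` ({0<..} \<times> {0<..})"
    then have "snd z \<in> {y. (fst z, y) \<in> K}"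
      by (subst slice_eq) auto
    then show "z \<in> K" by simp
  qed
  ultimately show ?thesis
    using assms by (intro interiorI) auto
qed

lemma frontier_slice:
  assumes "(x, y) \<in> frontier K" "xmin < x" "x < xmax"
  shows "y = upper x \<or> y = lower x"
proof -
  have "(x, y) \<in> K" "(x, y) \<notin> interior K"
    using assms(1) K_closed by (auto simp: frontier_def)
  then show ?thesis
    using slice_bounds interior_slice assms(2,3) by (metis order_le_less)
qed

end

text \<open>Unimodality of the width, for the cap beyond \<open>t\<close>; the next lemma is the
  counterpart for the strip from \<open>s\<close> to \<open>t\<close>.\<close>

lemma concave_on_below_after:
  fixes f :: "real \<Rightarrow> real"
  assumes f: "concave_on S f" and S: "s \<in> S" "x \<in> S" and "s < t" "t < x" and le: "f t \<le> f s"
  shows "f x \<le> f t"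
proof -
  define u where "u = (t - s) / (x - s)"
  have u: "0 < u" "u \<le> 1" "u * x + (1 - u) * s = t"
    using assms divide_diff_combination[of x s t] by (auto simp: u_def divide_le_eq)
  have "(1 - u) * f s + u * f x \<le> f t"
    using convex_onD[OF f[unfolded concave_on_def], of u s x] u S by (simp add: algebra_simps)
  moreover have "(1 - u) * f t \<le> (1 - u) * f s" using u le by (intro mult_left_mono) auto
  ultimately have "u * f x \<le> u * f t" by (simp add: algebra_simps)
  then show ?thesis using u by simp
qed

lemma concave_on_above_between:
  fixes f :: "real \<Rightarrow> real"
  assumes f: "concave_on S f" and S: "s \<in> S" "t \<in> S" and "s \<le> x" "x \<le> t" and le: "f t \<le> f s"
  shows "f t \<le> f x"
proof (cases "s = t")
  case False
  define u where "u = (x - s) / (t - s)"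
  have u: "0 \<le> u" "u \<le> 1" "u * t + (1 - u) * s = x"
    using assms False divide_diff_combination[of t s x] by (auto simp: u_def divide_le_eq)
  have "(1 - u) * f s + u * f t \<le> f x"
    using convex_onD[OF f[unfolded concave_on_def], of u s t] u S by (simp add: algebra_simps)
  moreover have "(1 - u) * f t \<le> (1 - u) * f s" using u le by (intro mult_left_mono) auto
  ultimately show ?thesis by (simp add: algebra_simps)
qed (use assms in auto)

lemma fst_snd_borel [measurable]:
  "fst \<in> borel_measurable (borel :: (real \<times> real) measure)" "snd \<in> borel_measurable (borel :: (real \<times> real) measure)"
  by (intro borel_measurable_continuous_onI continuous_intros)+

lemma hausdorff_outer_plus:
  assumes "A \<in> sets borel" "B \<in> sets borel" "A \<inter> B = {}"
  shows "H k (A \<union> B) = H k A + H k B"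
  using plus_emeasure[of A "hausdorff_measure k" B] assms by (simp add: emeasure_hausdorff_measure)

text \<open>A right triangle of height \<open>w\<close> whose hypotenuse falls with slope
  \<open>\<phi> / 2\<close>: the sloping end of the trapezoid that dominates a cap.\<close>

lemma nn_integral_decreasing_ramp:
  fixes w \<phi> c :: real
  assumes "0 < \<phi>" "0 \<le> w"
  shows "(\<integral>\<^sup>+x. ennreal (w - \<phi> * (x - c) / 2) * indicator {c..c + 2 * w / \<phi>} x \<partial>lborel) = ennreal (w\<^sup>2 / \<phi>)"
proof -
  define F where "F x = w * (x - c) - \<phi> * (x - c)\<^sup>2 / 4" for x
  have "(\<integral>\<^sup>+x. ennreal (w - \<phi> * (x - c) / 2) * indicator {c..c + 2 * w / \<phi>} x \<partial>lborel) =
      F (c + 2 * w / \<phi>) - F c"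
  proof (rule nn_integral_FTC_Icc)
    fix x assume x: "x \<in> {c..c + 2 * w / \<phi>}"
    show "DERIV F x :> w - \<phi> * (x - c) / 2"
      unfolding F_def by (auto intro!: derivative_eq_intros)
    show "0 \<le> w - \<phi> * (x - c) / 2"
      using x assms by (simp add: field_simps)
  qed (use assms in auto)
  also have "F (c + 2 * w / \<phi>) - F c = w\<^sup>2 / \<phi>"
    using assms by (simp add: F_def field_simps power2_eq_square)
  finally show ?thesis .
qed

section \<open>Arc length against area of caps\<close>

context planar_body
begin

definition area_beyond :: "real \<Rightarrow> ennreal" where
  "area_beyond t = vol (K \<inter> {z. t < fst z})"

definition arc_beyond :: "real \<Rightarrow> ennreal" where
  "arc_beyond t = H 1 (frontier K \<inter> {z. t < fst z})"

lemma K_borel [measurable]: "K \<in> sets borel" and frontier_borel [measurable]: "frontier K \<in> sets borel"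
  using K_closed by auto

lemma emeasure_strip:
  assumes [measurable]: "S \<in> sets borel"
  shows "vol (K \<inter> {z. fst z \<in> S}) = (\<integral>\<^sup>+x. ennreal (width x) * indicator (S \<inter> {xmin..xmax}) x \<partial>lborel)"
proof -
  let ?A = "K \<inter> {z. fst z \<in> S}"
  have "?A \<in> sets (lborel :: (real \<times> real) measure)" by simp
  then have A: "?A \<in> sets ((lborel :: real measure) \<Otimes>\<^sub>M (lborel :: real measure))"
    by (simp only: lborel_prod)
  have "vol ?A = (\<integral>\<^sup>+x. vol (Pair x -` ?A) \<partial>lborel)"
    using lborel.emeasure_pair_measure_alt[OF A] by (simp add: lborel_prod)
  also have "\<dots> = (\<integral>\<^sup>+x. ennreal (width x) * indicator (S \<inter> {xmin..xmax}) x \<partial>lborel)"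
  proof (intro nn_integral_cong)
    fix x
    show "vol (Pair x -` ?A) = ennreal (width x) * indicator (S \<inter> {xmin..xmax}) x"
    proof (cases "x \<in> S \<inter> {xmin..xmax}")
      case True
      then have "Pair x -` ?A = {lower x..upper x}"
        using slice_eq[of x] by auto
      moreover have "lower x \<le> upper x"
        using True slice_bounds[OF upper_lower_in(1)[of x]] by auto
      ultimately show ?thesis using True by (simp add: width_def)
    next
      case False
      then have "Pair x -` ?A = {}" using K_range by auto
      then show ?thesis using False by simp
    qed
  qed
  finally show ?thesis .
qed

text \<open>Horizontal projection takes the boundary of the cap onto the vertical chord at
  \<open>y\<close>.\<close>

lemma arc_beyond_ge_width:
  assumes "xmin < y" "y < xmax"
  shows "ennreal (width y) \<le> arc_beyond y"
proof -
  have w: "0 < width y" using assms by (rule width_pos)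
  have "ennreal (dist (y, lower y) (y, upper y)) \<le> H 1 (frontier K \<inter> {z. y < fst z})"
  proof (rule dist_le_hausdorff_outer_frontier[OF compact convex])
    show "(y, lower y) \<in> K" "(y, upper y) \<in> K" using assms upper_lower_in by auto
    show "(1, 0) \<noteq> (0 :: real \<times> real)" by (simp add: zero_prod_def)
    show "(1, 0) \<bullet> ((y, upper y) - (y, lower y)) = (0 :: real)" by (simp add: inner_Pair)
    fix th \<tau> :: real assume th: "0 < th" "th < 1" and \<tau>: "0 \<le> \<tau>"
    let ?v = "lower y + th * width y" and ?z = "(y, lower y) + th *\<^sub>R ((y, upper y) - (y, lower y)) + \<tau> *\<^sub>R (1, 0)"
    have z: "?z = (y + \<tau>, ?v)"
      by (simp add: width_def)
    assume "?z \<in> frontier K"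
    then have "(y + \<tau>, ?v) \<in> frontier K" unfolding z .
    \<comment> \<open>Points strictly inside the chord are interior to \<open>K\<close>, so the
      horizontal ray exits strictly to the right of \<open>y\<close>.\<close>
    moreover have "(y, ?v) \<notin> frontier K"
    proof -
      have "0 < th * width y" "0 < (1 - th) * width y" using th w by auto
      then have "lower y < ?v" "?v < upper y" by (auto simp: width_def algebra_simps)
      then show ?thesis using frontier_slice[of y ?v] assms by auto
    qed
    ultimately have "\<tau> \<noteq> 0" by auto
    then show "?z \<in> {z. y < fst z}"
      unfolding z using \<tau> by simp
  qed
  moreover have "dist (y, lower y) (y, upper y) = width y"
    using w by (simp add: dist_Pair_Pair dist_real_def width_def)
  ultimately show ?thesis by (simp add: arc_beyond_def)
qed

text \<open>Three disjoint pieces of the boundary are counted: the arc above the upper chord, the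
  arc below the lower chord, and what lies beyond \<open>y\<close>.\<close>

lemma arc_beyond_ge_chords:
  assumes t: "xmin < t" "t < y" "y < xmax"
  shows "ennreal (sqrt ((y - t)\<^sup>2 + (upper y - upper t)\<^sup>2) + sqrt ((y - t)\<^sup>2 + (lower y - lower t)\<^sup>2) + width y)
    \<le> arc_beyond t"
proof -
  let ?U = "frontier K \<inter> {z. t < fst z \<and> fst z < y \<and> 0 \<le> 1 * ((snd z - upper t) * (y - t) - (upper y - upper t) * (fst z - t))}"
  let ?L = "frontier K \<inter> {z. t < fst z \<and> fst z < y \<and> 0 \<le> (- 1) * ((snd z - lower t) * (y - t) - (lower y - lower t) * (fst z - t))}"
  let ?R = "frontier K \<inter> {z. y < fst z}"
  have U: "ennreal (sqrt ((y - t)\<^sup>2 + (upper y - upper t)\<^sup>2)) \<le> H 1 ?U"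
    using t upper_lower_in slice_bounds by (intro arc_length_ge_chord[OF compact convex]) auto
  have L: "ennreal (sqrt ((y - t)\<^sup>2 + (lower y - lower t)\<^sup>2)) \<le> H 1 ?L"
    using t upper_lower_in slice_bounds by (intro arc_length_ge_chord[OF compact convex]) auto
  have R: "ennreal (width y) \<le> H 1 ?R"
    using arc_beyond_ge_width[of y] t by (simp add: arc_beyond_def)
  have disj: "?U \<inter> ?L = {}"
  proof (rule ccontr)
    assume "?U \<inter> ?L \<noteq> {}"
    then obtain x v where x: "t < x" "x < y"
      and u: "0 \<le> (v - upper t) * (y - t) - (upper y - upper t) * (x - t)"
      and l: "0 \<le> - ((v - lower t) * (y - t) - (lower y - lower t) * (x - t))"
      by auto
    \<comment> \<open>Adding the two side conditions of a common point would make a positive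
      combination of the widths at \<open>t\<close> and \<open>y\<close> nonpositive.\<close>
    have "0 < width t * (y - x)" "0 < width y * (x - t)"
      using x t by (auto intro!: mult_pos_pos width_pos)
    with u l show False by (simp add: width_def algebra_simps)
  qed
  have "ennreal (sqrt ((y - t)\<^sup>2 + (upper y - upper t)\<^sup>2) + sqrt ((y - t)\<^sup>2 + (lower y - lower t)\<^sup>2) + width y) =
      ennreal (sqrt ((y - t)\<^sup>2 + (upper y - upper t)\<^sup>2)) + ennreal (sqrt ((y - t)\<^sup>2 + (lower y - lower t)\<^sup>2)) + ennreal (width y)"
    using width_pos[of y] t by (simp add: ennreal_plus)
  also have "\<dots> \<le> H 1 ?U + H 1 ?L + H 1 ?R"
    by (intro add_mono U L R)
  also have "\<dots> = H 1 (?U \<union> ?L \<union> ?R)"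
    using disj by (subst hausdorff_outer_plus, measurable, force, subst hausdorff_outer_plus, measurable)
  also have "\<dots> \<le> arc_beyond t"
    unfolding arc_beyond_def using t by (intro hausdorff_outer_mono) auto
  finally show ?thesis .
qed

text \<open>The boundary over the strip lies on two graphs. The lower one is treated as the graph of
  the concave function \<open>- lower\<close> with sign -1, so that the two vertical increments add
  up to the change of width.\<close>

lemma arc_strip_le:
  assumes "xmin < s" "s \<le> t" "t < xmax"
    and U: "\<And>x x'. xmin \<le> x \<Longrightarrow> x \<le> x' \<Longrightarrow> x' \<le> t \<Longrightarrow> m * (x' - x) \<le> upper x' - upper x"
    and L: "\<And>x x'. xmin \<le> x \<Longrightarrow> x \<le> x' \<Longrightarrow> x' \<le> t \<Longrightarrow> n * (x' - x) \<le> lower x - lower x'"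
  shows "H 1 (frontier K \<inter> {z. s < fst z \<and> fst z \<le> t}) \<le>
    ennreal ((sqrt (1 + m\<^sup>2) - m + (sqrt (1 + n\<^sup>2) - n)) * (t - s) + (width t - width s))"
proof -
  have pos: "0 \<le> (sqrt (1 + m\<^sup>2) - m) * (t - s) + (upper t - upper s)"
    "0 \<le> (sqrt (1 + n\<^sup>2) - n) * (t - s) + (- lower t - - lower s)"
    using U[of s t] L[of s t] assms(1,2)
      order_trans[OF real_sqrt_ge_zero sqrt_sum_squares_le_slope[of "t - s" m "upper t - upper s"]]
      order_trans[OF real_sqrt_ge_zero sqrt_sum_squares_le_slope[of "t - s" n "- lower t - - lower s"]]
    by auto
  have "frontier K \<inter> {z. s < fst z \<and> fst z \<le> t} \<subseteq>
      (\<lambda>x. (x, 1 * upper x)) ` {s..t} \<union> (\<lambda>x. (x, (- 1) * (- lower x))) ` {s..t}"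
  proof
    fix z assume z: "z \<in> frontier K \<inter> {z. s < fst z \<and> fst z \<le> t}"
    then have "snd z = upper (fst z) \<or> snd z = lower (fst z)"
      using frontier_slice[of "fst z" "snd z"] assms by auto
    then show "z \<in> (\<lambda>x. (x, 1 * upper x)) ` {s..t} \<union> (\<lambda>x. (x, (- 1) * (- lower x))) ` {s..t}"
    proof
      assume "snd z = upper (fst z)"
      then have "z = (\<lambda>x. (x, 1 * upper x)) (fst z)" by (simp add: prod_eq_iff)
      then show ?thesis using z by (intro UnI1 rev_image_eqI[of "fst z"]) auto
    next
      assume "snd z = lower (fst z)"
      then have "z = (\<lambda>x. (x, (- 1) * (- lower x))) (fst z)" by (simp add: prod_eq_iff)
      then show ?thesis using z by (intro UnI2 rev_image_eqI[of "fst z"]) auto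
    qed
  qed
  then have "H 1 (frontier K \<inter> {z. s < fst z \<and> fst z \<le> t}) \<le>
      H 1 ((\<lambda>x. (x, 1 * upper x)) ` {s..t}) + H 1 ((\<lambda>x. (x, (- 1) * (- lower x))) ` {s..t})"
    using hausdorff_outer_Un hausdorff_outer_mono order_trans by blast
  also have "\<dots> \<le> ennreal ((sqrt (1 + m\<^sup>2) - m) * (t - s) + (upper t - upper s)) +
      ennreal ((sqrt (1 + n\<^sup>2) - n) * (t - s) + (- lower t - - lower s))"
    using assms by (intro add_mono hausdorff_outer_graph_le) auto
  also have "\<dots> = ennreal ((sqrt (1 + m\<^sup>2) - m + (sqrt (1 + n\<^sup>2) - n)) * (t - s) + (width t - width s))"
    using pos by (subst ennreal_plus[symmetric]) (auto simp: width_def algebra_simps)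
  finally show ?thesis .
qed

text \<open>The key step of the planar case: \<open>2 * width x + \<phi> * (x - t)\<close> is bounded by the arc length beyond \<open>t\<close> plus \<open>width t\<close>, which
  bounds the area beyond \<open>t\<close> by that of a trapezoid.\<close>

lemma arc_area_ratio_mono:
  assumes fin: "H 1 (frontier K) < \<infinity>"
    and st: "xmin < s" "s < t" "t < xmax" and w: "width t \<le> width s"
  shows "arc_beyond s * area_beyond t \<le> arc_beyond t * area_beyond s"
proof -
  have t: "xmin < t" "xmin \<le> t" "t \<le> xmax" using st by auto
  obtain m where m: "\<And>x. x \<in> {xmin..xmax} \<Longrightarrow> upper x \<le> upper t + m * (x - t)"
    "\<And>x x'. xmin \<le> x \<Longrightarrow> x \<le> x' \<Longrightarrow> x' \<le> t \<Longrightarrow> m * (x' - x) \<le> upper x' - upper x"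
    using concave_supergradient[OF upper_concave t(1) st(3)] by metis
  have "concave_on {xmin..xmax} (\<lambda>x. - lower x)"
    using lower_convex by (simp add: concave_on_def)
  then obtain n where n: "\<And>x. x \<in> {xmin..xmax} \<Longrightarrow> - lower x \<le> - lower t + n * (x - t)"
    "\<And>x x'. xmin \<le> x \<Longrightarrow> x \<le> x' \<Longrightarrow> x' \<le> t \<Longrightarrow> n * (x' - x) \<le> - lower x' - - lower x"
    using concave_supergradient[OF _ t(1) st(3)] by metis
  \<comment> \<open>The rate at which arc length exceeds the change of width. Since \<open>m\<close>
    and \<open>n\<close> belong to supporting lines at the cut \<open>t\<close>, it is an upper
    bound in the strip before \<open>t\<close> and a lower bound for the chords beyond
    \<open>t\<close>.\<close>
  define \<phi> where "\<phi> = (sqrt (1 + m\<^sup>2) - m) + (sqrt (1 + n\<^sup>2) - n)"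
  have "x < sqrt (1 + x\<^sup>2)" for x :: real by (rule real_less_rsqrt) simp
  then have \<phi>: "0 < \<phi>" by (auto simp: \<phi>_def intro!: add_pos_pos)
  define w0 where "w0 = width t"
  have w0: "0 < w0" using st t by (auto simp: w0_def intro!: width_pos)
  have "arc_beyond t \<le> H 1 (frontier K)"
    unfolding arc_beyond_def by (intro hausdorff_outer_mono) auto
  with fin have "arc_beyond t < \<infinity>" by (rule order.strict_trans1[rotated])
  then obtain \<Lambda> where \<Lambda>: "arc_beyond t = ennreal \<Lambda>" "0 \<le> \<Lambda>"
    by (cases "arc_beyond t") auto
  have \<Lambda>w: "w0 \<le> \<Lambda>"
    using arc_beyond_ge_width[OF t(1) st(3)] \<Lambda> by (simp add: w0_def)
  have key: "2 * width x + \<phi> * (x - t) \<le> \<Lambda> + w0" if x: "t < x" "x < xmax" for x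
  proof -
    have "ennreal (sqrt ((x - t)\<^sup>2 + (upper x - upper t)\<^sup>2) + sqrt ((x - t)\<^sup>2 + (lower x - lower t)\<^sup>2) + width x) \<le> ennreal \<Lambda>"
      using arc_beyond_ge_chords[OF t(1) x] \<Lambda> by simp
    then have "sqrt ((x - t)\<^sup>2 + (upper x - upper t)\<^sup>2) + sqrt ((x - t)\<^sup>2 + (lower x - lower t)\<^sup>2) + width x \<le> \<Lambda>"
      using \<Lambda>(2) by (simp add: ennreal_le_iff)
    moreover have "(sqrt (1 + m\<^sup>2) - m) * (x - t) + (upper x - upper t) \<le> sqrt ((x - t)\<^sup>2 + (upper x - upper t)\<^sup>2)"
      using m(1)[of x] x st by (intro sqrt_sum_squares_ge_slope) auto
    moreover have "(sqrt (1 + n\<^sup>2) - n) * (x - t) + (lower t - lower x) \<le> sqrt ((x - t)\<^sup>2 + (lower t - lower x)\<^sup>2)"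
      using n(1)[of x] x st by (intro sqrt_sum_squares_ge_slope) auto
    ultimately have "((sqrt (1 + m\<^sup>2) - m) * (x - t) + (upper x - upper t)) +
        ((sqrt (1 + n\<^sup>2) - n) * (x - t) + (lower t - lower x)) + width x \<le> \<Lambda>"
      by (simp add: power2_commute)
    then show ?thesis
      by (simp add: \<phi>_def w0_def width_def algebra_simps)
  qed
  \<comment> \<open>The abscissa at which the linear bound
    \<open>(\<Lambda> + w0 - \<phi> * (x - t)) / 2\<close> for the width has fallen to
    \<open>w0\<close>. The dominating trapezoid is level at \<open>w0\<close> up to \<open>c\<close>
    and then descends to 0.\<close>
  define c where "c = t + (\<Lambda> - w0) / \<phi>"
  have c: "t \<le> c" "\<phi> * (c - t) = \<Lambda> - w0" using \<phi> \<Lambda>w by (auto simp: c_def)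
  have area_le: "area_beyond t * ennreal \<phi> \<le> ennreal w0 * arc_beyond t"
  proof -
    have "area_beyond t = (\<integral>\<^sup>+x. ennreal (width x) * indicator ({t<..} \<inter> {xmin..xmax}) x \<partial>lborel)"
      unfolding area_beyond_def using emeasure_strip[of "{t<..}"] by simp
    also have "\<dots> \<le> (\<integral>\<^sup>+x. ennreal w0 * indicator {t..c} x +
        ennreal (w0 - \<phi> * (x - c) / 2) * indicator {c..c + 2 * w0 / \<phi>} x \<partial>lborel)"
    proof (rule nn_integral_mono_AE, rule AE_mp[OF AE_lborel_singleton[of xmax]], rule AE_I2, rule impI)
      fix x assume "x \<noteq> xmax"
      show "ennreal (width x) * indicator ({t<..} \<inter> {xmin..xmax}) x \<le> ennreal w0 * indicator {t..c} x +
        ennreal (w0 - \<phi> * (x - c) / 2) * indicator {c..c + 2 * w0 / \<phi>} x"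
      proof (cases "x \<in> {t<..} \<inter> {xmin..xmax}")
        case True
        then have x: "t < x" "x < xmax" using \<open>x \<noteq> xmax\<close> by auto
        show ?thesis
        proof (cases "x \<le> c")
          case True
          have "width x \<le> w0"
            unfolding w0_def using concave_on_below_after[OF width_concave _ _ st(2) x(1) w] st x by auto
          then have "ennreal (width x) \<le> ennreal w0" by (rule ennreal_leI)
          also have "\<dots> \<le> ennreal w0 + ennreal (w0 - \<phi> * (x - c) / 2) * indicator {c..c + 2 * w0 / \<phi>} x"
            by simp
          finally show ?thesis
            using True x \<open>x \<in> {t<..} \<inter> {xmin..xmax}\<close> by simp
        next
          case False
          have "2 * width x + \<phi> * (x - c) \<le> 2 * w0"
            using key[OF x] c(2) by (simp add: algebra_simps)
          moreover have "0 < width x" using x t by (intro width_pos) auto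
          ultimately have le: "width x \<le> w0 - \<phi> * (x - c) / 2" and "\<phi> * (x - c) \<le> 2 * w0" by auto
          then have "x \<le> c + 2 * w0 / \<phi>" using \<phi> by (simp add: field_simps)
          then show ?thesis
            using False x \<open>x \<in> {t<..} \<inter> {xmin..xmax}\<close> ennreal_leI[OF le] by simp
        qed
      qed simp
    qed
    also have "\<dots> = (\<integral>\<^sup>+x. ennreal w0 * indicator {t..c} x \<partial>lborel) +
        (\<integral>\<^sup>+x. ennreal (w0 - \<phi> * (x - c) / 2) * indicator {c..c + 2 * w0 / \<phi>} x \<partial>lborel)"
      by (rule nn_integral_add) auto
    also have "\<dots> = ennreal (w0 * (c - t)) + ennreal (w0\<^sup>2 / \<phi>)"
      using \<phi> w0 c(1) by (simp add: nn_integral_decreasing_ramp nn_integral_cmult ennreal_mult)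
    also have "\<dots> = ennreal (w0 * (c - t) + w0\<^sup>2 / \<phi>)"
      using \<phi> w0 c(1) by (subst ennreal_plus) auto
    finally have "area_beyond t * ennreal \<phi> \<le> ennreal (w0 * (c - t) + w0\<^sup>2 / \<phi>) * ennreal \<phi>"
      by (rule mult_right_mono) simp
    also have "\<dots> = ennreal ((w0 * (c - t) + w0\<^sup>2 / \<phi>) * \<phi>)"
      using \<phi> w0 c(1) by (subst ennreal_mult) auto
    \<comment> \<open>The rectangle contributes \<open>w0 * (\<Lambda> - w0)\<close> and the
      triangle the square of \<open>w0\<close>, so \<open>\<phi>\<close> times the area of the
      trapezoid is exactly \<open>w0 * \<Lambda>\<close>.\<close>
    also have "(w0 * (c - t) + w0\<^sup>2 / \<phi>) * \<phi> = w0 * (\<phi> * (c - t)) + w0\<^sup>2"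
      using \<phi> by (simp add: field_simps)
    also have "\<dots> = w0 * \<Lambda>"
      unfolding c(2) by (simp add: algebra_simps power2_eq_square)
    also have "ennreal (w0 * \<Lambda>) = ennreal w0 * arc_beyond t"
      using w0 \<Lambda> by (simp add: ennreal_mult)
    finally show ?thesis .
  qed
  define len where "len = H 1 (frontier K \<inter> {z. s < fst z \<and> fst z \<le> t})"
  define \<alpha> where "\<alpha> = vol (K \<inter> {z. fst z \<in> {s<..t}})"
  have "len \<le> ennreal (\<phi> * (t - s) + (width t - width s))"
    unfolding len_def \<phi>_def using st m(2) n(2) by (intro arc_strip_le) auto
  also have "\<dots> \<le> ennreal (\<phi> * (t - s))" using w by (intro ennreal_leI) simp
  finally have len: "len \<le> ennreal (\<phi> * (t - s))" .
  have \<alpha>: "ennreal (w0 * (t - s)) \<le> \<alpha>"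
  proof -
    have "ennreal (w0 * (t - s)) = (\<integral>\<^sup>+x. ennreal w0 * indicator {s<..t} x \<partial>lborel)"
      using w0 st by (simp add: nn_integral_cmult ennreal_mult)
    also have "\<dots> \<le> (\<integral>\<^sup>+x. ennreal (width x) * indicator ({s<..t} \<inter> {xmin..xmax}) x \<partial>lborel)"
    proof (intro nn_integral_mono)
      fix x
      show "ennreal w0 * indicator {s<..t} x \<le> ennreal (width x) * indicator ({s<..t} \<inter> {xmin..xmax}) x"
        using concave_on_above_between[OF width_concave, of s t x] st w
        by (auto simp: indicator_def w0_def intro!: ennreal_leI)
    qed
    also have "\<dots> = \<alpha>" unfolding \<alpha>_def by (rule emeasure_strip[symmetric]) simp
    finally show ?thesis .
  qed
  have arc: "arc_beyond s = arc_beyond t + len"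
  proof -
    have "frontier K \<inter> {z. s < fst z} = (frontier K \<inter> {z. t < fst z}) \<union> (frontier K \<inter> {z. s < fst z \<and> fst z \<le> t})"
      using st by auto
    then show ?thesis
      unfolding arc_beyond_def len_def by (simp only:) (rule hausdorff_outer_plus; auto)
  qed
  have area: "area_beyond s = area_beyond t + \<alpha>"
  proof -
    have "K \<inter> {z. s < fst z} = (K \<inter> {z. t < fst z}) \<union> (K \<inter> {z. fst z \<in> {s<..t}})"
      using st by auto
    then show ?thesis
      unfolding area_beyond_def \<alpha>_def by (simp only:) (rule plus_emeasure[symmetric]; auto)
  qed
  \<comment> \<open>The strip has a ratio of arc to area of at most \<open>\<phi> / w0\<close>, the
    cap beyond \<open>t\<close> one of at least \<open>\<phi> / w0\<close>. Joining the strip to the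
    cap thus cannot raise the ratio.\<close>
  have "len * area_beyond t \<le> ennreal (\<phi> * (t - s)) * area_beyond t"
    using len by (rule mult_right_mono) simp
  also have "\<dots> = ennreal (t - s) * (area_beyond t * ennreal \<phi>)"
    using \<phi> st by (simp add: ennreal_mult mult_ac)
  also have "\<dots> \<le> ennreal (t - s) * (ennreal w0 * arc_beyond t)"
    using area_le by (rule mult_left_mono) simp
  also have "\<dots> = ennreal (w0 * (t - s)) * arc_beyond t"
    using w0 st by (simp add: ennreal_mult mult_ac)
  also have "\<dots> \<le> \<alpha> * arc_beyond t"
    using \<alpha> by (rule mult_right_mono) simp
  finally have "len * area_beyond t \<le> arc_beyond t * \<alpha>" by (simp add: mult.commute)
  then show ?thesis
    unfolding arc area by (simp add: distrib_left distrib_right add_left_mono)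
qed

end

section \<open>Transport by linear isometries and the crossing of the cap functions\<close>

locale linear_isometry =
  fixes f :: "'a::euclidean_space \<Rightarrow> 'b::euclidean_space" and f' :: "'b \<Rightarrow> 'a"
  assumes linear_f: "linear f" and linear_f': "linear f'"
    and inv_left: "f' (f x) = x" and inv_right: "f (f' y) = y" and norm_f: "norm (f x) = norm x"
begin

lemma dist_f: "dist (f x) (f y) = dist x y"
  using norm_f[of "x - y"] by (simp add: dist_norm linear_diff[OF linear_f])

lemma image_vimage: "f ` (f -` S) = S"
  using inv_right by (auto simp: image_iff) metis

text \<open>The description of the frontier by distances alone makes this a consequence of
  bijectivity and distance preservation.\<close>

lemma frontier_vimage: "frontier (f -` S) = f -` frontier S"
proof -
  have "(\<exists>y. f y \<in> T \<and> dist x y < e) \<longleftrightarrow> (\<exists>y. y \<in> T \<and> dist (f x) y < e)" for T :: "'b set" and x e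
    using dist_f inv_right by metis
  from this[of S] this[of "- S"] show ?thesis
    by (simp add: frontier_straddle set_eq_iff Bex_def)
qed

lemma hausdorff_outer_vimage: "H k (f -` S) = H k S"
  using hausdorff_outer_isometric_image[of "f -` S" f k] unfolding image_vimage by (simp add: dist_f)

lemma emeasure_lborel_vimage:
  assumes "DIM('a) = DIM('b)" "S \<in> sets borel"
  shows "vol (f -` S) = vol S"
  by (rule emeasure_lborel_isometry_vimage[OF linear_f linear_f' inv_left inv_right norm_f assms])

lemma convex_body_vimage:
  assumes "convex_body S"
  shows "convex_body (f -` S)"
proof -
  have bl: "bounded_linear f" "bounded_linear f'"
    using linear_f linear_f' by (simp_all add: linear_conv_bounded_linear)
  have eq: "f -` S = f' ` S"
    using inv_left inv_right by (auto simp: image_iff) metis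
  have "compact (f' ` S)"
    using assms bl by (intro compact_continuous_image) (auto simp: convex_body_def linear_continuous_on)
  moreover have "convex (f -` S)"
    using assms linear_f by (intro convex_linear_vimage) (auto simp: convex_body_def)
  moreover have "interior (f -` S) \<noteq> {}"
  proof -
    have "open (f -` interior S)"
      using bl by (intro continuous_open_vimage) (auto simp: linear_continuous_at)
    moreover have "f -` interior S \<subseteq> f -` S" using interior_subset by auto
    ultimately have "f -` interior S \<subseteq> interior (f -` S)" by (rule interior_maximal[rotated])
    moreover obtain y where "y \<in> interior S" using assms by (auto simp: convex_body_def)
    then have "f' y \<in> f -` interior S" using inv_right by simp
    ultimately show ?thesis by auto
  qed
  ultimately show ?thesis by (simp add: convex_body_def eq)
qed

end

lemma planar_body_iff_convex_body: "planar_body K \<longleftrightarrow> convex_body K"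
  by (simp add: planar_body_def convex_body_def)

definition flip_fst :: "real \<times> real \<Rightarrow> real \<times> real" where
  "flip_fst z = (- fst z, snd z)"

lemma linear_isometry_flip_fst: "linear_isometry flip_fst flip_fst"
  by standard (auto simp: flip_fst_def norm_prod_def algebra_simps intro!: linearI)

context planar_body
begin

definition area_before :: "real \<Rightarrow> ennreal" where
  "area_before t = vol (K \<inter> {z. fst z < t})"

definition arc_before :: "real \<Rightarrow> ennreal" where
  "arc_before t = H 1 (frontier K \<inter> {z. fst z < t})"

text \<open>The mirror image of \<open>arc_area_ratio_mono\<close>: flipping the first coordinate
  exchanges the two kinds of caps and turns \<open>s < t\<close> into
  \<open>- t < - s\<close>.\<close>

lemma arc_area_ratio_mono_before:
  assumes fin: "H 1 (frontier K) < \<infinity>"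
    and st: "xmin < s" "s < t" "t < xmax" and w: "width s \<le> width t"
  shows "arc_before t * area_before s \<le> arc_before s * area_before t"
proof -
  interpret flip: linear_isometry flip_fst flip_fst by (rule linear_isometry_flip_fst)
  let ?K = "flip_fst -` K"
  interpret K': planar_body ?K
    using planar_body_axioms flip.convex_body_vimage by (simp add: planar_body_iff_convex_body)
  have slice: "{y. (x, y) \<in> ?K} = {y. (- x, y) \<in> K}" for x by (simp add: flip_fst_def)
  then have width: "K'.width x = width (- x)" for x
    by (simp add: K'.width_def K'.upper_def K'.lower_def width_def upper_def lower_def)
  have "fst ` ?K = uminus ` fst ` K"
  proof -
    have "?K = flip_fst ` K"
      using flip.inv_left by (auto simp: image_iff) metis
    then show ?thesis by (simp add: image_image flip_fst_def)
  qed
  then have "{K'.xmin..K'.xmax} = {- xmax..- xmin}"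
    unfolding K'.fst_K fst_K by simp
  then have ends: "K'.xmin = - xmax" "K'.xmax = - xmin"
    using st by (auto simp: Icc_eq_Icc)
  have area: "K'.area_beyond x = area_before (- x)" for x
  proof -
    have "?K \<inter> {z. x < fst z} = flip_fst -` (K \<inter> {z. fst z < - x})"
      by (auto simp: flip_fst_def)
    then have "K'.area_beyond x = vol (flip_fst -` (K \<inter> {z. fst z < - x}))"
      by (simp only: K'.area_beyond_def)
    also have "\<dots> = area_before (- x)"
      unfolding area_before_def by (rule flip.emeasure_lborel_vimage) auto
    finally show ?thesis .
  qed
  have arc: "K'.arc_beyond x = arc_before (- x)" for x
  proof -
    have "frontier ?K \<inter> {z. x < fst z} = flip_fst -` (frontier K \<inter> {z. fst z < - x})"
      unfolding flip.frontier_vimage by (auto simp: flip_fst_def)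
    then show ?thesis
      unfolding K'.arc_beyond_def arc_before_def by (simp only: flip.hausdorff_outer_vimage)
  qed
  have "K'.arc_beyond (- t) * K'.area_beyond (- s) \<le> K'.arc_beyond (- s) * K'.area_beyond (- t)"
    using fin st w
    by (intro K'.arc_area_ratio_mono) (auto simp: ends width flip.frontier_vimage flip.hausdorff_outer_vimage)
  then show ?thesis by (simp add: area arc)
qed

lemma area_pos:
  assumes "xmin < t" "t < xmax"
  shows "0 < area_beyond t" "0 < area_before t"
proof -
  have pos: "0 < vol (K \<inter> {z. fst z \<in> S})" if S: "open S" "x \<in> S" "xmin < x" "x < xmax" for S x
  proof -
    have "0 < width x" using S by (intro width_pos)
    then have "(x, (lower x + upper x) / 2) \<in> interior K"
      using S by (intro interior_slice) (auto simp: width_def)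
    then have "(x, (lower x + upper x) / 2) \<in> interior K \<inter> S \<times> UNIV"
      using S by simp
    moreover have "open (interior K \<inter> S \<times> UNIV)"
      using S by (intro open_Int open_Times) auto
    ultimately obtain e where e: "0 < e" "ball (x, (lower x + upper x) / 2) e \<subseteq> interior K \<inter> S \<times> UNIV"
      by (metis openE)
    have "0 < vol (ball (x, (lower x + upper x) / 2) e)"
      using e by (intro emeasure_lborel_ball_pos)
    also have "\<dots> \<le> vol (K \<inter> {z. fst z \<in> S})"
    proof (rule emeasure_mono)
      show "ball (x, (lower x + upper x) / 2) e \<subseteq> K \<inter> {z. fst z \<in> S}"
        using e interior_subset by fastforce
      have "S \<in> sets borel" using S by simp
      then show "K \<inter> {z. fst z \<in> S} \<in> sets lborel" by measurable
    qed
    finally show ?thesis .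
  qed
  show "0 < area_beyond t" "0 < area_before t"
    using pos[of "{t<..}" "(t + xmax) / 2"] pos[of "{..<t}" "(t + xmin) / 2"] assms
    by (auto simp: area_beyond_def area_before_def)
qed

lemma halves_split:
  fixes M :: "(real \<times> real) measure"
  assumes [measurable_cong]: "sets M = sets borel" and A [measurable]: "A \<in> sets borel"
  shows "emeasure M (A \<inter> {z. t < fst z}) + emeasure M (A \<inter> {z. fst z < t}) + emeasure M (A \<inter> {z. fst z = t}) = emeasure M A"
proof -
  let ?B = "A \<inter> {z. t < fst z}" and ?C = "A \<inter> {z. fst z < t}" and ?D = "A \<inter> {z. fst z = t}"
  have "emeasure M ?B + emeasure M ?C = emeasure M (?B \<union> ?C)"
    by (rule plus_emeasure) auto
  moreover have "emeasure M (?B \<union> ?C) + emeasure M ?D = emeasure M (?B \<union> ?C \<union> ?D)"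
    by (rule plus_emeasure) auto
  moreover have "?B \<union> ?C \<union> ?D = A" by auto
  ultimately show ?thesis by simp
qed

lemma area_split: "area_beyond t + area_before t = vol K"
proof -
  have "vol (K \<inter> {z. fst z \<in> {t}}) = (\<integral>\<^sup>+x. ennreal (width x) * indicator ({t} \<inter> {xmin..xmax}) x \<partial>lborel)"
    by (rule emeasure_strip) simp
  also have "\<dots> = (\<integral>\<^sup>+x. 0 \<partial>(lborel :: real measure))"
  proof (rule nn_integral_cong_AE)
    show "AE x in lborel. ennreal (width x) * indicator ({t} \<inter> {xmin..xmax}) x = 0"
      using AE_lborel_singleton[of t] by eventually_elim simp
  qed
  finally have "vol (K \<inter> {z. fst z = t}) = 0" by simp
  then show ?thesis
    using halves_split[of lborel K t] by (simp add: area_beyond_def area_before_def)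
qed

text \<open>Strictly between the extremes a vertical line meets the boundary in at most two points,
  a null set. At \<open>xmin\<close> or \<open>xmax\<close> the boundary may contain a vertical edge
  of positive length.\<close>

lemma arc_split:
  assumes "xmin < t" "t < xmax"
  shows "arc_beyond t + arc_before t = H 1 (frontier K)"
proof -
  have "frontier K \<inter> {z. fst z = t} \<subseteq> {(t, upper t), (t, lower t)}"
  proof
    fix z assume "z \<in> frontier K \<inter> {z. fst z = t}"
    then show "z \<in> {(t, upper t), (t, lower t)}"
      using frontier_slice[of t "snd z"] assms by (cases z) auto
  qed
  then have null: "H 1 (frontier K \<inter> {z. fst z = t}) = 0"
    by (intro hausdorff_outer_finite) (auto intro: finite_subset)
  then show ?thesis
    using halves_split[of "hausdorff_measure 1" "frontier K" t]
    by (simp add: emeasure_hausdorff_measure arc_beyond_def arc_before_def)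
qed

text \<open>Once the share of arc length of a right cap has caught up with its share of area, it
  stays ahead for all smaller right caps; the crossing point is the infimum of these cuts. To the
  left of it the inequality is expressed by the complementary caps.\<close>

lemma arc_area_single_crossing:
  assumes fin: "H 1 (frontier K) < \<infinity>"
  obtains s where
    "\<And>t. s < t \<Longrightarrow> area_beyond t * H 1 (frontier K) \<le> arc_beyond t * vol K"
    "\<And>t. t < s \<Longrightarrow> area_before t * H 1 (frontier K) \<le> arc_before t * vol K"
proof -
  \<comment> \<open>All quantities are finite, and real values permit the subtraction involved in
    passing to complementary caps.\<close>
  define L where "L = enn2real (H 1 (frontier K))"
  define V where "V = enn2real (vol K)"
  define lr where "lr t = enn2real (arc_beyond t)" for t
  define ll where "ll t = enn2real (arc_before t)" for t
  define ar where "ar t = enn2real (area_beyond t)" for t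
  define al where "al t = enn2real (area_before t)" for t
  have V_fin: "vol K < top"
    using emeasure_bounded_finite[OF compact_imp_bounded[OF compact]] by simp
  have le_L: "arc_beyond t \<le> H 1 (frontier K)" "arc_before t \<le> H 1 (frontier K)" for t
    unfolding arc_beyond_def arc_before_def by (auto intro!: hausdorff_outer_mono)
  have le_V: "area_beyond t \<le> vol K" "area_before t \<le> vol K" for t
    unfolding area_beyond_def area_before_def by (auto intro!: emeasure_mono)
  have eq: "H 1 (frontier K) = ennreal L" "vol K = ennreal V"
    "arc_beyond t = ennreal (lr t)" "arc_before t = ennreal (ll t)"
    "area_beyond t = ennreal (ar t)" "area_before t = ennreal (al t)" for t
    unfolding L_def V_def lr_def ll_def ar_def al_def
    using fin V_fin le_L[of t] le_V[of t] by (auto simp: ennreal_enn2real_if top_unique)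
  have nonneg: "0 \<le> L" "0 \<le> V" "0 \<le> lr t" "0 \<le> ll t" "0 \<le> ar t" "0 \<le> al t" for t
    by (simp_all add: L_def V_def lr_def ll_def ar_def al_def)
  have split: "ar t + al t = V" for t
    using area_split[of t] nonneg unfolding eq by (simp flip: ennreal_plus)
  have split': "lr t + ll t = L" if "xmin < t" "t < xmax" for t
    using arc_split[OF that] nonneg unfolding eq by (simp flip: ennreal_plus)
  have pos: "0 < ar t" "0 < al t" if "xmin < t" "t < xmax" for t
    using area_pos[OF that] nonneg by (simp_all add: eq)
  define S where "S = {t. xmin < t \<and> t < xmax \<and> L * ar t \<le> V * lr t}"
  have up: "t \<in> S" if s: "s \<in> S" and t: "s < t" "t < xmax" for s t
  proof (cases "width t \<le> width s")
    case True
    have "arc_beyond s * area_beyond t \<le> arc_beyond t * area_beyond s"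
      using s t True by (intro arc_area_ratio_mono[OF fin]) (auto simp: S_def)
    then have "lr s * ar t \<le> lr t * ar s"
      using nonneg by (simp add: eq flip: ennreal_mult)
    then have "V * (lr s * ar t) \<le> V * (lr t * ar s)"
      using nonneg by (intro mult_left_mono)
    moreover have "L * ar s * ar t \<le> V * lr s * ar t"
      using s nonneg by (intro mult_right_mono) (auto simp: S_def)
    ultimately have "ar s * (L * ar t) \<le> ar s * (V * lr t)" by (simp add: mult_ac)
    then show ?thesis using pos(1)[of s] s t by (simp add: S_def)
  next
    \<comment> \<open>When the width grows from \<open>s\<close> to \<open>t\<close>, the left caps
      are compared, and membership in \<open>S\<close> is translated to left caps and back by
      complements.\<close>
    case False
    have "arc_before t * area_before s \<le> arc_before s * area_before t"
      using s t False by (intro arc_area_ratio_mono_before[OF fin]) (auto simp: S_def)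
    then have "ll t * al s \<le> ll s * al t"
      using nonneg by (simp add: eq flip: ennreal_mult)
    then have "V * (ll t * al s) \<le> V * (ll s * al t)"
      using nonneg by (intro mult_left_mono)
    moreover have "V * ll s \<le> L * al s"
    proof -
      have "ar s = V - al s" "lr s = L - ll s" using split[of s] split'[of s] s by (auto simp: S_def)
      moreover have "L * ar s \<le> V * lr s" using s by (simp add: S_def)
      ultimately have "L * (V - al s) \<le> V * (L - ll s)" by metis
      then show ?thesis by (simp add: algebra_simps)
    qed
    then have "V * ll s * al t \<le> L * al s * al t" using nonneg by (intro mult_right_mono)
    ultimately have "al s * (V * ll t) \<le> al s * (L * al t)" by (simp add: mult_ac)
    then have "V * ll t \<le> L * al t" using pos(2)[of s] s by (simp add: S_def)
    moreover have "al t = V - ar t" "ll t = L - lr t" using split[of t] split'[of t] s t by (auto simp: S_def)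
    ultimately show ?thesis using s t by (simp add: S_def algebra_simps)
  qed
  \<comment> \<open>If no cut belongs to \<open>S\<close>, the crossing is placed at the right end,
    beyond which caps are empty.\<close>
  define s0 where "s0 = (if S = {} then xmax else Inf S)"
  have bdd: "bdd_below S" by (rule bdd_belowI[of _ xmin]) (auto simp: S_def)
  have s0: "xmin \<le> s0" "s0 \<le> xmax"
  proof -
    have "xmin \<le> xmax" using interior interior_subset fst_K by fastforce
    moreover have "xmin \<le> Inf S" if "S \<noteq> {}" using that by (intro cInf_greatest) (auto simp: S_def)
    moreover have "Inf S \<le> xmax" if x: "x \<in> S" for x
      using cInf_lower[OF x bdd] x by (auto simp: S_def)
    ultimately show "xmin \<le> s0" "s0 \<le> xmax" by (auto simp: s0_def)
  qed
  show ?thesis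
  proof (rule that[of s0])
    fix t assume t: "s0 < t"
    have "ar t * L \<le> lr t * V"
    proof (cases "t < xmax")
      case True
      then have "S \<noteq> {}" using t by (auto simp: s0_def)
      then obtain s where "s \<in> S" "s < t"
        using t cInf_lessD[of S t] by (auto simp: s0_def)
      then show ?thesis using up[of s t] True by (auto simp: S_def mult.commute)
    next
      case False
      then have "K \<inter> {z. t < fst z} = {}" by (auto dest: K_range)
      then have "ar t = 0" by (simp add: ar_def area_beyond_def)
      then show ?thesis using nonneg by simp
    qed
    then show "area_beyond t * H 1 (frontier K) \<le> arc_beyond t * vol K"
      unfolding eq using nonneg by (simp flip: ennreal_mult)
  next
    fix t assume t: "t < s0"
    have "al t * L \<le> ll t * V"
    proof (cases "xmin < t")
      case True
      then have x: "xmin < t" "t < xmax" using t s0 by auto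
      have "t \<notin> S" using t cInf_lower[OF _ bdd, of t] by (auto simp: s0_def split: if_splits)
      then have "V * lr t < L * ar t" using x by (simp add: S_def)
      moreover have "ar t = V - al t" "lr t = L - ll t" using split[of t] split'[OF x] by auto
      ultimately show ?thesis by (simp add: algebra_simps)
    next
      case False
      then have "K \<inter> {z. fst z < t} = {}" by (auto dest: K_range)
      then have "al t = 0" by (simp add: al_def area_before_def)
      then show ?thesis using nonneg by simp
    qed
    then show "area_before t * H 1 (frontier K) \<le> arc_before t * vol K"
      unfolding eq using nonneg by (simp flip: ennreal_mult)
  qed
qed

end

section \<open>Convex order on the line\<close>

lemma nn_integral_layer_cake:
  assumes "sigma_finite_measure \<mu>" and f [measurable]: "f \<in> borel_measurable \<mu>" and nonneg: "\<And>x. 0 \<le> f x"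
  shows "(\<integral>\<^sup>+x. ennreal (f x) \<partial>\<mu>) = (\<integral>\<^sup>+r. indicator {0..} r * emeasure \<mu> {x \<in> space \<mu>. r < f x} \<partial>lborel)"
proof -
  interpret \<mu>: sigma_finite_measure \<mu> by fact
  interpret P: pair_sigma_finite \<mu> "lborel :: real measure" ..
  have "(\<integral>\<^sup>+x. ennreal (f x) \<partial>\<mu>) = (\<integral>\<^sup>+x. \<integral>\<^sup>+r. indicator {0..} r * (if r < f x then 1 else 0) \<partial>lborel \<partial>\<mu>)"
  proof (intro nn_integral_cong)
    fix x
    have "(\<integral>\<^sup>+r. indicator {0..} r * (if r < f x then 1 else 0) \<partial>lborel) = (\<integral>\<^sup>+r. indicator {0..<f x} r \<partial>lborel)"
      by (intro nn_integral_cong) (auto simp: indicator_def)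
    then show "ennreal (f x) = (\<integral>\<^sup>+r. indicator {0..} r * (if r < f x then 1 else 0) \<partial>lborel)"
      using nonneg[of x] by simp
  qed
  also have "\<dots> = (\<integral>\<^sup>+r. \<integral>\<^sup>+x. indicator {0..} r * (if r < f x then 1 else 0) \<partial>\<mu> \<partial>lborel)"
    by (rule P.Fubini'[symmetric]) measurable
  also have "\<dots> = (\<integral>\<^sup>+r. indicator {0..} r * emeasure \<mu> {x \<in> space \<mu>. r < f x} \<partial>lborel)"
  proof (intro nn_integral_cong)
    fix r :: real
    have "(\<integral>\<^sup>+x. indicator {0..} r * (if r < f x then 1 else 0) \<partial>\<mu>) =
        indicator {0..} r * (\<integral>\<^sup>+x. indicator {x \<in> space \<mu>. r < f x} x \<partial>\<mu>)"
      by (subst nn_integral_cmult[symmetric]) (auto intro!: nn_integral_cong simp: indicator_def)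
    then show "(\<integral>\<^sup>+x. indicator {0..} r * (if r < f x then 1 else 0) \<partial>\<mu>) =
        indicator {0..} r * emeasure \<mu> {x \<in> space \<mu>. r < f x}"
      by simp
  qed
  finally show ?thesis .
qed

text \<open>The layer-cake formula reduces the claim to level sets of \<open>\<psi>\<close> cut off
  at \<open>s\<close>. By monotonicity and continuity each of them is empty or an open half-line
  starting at some \<open>c\<close> with \<open>s \<le> c\<close>, to which the tail comparison
  applies.\<close>

lemma nn_integral_le_of_tail_le:
  fixes \<mu> \<nu> :: "real measure"
  assumes "prob_space \<mu>" "prob_space \<nu>" and sets [simp, measurable_cong]: "sets \<mu> = sets borel" "sets \<nu> = sets borel"
    and tail: "\<And>t. s < t \<Longrightarrow> emeasure \<mu> {t<..} \<le> emeasure \<nu> {t<..}"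
    and cont: "continuous_on UNIV \<psi>" and mono: "\<And>x y. s < x \<Longrightarrow> x \<le> y \<Longrightarrow> \<psi> x \<le> \<psi> y"
    and nonneg: "\<And>x. (0::real) \<le> \<psi> x"
  shows "(\<integral>\<^sup>+x. ennreal (\<psi> x) * indicator {s<..} x \<partial>\<mu>) \<le> (\<integral>\<^sup>+x. ennreal (\<psi> x) * indicator {s<..} x \<partial>\<nu>)"
proof -
  interpret \<mu>: prob_space \<mu> by fact
  interpret \<nu>: prob_space \<nu> by fact
  have [simp]: "space \<mu> = UNIV" "space \<nu> = UNIV"
    using sets_eq_imp_space_eq[OF sets(1)] sets_eq_imp_space_eq[OF sets(2)] by auto
  have [measurable]: "\<psi> \<in> borel_measurable borel"
    using cont by (rule borel_measurable_continuous_onI)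
  \<comment> \<open>A level set may start at \<open>s\<close> itself. There the comparison follows
    from continuity from below along the half-lines that start at
    \<open>s + 1 / real (Suc n)\<close>.\<close>
  have tail_s: "emeasure \<mu> {s<..} \<le> emeasure \<nu> {s<..}"
  proof -
    have sup: "emeasure M {s<..} = (SUP n. emeasure M {s + 1 / real (Suc n)<..})"
      if "sets M = sets borel" for M :: "real measure"
    proof -
      have "(\<Union>n. {s + 1 / real (Suc n)<..}) = {s<..}"
      proof (intro equalityI subsetI)
        fix x assume "x \<in> {s<..}"
        then obtain n where "inverse (real (Suc n)) < x - s" using reals_Archimedean[of "x - s"] by auto
        then show "x \<in> (\<Union>n. {s + 1 / real (Suc n)<..})" by (auto simp: field_simps intro!: exI[of _ n])
      next
        fix x assume "x \<in> (\<Union>n. {s + 1 / real (Suc n)<..})"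
        then obtain n where "s + 1 / real (Suc n) < x" by blast
        moreover have "0 < 1 / real (Suc n)" by simp
        ultimately have "s < x" by linarith
        then show "x \<in> {s<..}" by simp
      qed
      moreover have "(SUP n. emeasure M {s + 1 / real (Suc n)<..}) = emeasure M (\<Union>n. {s + 1 / real (Suc n)<..})"
      proof (rule SUP_emeasure_incseq)
        show "incseq (\<lambda>n. {s + 1 / real (Suc n)<..})"
        proof (rule incseq_SucI)
          fix n
          have "1 / real (Suc (Suc n)) \<le> 1 / real (Suc n)" by (intro frac_le) auto
          then show "{s + 1 / real (Suc n)<..} \<le> {s + 1 / real (Suc (Suc n))<..}"
            by (simp only: greaterThan_subset_iff add_left_mono)
        qed
        show "range (\<lambda>n. {s + 1 / real (Suc n)<..}) \<subseteq> sets M"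
          unfolding that by (intro image_subsetI borel_open open_greaterThan)
      qed
      ultimately show ?thesis by simp
    qed
    show ?thesis
      unfolding sup[OF sets(1)] sup[OF sets(2)] by (intro SUP_mono') (auto intro!: tail)
  qed
  have level: "emeasure \<mu> {x. r < \<psi> x * indicator {s<..} x} \<le> emeasure \<nu> {x. r < \<psi> x * indicator {s<..} x}"
    if "0 \<le> r" for r
  proof -
    define U where "U = {x. s < x \<and> r < \<psi> x}"
    have U: "{x. r < \<psi> x * indicator {s<..} x} = U"
      using that by (auto simp: U_def indicator_def)
    have "open U"
      unfolding U_def using cont by (intro open_Collect_conj open_Collect_less continuous_intros) auto
    show ?thesis
    proof (cases "U = {}")
      case False
      define c where "c = Inf U"
      have bdd: "bdd_below U" by (rule bdd_belowI[of _ s]) (auto simp: U_def)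
      have c: "s \<le> c" unfolding c_def using False by (intro cInf_greatest) (auto simp: U_def)
      have "c \<notin> U"
      proof
        assume "c \<in> U"
        then obtain e where e: "0 < e" "ball c e \<subseteq> U" using \<open>open U\<close> by (metis openE)
        then have "c - e / 2 \<in> U" by (auto simp: dist_real_def)
        from cInf_lower[OF this bdd] e(1) show False by (simp add: c_def)
      qed
      have "U = {c<..}"
      proof (intro equalityI subsetI)
        fix x assume "x \<in> U"
        then show "x \<in> {c<..}" using cInf_lower[OF _ bdd, of x] \<open>c \<notin> U\<close> by (auto simp: c_def less_le)
      next
        fix x assume "x \<in> {c<..}"
        then obtain y where "y \<in> U" "y < x" using cInf_lessD[OF False, of x] by (auto simp: c_def)
        then show "x \<in> U" using mono[of y x] by (auto simp: U_def)
      qed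
      then show ?thesis
        unfolding U using tail[of c] tail_s c by (cases "s = c") auto
    qed (simp add: U)
  qed
  have eq: "(\<integral>\<^sup>+x. ennreal (\<psi> x) * indicator {s<..} x \<partial>M) =
      (\<integral>\<^sup>+r. indicator {0..} r * emeasure M {x. r < \<psi> x * indicator {s<..} x} \<partial>lborel)"
    if M: "prob_space M" "sets M = sets borel" for M :: "real measure"
  proof -
    interpret M: prob_space M by fact
    have [simp]: "space M = UNIV" using sets_eq_imp_space_eq[OF M(2)] by simp
    have [measurable]: "(\<lambda>x. \<psi> x * indicator {s<..} x) \<in> borel_measurable M"
      using M(2) by (subst measurable_cong_sets[OF M(2) refl]) measurable
    have "(\<integral>\<^sup>+x. ennreal (\<psi> x) * indicator {s<..} x \<partial>M) = (\<integral>\<^sup>+x. ennreal (\<psi> x * indicator {s<..} x) \<partial>M)"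
      by (intro nn_integral_cong) (auto simp: indicator_def)
    also have "\<dots> = (\<integral>\<^sup>+r. indicator {0..} r * emeasure M {x \<in> space M. r < \<psi> x * indicator {s<..} x} \<partial>lborel)"
      using nonneg by (intro nn_integral_layer_cake) (auto simp: M.sigma_finite_measure_axioms)
    finally show ?thesis by simp
  qed
  show ?thesis
    unfolding eq[OF assms(1) sets(1)] eq[OF assms(2) sets(2)]
    using level by (intro nn_integral_mono) (auto simp: indicator_def)
qed

text \<open>The cut criterion of Karlin and Novikov: subtract a supporting line at the crossing point, so
  that only the two tails matter.\<close>

lemma integral_convex_le_of_single_crossing:
  fixes \<mu> \<nu> :: "real measure" and \<phi> :: "real \<Rightarrow> real"
  assumes "prob_space \<mu>" "prob_space \<nu>" and sets [simp, measurable_cong]: "sets \<mu> = sets borel" "sets \<nu> = sets borel"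
    and right: "\<And>t. s < t \<Longrightarrow> emeasure \<mu> {t<..} \<le> emeasure \<nu> {t<..}"
    and left: "\<And>t. t < s \<Longrightarrow> emeasure \<mu> {..<t} \<le> emeasure \<nu> {..<t}"
    and int: "integrable \<mu> (\<lambda>x. x)" "integrable \<nu> (\<lambda>x. x)" "integrable \<mu> \<phi>" "integrable \<nu> \<phi>"
    and mean: "(\<integral>x. x \<partial>\<mu>) = (\<integral>x. x \<partial>\<nu>)"
    and convex: "convex_on UNIV \<phi>"
  shows "(\<integral>x. \<phi> x \<partial>\<mu>) \<le> (\<integral>x. \<phi> x \<partial>\<nu>)"
proof -
  interpret \<mu>: prob_space \<mu> by fact
  interpret \<nu>: prob_space \<nu> by fact
  \<comment> \<open>The right derivative of \<open>\<phi>\<close> at \<open>s\<close>, hence the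
    slope of a supporting line. The means agree, so subtracting this line changes both integrals by
    the same amount.\<close>
  define m where "m = Inf ((\<lambda>t. (\<phi> s - \<phi> t) / (s - t)) ` ({s<..} \<inter> UNIV))"
  define \<psi> where "\<psi> x = \<phi> x - \<phi> s - m * (x - s)" for x
  have nonneg: "0 \<le> \<psi> x" for x
    using convex_le_Inf_differential[OF convex, of s x] by (simp add: \<psi>_def m_def)
  have cont: "continuous_on UNIV \<psi>"
    unfolding \<psi>_def using convex_on_continuous[OF open_UNIV convex] by (intro continuous_intros)
  have [measurable]: "\<psi> \<in> borel_measurable borel" using cont by (rule borel_measurable_continuous_onI)
  have conv\<psi>: "\<psi> ((1 - u) * x + u * y) \<le> (1 - u) * \<psi> x + u * \<psi> y" if "0 \<le> u" "u \<le> 1" for u x y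
    using convex_onD[OF convex, of u x y] that by (simp add: \<psi>_def algebra_simps)
  have mono: "\<psi> x \<le> \<psi> y" if "s < x \<and> x \<le> y \<or> y \<le> x \<and> x < s" for x y
  proof -
    define u where "u = (x - s) / (y - s)"
    have "(x - s) / (y - s) * (y - s) = x - s" using that by auto
    then have u: "0 \<le> u" "u \<le> 1" "(1 - u) * s + u * y = x"
      using that by (auto simp: u_def divide_le_eq zero_le_divide_iff right_diff_distrib left_diff_distrib)
    have "\<psi> x \<le> (1 - u) * \<psi> s + u * \<psi> y" using conv\<psi>[of u s y] u by simp
    also have "\<dots> \<le> \<psi> y" using u nonneg[of y] by (simp add: \<psi>_def[of s] mult_left_le_one_le)
    finally show ?thesis .
  qed
  \<comment> \<open>The left tail is reflected into a right tail, so that the one-sided comparison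
    serves for both. The point \<open>s\<close> itself may be dropped because \<open>\<psi>\<close>
    vanishes there.\<close>
  have split: "(\<integral>\<^sup>+x. ennreal (\<psi> x) \<partial>M) = (\<integral>\<^sup>+x. ennreal (\<psi> x) * indicator {s<..} x \<partial>M) +
      (\<integral>\<^sup>+x. ennreal (\<psi> (- x)) * indicator {- s<..} x \<partial>distr M borel uminus)"
    if M [measurable_cong]: "sets M = sets borel" for M
  proof -
    have "(\<integral>\<^sup>+x. ennreal (\<psi> x) \<partial>M) = (\<integral>\<^sup>+x. ennreal (\<psi> x) * indicator {s<..} x + ennreal (\<psi> x) * indicator {- s<..} (- x) \<partial>M)"
      by (intro nn_integral_cong) (auto simp: indicator_def \<psi>_def[of s])
    also have "\<dots> = (\<integral>\<^sup>+x. ennreal (\<psi> x) * indicator {s<..} x \<partial>M) + (\<integral>\<^sup>+x. ennreal (\<psi> x) * indicator {- s<..} (- x) \<partial>M)"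
      by (rule nn_integral_add) measurable
    also have "(\<integral>\<^sup>+x. ennreal (\<psi> x) * indicator {- s<..} (- x) \<partial>M) =
        (\<integral>\<^sup>+x. ennreal (\<psi> (- x)) * indicator {- s<..} x \<partial>distr M borel uminus)"
      by (subst nn_integral_distr) auto
    finally show ?thesis .
  qed
  have "(\<integral>\<^sup>+x. ennreal (\<psi> x) \<partial>\<mu>) \<le> (\<integral>\<^sup>+x. ennreal (\<psi> x) \<partial>\<nu>)"
    unfolding split[OF sets(1)] split[OF sets(2)]
  proof (rule add_mono)
    show "(\<integral>\<^sup>+x. ennreal (\<psi> x) * indicator {s<..} x \<partial>\<mu>) \<le> (\<integral>\<^sup>+x. ennreal (\<psi> x) * indicator {s<..} x \<partial>\<nu>)"
      using right cont nonneg mono by (intro nn_integral_le_of_tail_le assms(1,2)) auto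
    have tail: "emeasure (distr M borel uminus) {t<..} = emeasure M {..<- t}"
      if M [measurable_cong]: "sets M = sets borel" for t :: real and M
    proof -
      have "uminus -` {t<..} = {..<- t}" by auto
      moreover have "space M = UNIV" using sets_eq_imp_space_eq[OF M] by simp
      ultimately show ?thesis by (subst emeasure_distr) auto
    qed
    show "(\<integral>\<^sup>+x. ennreal (\<psi> (- x)) * indicator {- s<..} x \<partial>distr \<mu> borel uminus) \<le>
        (\<integral>\<^sup>+x. ennreal (\<psi> (- x)) * indicator {- s<..} x \<partial>distr \<nu> borel uminus)"
    proof (rule nn_integral_le_of_tail_le)
      show "prob_space (distr \<mu> borel uminus)" "prob_space (distr \<nu> borel uminus)"
        by (intro \<mu>.prob_space_distr \<nu>.prob_space_distr; measurable)+
      show "continuous_on UNIV (\<lambda>x. \<psi> (- x))"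
        by (intro continuous_on_compose2[OF cont] continuous_intros) auto
      show "emeasure (distr \<mu> borel uminus) {t<..} \<le> emeasure (distr \<nu> borel uminus) {t<..}" if "- s < t" for t
        unfolding tail[OF sets(1)] tail[OF sets(2)] using that by (intro left) simp
    qed (use mono nonneg in auto)
  qed
  moreover have int\<psi>: "integrable \<mu> \<psi>" "integrable \<nu> \<psi>"
    unfolding \<psi>_def using int by (auto intro!: Bochner_Integration.integrable_diff)
  ultimately have "ennreal (\<integral>x. \<psi> x \<partial>\<mu>) \<le> ennreal (\<integral>x. \<psi> x \<partial>\<nu>)"
    using nonneg by (simp add: nn_integral_eq_integral)
  then have "(\<integral>x. \<psi> x \<partial>\<mu>) \<le> (\<integral>x. \<psi> x \<partial>\<nu>)"
    using nonneg by (subst (asm) ennreal_le_iff) (auto intro: Bochner_Integration.integral_nonneg)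
  moreover have "(\<integral>x. \<psi> x \<partial>\<mu>) = (\<integral>x. \<phi> x \<partial>\<mu>) - \<phi> s - m * ((\<integral>x. x \<partial>\<mu>) - s)"
    unfolding \<psi>_def using int by (simp add: \<mu>.prob_space)
  moreover have "(\<integral>x. \<psi> x \<partial>\<nu>) = (\<integral>x. \<phi> x \<partial>\<nu>) - \<phi> s - m * ((\<integral>x. x \<partial>\<nu>) - s)"
    unfolding \<psi>_def using int by (simp add: \<nu>.prob_space)
  ultimately show ?thesis using mean by simp
qed

section \<open>Projections and norms\<close>

lemma convex_on_abs_powr:
  assumes p: "1 \<le> (p::real)"
  shows "convex_on UNIV (\<lambda>x::real. \<bar>x\<bar> powr p)"
proof (rule convex_onI)
  fix u x y :: real assume u: "0 < u" "u < 1"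
  have pos: "((1 - u) * a + u * b) powr p \<le> (1 - u) * a powr p + u * b powr p" if ab: "0 \<le> a" "0 \<le> b" for a b :: real
  proof -
    have le: "(v * a) powr p \<le> v * a powr p" if "0 < v" "v < 1" "0 \<le> a" for v a :: real
    proof -
      have "v powr p \<le> v powr 1" using that p by (intro powr_mono') auto
      then show ?thesis using that by (simp add: powr_mult mult_right_mono)
    qed
    \<comment> \<open>If one argument vanishes, the claim reduces to \<open>v powr p \<le> v\<close>
      for \<open>v\<close> between 0 and 1.\<close>
    consider "a = 0" | "b = 0" | "0 < a" "0 < b" using ab by linarith
    then show ?thesis
    proof cases
      case 1
      then show ?thesis using le[of u b] u ab by simp
    next
      case 2
      then show ?thesis using le[of "1 - u" a] u ab by simp
    next
      case 3
      then show ?thesis using convex_onD[OF powr_convex[OF p], of u a b] u by simp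
    qed
  qed
  have "\<bar>(1 - u) *\<^sub>R x + u *\<^sub>R y\<bar> \<le> (1 - u) * \<bar>x\<bar> + u * \<bar>y\<bar>"
    using abs_triangle_ineq[of "(1 - u) * x" "u * y"] u by (simp add: abs_mult)
  then have "\<bar>(1 - u) *\<^sub>R x + u *\<^sub>R y\<bar> powr p \<le> ((1 - u) * \<bar>x\<bar> + u * \<bar>y\<bar>) powr p"
    using p by (intro powr_mono2) auto
  also have "\<dots> \<le> (1 - u) * \<bar>x\<bar> powr p + u * \<bar>y\<bar> powr p" by (rule pos) auto
  finally show "\<bar>(1 - u) *\<^sub>R x + u *\<^sub>R y\<bar> powr p \<le> (1 - u) * \<bar>x\<bar> powr p + u * \<bar>y\<bar> powr p" .
qed simp

lemma integrable_continuous_compact_support: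
  fixes g :: "'a::euclidean_space \<Rightarrow> 'b::euclidean_space"
  assumes "prob_space P" "sets P = sets borel" "AE z in P. z \<in> K" "compact K" "continuous_on UNIV g"
  shows "integrable P g"
proof -
  interpret prob_space P by fact
  have "compact (g ` K)"
    using assms(4,5) by (intro compact_continuous_image) (auto intro: continuous_on_subset)
  then obtain C where C: "\<And>z. z \<in> K \<Longrightarrow> norm (g z) \<le> C"
    using compact_imp_bounded by (force simp: bounded_iff)
  have "g \<in> borel_measurable P"
    using borel_measurable_continuous_onI[OF assms(5)] by (subst measurable_cong_sets[OF assms(2) refl])
  then show ?thesis
    using assms(3) C by (intro integrable_const_bound[of _ C]) (auto elim: eventually_mono)
qed

lemma ennreal_divide_le_divide_swap:
  fixes a b L V :: ennreal
  assumes "a * L \<le> b * V" "L \<noteq> 0" "L \<noteq> top" "V \<noteq> 0" "V \<noteq> top"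
  shows "a / V \<le> b / L"
proof -
  have "a / V = a * L / L / V" using assms by (simp add: ennreal_mult_divide_eq)
  also have "\<dots> \<le> b * V / L / V" using assms(1) by (intro divide_right_mono_ennreal)
  also have "b * V / L = b / L * V" by (metis ennreal_times_divide mult.commute)
  also have "b / L * V / V = b / L" using assms by (simp add: ennreal_mult_divide_eq)
  finally show ?thesis .
qed

text \<open>For extended nonnegative numbers both 0 / 0 and top / top are 0, so total mass 1
  excludes these two values. This yields positive finite boundary measure without computing
  it.\<close>

lemma emeasure_if_prob_space_uniform_measure:
  assumes "prob_space (uniform_measure M A)" "A \<in> sets M"
  shows "emeasure M A \<noteq> 0" "emeasure M A \<noteq> top"
proof -
  have "emeasure (uniform_measure M A) (space M) = 1"
    using prob_space.emeasure_space_1[OF assms(1)] by simp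
  then have "emeasure M A / emeasure M A = 1"
    using assms(2) by (simp add: emeasure_uniform_measure sets.Int_space_eq2)
  then show "emeasure M A \<noteq> 0" "emeasure M A \<noteq> top" by auto
qed

lemma AE_uniform_measure_in:
  assumes "A \<in> sets M"
  shows "AE x in uniform_measure M A. x \<in> A"
  using assms by (intro AE_uniform_measureI) auto

lemma linear_isometry_planar_frame:
  fixes u v :: "'a::euclidean_space"
  assumes uv: "u \<bullet> u = 1" "v \<bullet> v = 1" "u \<bullet> v = 0" and exp: "\<And>x. x = (x \<bullet> u) *\<^sub>R u + (x \<bullet> v) *\<^sub>R v"
  shows "linear_isometry (\<lambda>z. fst z *\<^sub>R u + snd z *\<^sub>R v) (\<lambda>x. (x \<bullet> u, x \<bullet> v))"
proof
  fix z :: "real \<times> real"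
  have uv': "v \<bullet> u = 0" using uv by (simp add: inner_commute)
  show "((fst z *\<^sub>R u + snd z *\<^sub>R v) \<bullet> u, (fst z *\<^sub>R u + snd z *\<^sub>R v) \<bullet> v) = z"
    by (simp add: inner_add_left uv uv')
  have "(fst z *\<^sub>R u + snd z *\<^sub>R v) \<bullet> (fst z *\<^sub>R u + snd z *\<^sub>R v) = (fst z)\<^sup>2 + (snd z)\<^sup>2"
    by (simp add: inner_add_left inner_add_right uv uv' power2_eq_square)
  then show "norm (fst z *\<^sub>R u + snd z *\<^sub>R v) = norm z"
    by (simp add: norm_eq_sqrt_inner[of "fst z *\<^sub>R u + snd z *\<^sub>R v"] norm_prod_def)
qed (auto simp: exp[symmetric] algebra_simps inner_add_left intro!: linearI)

lemma planar_frame_exists: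
  fixes u :: "'a::euclidean_space"
  assumes "DIM('a) = 2" "norm u = 1"
  obtains v where "u \<bullet> u = 1" "v \<bullet> v = 1" "u \<bullet> v = 0" "\<And>x. x = (x \<bullet> u) *\<^sub>R u + (x \<bullet> v) *\<^sub>R v"
proof -
  obtain e f :: 'a where ef: "Basis = {e, f}" "e \<noteq> f" using assms(1) by (auto simp: card_2_iff)
  then have "e \<in> Basis" "f \<in> Basis" by auto
  then have on: "e \<bullet> e = 1" "f \<bullet> f = 1" "e \<bullet> f = 0" "f \<bullet> e = 0"
    using ef(2) by (simp_all add: inner_not_same_Basis)
  have exp: "x = (x \<bullet> e) *\<^sub>R e + (x \<bullet> f) *\<^sub>R f" for x
  proof -
    have "(\<Sum>b\<in>{e, f}. (x \<bullet> b) *\<^sub>R b) = x"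
      using euclidean_representation[of x] ef(1) by metis
    then show ?thesis using ef(2) by simp
  qed
  define a where "a = u \<bullet> e"
  define b where "b = u \<bullet> f"
  have u: "u = a *\<^sub>R e + b *\<^sub>R f" using exp[of u] by (simp add: a_def b_def)
  have "u \<bullet> u = 1" using assms(2) by (simp add: dot_square_norm)
  then have ab: "a * a + b * b = 1"
    by (subst (asm) u, subst (asm) u) (simp add: inner_add_left inner_add_right on)
  \<comment> \<open>\<open>u\<close> turned by a right angle.\<close>
  define v where "v = (- b) *\<^sub>R e + a *\<^sub>R f"
  show ?thesis
  proof (rule that[of v])
    show "u \<bullet> u = 1" by fact
    show "v \<bullet> v = 1" "u \<bullet> v = 0"
      using ab by (simp_all add: v_def u inner_add_left inner_add_right inner_diff_left inner_diff_right on)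
    fix x
    define c where "c = x \<bullet> e"
    define d where "d = x \<bullet> f"
    have "(x \<bullet> u) *\<^sub>R u + (x \<bullet> v) *\<^sub>R v = (c * a + d * b) *\<^sub>R u + (d * a - c * b) *\<^sub>R v"
      by (simp add: u v_def inner_add_right inner_diff_right c_def d_def mult.commute)
    also have "\<dots> = ((c * a + d * b) * a - (d * a - c * b) * b) *\<^sub>R e + ((c * a + d * b) * b + (d * a - c * b) * a) *\<^sub>R f"
      by (simp add: u v_def algebra_simps)
    also have "(c * a + d * b) * a - (d * a - c * b) * b = c * (a * a + b * b)" by (simp add: algebra_simps)
    also have "(c * a + d * b) * b + (d * a - c * b) * a = d * (a * a + b * b)" by (simp add: algebra_simps)
    finally show "x = (x \<bullet> u) *\<^sub>R u + (x \<bullet> v) *\<^sub>R v"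
      using exp[of x] by (simp add: ab c_def d_def)
  qed
qed

text \<open>In the orthonormal frame \<open>u\<close>, \<open>v\<close> the projection to
  \<open>u\<close> becomes the first coordinate, and the tails of the projected laws become the
  normalised area and arc length of caps. These cross once, and the means are equal.\<close>

lemma planar_projection_convex_le:
  fixes K :: "'a::euclidean_space set"
  assumes dim: "DIM('a) = 2" and K: "convex_body K" and u: "norm u = 1"
    and P: "P = uniform_measure lborel K" and Q: "Q = uniform_measure (hausdorff_measure 1) (frontier K)"
    and prob: "prob_space P" "prob_space Q" and mean: "(\<integral>z. z \<partial>P) = (\<integral>z. z \<partial>Q)"
    and \<phi>: "convex_on UNIV \<phi>"
  shows "(\<integral>z. \<phi> (z \<bullet> u) \<partial>P) \<le> (\<integral>z. \<phi> (z \<bullet> u) \<partial>Q)"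
proof -
  obtain v where uv: "u \<bullet> u = 1" "v \<bullet> v = 1" "u \<bullet> v = 0" and exp: "\<And>x. x = (x \<bullet> u) *\<^sub>R u + (x \<bullet> v) *\<^sub>R v"
    using planar_frame_exists[OF dim u] by metis
  let ?T = "\<lambda>z. fst z *\<^sub>R u + snd z *\<^sub>R v"
  interpret T: linear_isometry ?T "\<lambda>x. (x \<bullet> u, x \<bullet> v)"
    using uv exp by (rule linear_isometry_planar_frame)
  interpret K': planar_body "?T -` K"
    using T.convex_body_vimage[OF K] by (simp add: planar_body_iff_convex_body)
  have "v \<bullet> u = 0" using uv by (simp add: inner_commute)
  then have Tu: "?T z \<bullet> u = fst z" for z using uv by (simp add: inner_add_left)
  have compact: "compact K" using K by (simp add: convex_body_def)
  then have [measurable]: "K \<in> sets borel" by (simp add: borel_closed compact_imp_closed)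
  have fr [measurable]: "frontier K \<in> sets borel" by simp
  have half [measurable]: "{z. t < z \<bullet> u} \<in> sets borel" "{z. z \<bullet> u < t} \<in> sets borel" for t
    by (auto intro!: borel_open open_halfspace_gt open_halfspace_lt simp: inner_commute)
  let ?V = "vol K" and ?L = "H 1 (frontier K)"
  have V: "?V \<noteq> 0" "?V \<noteq> top"
    using emeasure_if_prob_space_uniform_measure[of lborel K] prob(1) P by auto
  have L: "?L \<noteq> 0" "?L \<noteq> top"
    using emeasure_if_prob_space_uniform_measure[of "hausdorff_measure 1" "frontier K"] prob(2) Q fr
    by (auto simp: emeasure_hausdorff_measure)
  have dims: "DIM(real \<times> real) = DIM('a)" using dim by simp
  have V': "vol (?T -` K) = ?V" by (rule T.emeasure_lborel_vimage[OF dims]) simp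
  have L': "H 1 (frontier (?T -` K)) = ?L"
    by (simp only: T.frontier_vimage T.hausdorff_outer_vimage)
  have pre: "?T -` (S \<inter> {z. t < z \<bullet> u}) = ?T -` S \<inter> {z. t < fst z}"
    "?T -` (S \<inter> {z. z \<bullet> u < t}) = ?T -` S \<inter> {z. fst z < t}" for S t
    by (auto simp: Tu)
  have area: "K'.area_beyond t = vol (K \<inter> {z. t < z \<bullet> u})"
    "K'.area_before t = vol (K \<inter> {z. z \<bullet> u < t})" for t
    unfolding K'.area_beyond_def K'.area_before_def pre[symmetric]
    by (rule T.emeasure_lborel_vimage[OF dims]; measurable)+
  have arc: "K'.arc_beyond t = H 1 (frontier K \<inter> {z. t < z \<bullet> u})"
    "K'.arc_before t = H 1 (frontier K \<inter> {z. z \<bullet> u < t})" for t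
    unfolding K'.arc_beyond_def K'.arc_before_def T.frontier_vimage pre[symmetric]
    by (rule T.hausdorff_outer_vimage)+
  have fin: "H 1 (frontier (?T -` K)) < \<infinity>"
    unfolding L' using L by (simp add: less_top)
  obtain s where "\<And>t. s < t \<Longrightarrow> K'.area_beyond t * H 1 (frontier (?T -` K)) \<le> K'.arc_beyond t * vol (?T -` K)"
    "\<And>t. t < s \<Longrightarrow> K'.area_before t * H 1 (frontier (?T -` K)) \<le> K'.arc_before t * vol (?T -` K)"
    using K'.arc_area_single_crossing[OF fin] by blast
  note s = this[unfolded V' L']
  have setsP [measurable_cong, simp]: "sets P = sets borel" and setsQ [measurable_cong, simp]: "sets Q = sets borel"
    by (simp_all add: P Q)
  have spaceP [simp]: "space P = UNIV" and spaceQ [simp]: "space Q = UNIV"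
    by (simp_all add: P Q)
  interpret P: prob_space P by fact
  interpret Q: prob_space Q by fact
  have emP: "emeasure P S = vol (K \<inter> S) / ?V" if "S \<in> sets borel" for S
    using that by (simp add: P)
  have emQ: "emeasure Q S = H 1 (frontier K \<inter> S) / ?L" if "S \<in> sets borel" for S
    using that by (simp add: Q emeasure_hausdorff_measure)
  let ?\<mu> = "distr P borel (\<lambda>z. z \<bullet> u)" and ?\<nu> = "distr Q borel (\<lambda>z. z \<bullet> u)"
  have suppP: "AE z in P. z \<in> K"
    unfolding P by (rule AE_uniform_measure_in) simp
  have "AE z in Q. z \<in> frontier K"
    unfolding Q by (rule AE_uniform_measure_in) simp
  then have suppQ: "AE z in Q. z \<in> K"
    using frontier_subset_closed[OF compact_imp_closed[OF compact]] by (auto elim: eventually_mono)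
  note intP = integrable_continuous_compact_support[OF prob(1) setsP suppP compact]
  note intQ = integrable_continuous_compact_support[OF prob(2) setsQ suppQ compact]
  have cont: "continuous_on UNIV (\<lambda>z. \<phi> (z \<bullet> u))"
    by (intro continuous_on_compose2[OF convex_on_continuous[OF open_UNIV \<phi>]] continuous_intros) auto
  have cont_u: "continuous_on UNIV (\<lambda>z. z \<bullet> u)" by (intro continuous_intros)
  have [measurable]: "\<phi> \<in> borel_measurable borel"
    using convex_on_continuous[OF open_UNIV \<phi>] by (rule borel_measurable_continuous_onI)
  have "(\<integral>x. \<phi> x \<partial>?\<mu>) \<le> (\<integral>x. \<phi> x \<partial>?\<nu>)"
  proof (rule integral_convex_le_of_single_crossing[where s = s])
    show "prob_space ?\<mu>" "prob_space ?\<nu>"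
      by (intro P.prob_space_distr Q.prob_space_distr; measurable)+
    show "emeasure ?\<mu> {t<..} \<le> emeasure ?\<nu> {t<..}" if "s < t" for t
    proof -
      have "emeasure ?\<mu> {t<..} = emeasure P {z. t < z \<bullet> u}" "emeasure ?\<nu> {t<..} = emeasure Q {z. t < z \<bullet> u}"
        by (subst emeasure_distr; simp add: vimage_def)+
      then show ?thesis
        using ennreal_divide_le_divide_swap[OF s(1)[OF that] L V] by (simp add: emP emQ area arc)
    qed
    show "emeasure ?\<mu> {..<t} \<le> emeasure ?\<nu> {..<t}" if "t < s" for t
    proof -
      have "emeasure ?\<mu> {..<t} = emeasure P {z. z \<bullet> u < t}" "emeasure ?\<nu> {..<t} = emeasure Q {z. z \<bullet> u < t}"
        by (subst emeasure_distr; simp add: vimage_def)+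
      then show ?thesis
        using ennreal_divide_le_divide_swap[OF s(2)[OF that] L V] by (simp add: emP emQ area arc)
    qed
    show "integrable ?\<mu> (\<lambda>x. x)" "integrable ?\<mu> \<phi>"
      using intP[OF cont_u] intP[OF cont] by (simp_all add: integrable_distr_eq)
    show "integrable ?\<nu> (\<lambda>x. x)" "integrable ?\<nu> \<phi>"
      using intQ[OF cont_u] intQ[OF cont] by (simp_all add: integrable_distr_eq)
    show "(\<integral>x. x \<partial>?\<mu>) = (\<integral>x. x \<partial>?\<nu>)"
    proof -
      have "(\<integral>x. x \<partial>?\<mu>) = (\<integral>z. z \<bullet> u \<partial>P)" "(\<integral>x. x \<partial>?\<nu>) = (\<integral>z. z \<bullet> u \<partial>Q)"
        by (intro integral_distr; measurable)+
      moreover have "(\<integral>z. z \<bullet> u \<partial>P) = (\<integral>z. z \<partial>P) \<bullet> u"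
        by (rule integral_inner_left) (rule intP[OF continuous_on_id])
      moreover have "(\<integral>z. z \<bullet> u \<partial>Q) = (\<integral>z. z \<partial>Q) \<bullet> u"
        by (rule integral_inner_left) (rule intQ[OF continuous_on_id])
      ultimately show ?thesis using mean by metis
    qed
  qed (use \<phi> in auto)
  then show ?thesis by (simp add: integral_distr)
qed

section \<open>The norm as an average of projections over the unit ball\<close>

lemma ball_borel [measurable]: "ball c r \<in> sets (borel :: 'a::metric_space measure)"
  by (intro borel_open open_ball)

definition ball_average :: "real \<Rightarrow> 'a::euclidean_space \<Rightarrow> ennreal" where
  "ball_average p x = (\<integral>\<^sup>+w. ennreal (\<bar>x \<bullet> w\<bar> powr p) * indicator (ball 0 1) w \<partial>lborel)"

text \<open>The reflection that exchanges \<open>x\<close> and \<open>norm x *\<^sub>R e\<close>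
  preserves the ball, the volume and inner products; homogeneity then extracts the norm.\<close>

lemma ball_average_eq:
  fixes x e :: "'a::euclidean_space"
  assumes e: "norm e = 1"
  shows "ball_average p x = ennreal (norm x powr p) * ball_average p e"
proof -
  let ?y = "norm x *\<^sub>R e" and ?R = "reflect_along (x - norm x *\<^sub>R e)"
  have "norm x = norm ?y" using e by simp
  then have R: "?R x = ?y" by (rule reflect_along_swap)
  have [measurable]: "?R \<in> borel_measurable borel"
    using linear_reflect_along by (intro borel_measurable_continuous_onI linear_continuous_on) (simp add: linear_conv_bounded_linear)
  have distr: "distr lborel borel ?R = lborel"
    by (rule measure_eqI) (auto simp: emeasure_distr emeasure_lborel_reflect_along_vimage)
  have "ball_average p ?y = (\<integral>\<^sup>+w. ennreal (\<bar>?y \<bullet> w\<bar> powr p) * indicator (ball 0 1) w \<partial>distr lborel borel ?R)"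
    unfolding ball_average_def distr ..
  also have "\<dots> = (\<integral>\<^sup>+w. ennreal (\<bar>?y \<bullet> ?R w\<bar> powr p) * indicator (ball 0 1) (?R w) \<partial>lborel)"
    by (rule nn_integral_distr) measurable
  also have "\<dots> = ball_average p x"
  proof -
    have "?y \<bullet> ?R w = x \<bullet> w" for w
      using inner_reflect_along[of "x - ?y" x w] unfolding R .
    moreover have "?R w \<in> ball 0 1 \<longleftrightarrow> w \<in> ball 0 1" for w
      using norm_reflect_along[of "x - ?y" w] by simp
    ultimately show ?thesis
      unfolding ball_average_def by (intro nn_integral_cong) (simp only: indicator_def)
  qed
  finally have "ball_average p x = ball_average p ?y" ..
  also have "\<dots> = (\<integral>\<^sup>+w. ennreal (norm x powr p) * (ennreal (\<bar>e \<bullet> w\<bar> powr p) * indicator (ball 0 1) w) \<partial>lborel)"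
    unfolding ball_average_def
    by (intro nn_integral_cong) (simp add: abs_mult powr_mult ennreal_mult mult.assoc)
  also have "\<dots> = ennreal (norm x powr p) * ball_average p e"
    unfolding ball_average_def by (rule nn_integral_cmult) measurable
  finally show ?thesis .
qed

lemma ball_average_unit:
  fixes e :: "'a::euclidean_space"
  assumes e: "norm e = 1" and p: "1 \<le> p"
  shows "ball_average p e \<noteq> 0" "ball_average p e \<noteq> top"
proof -
  have "ball_average p e \<le> (\<integral>\<^sup>+w. indicator (ball (0::'a) 1) w \<partial>lborel)"
    unfolding ball_average_def
  proof (intro nn_integral_mono)
    fix w :: 'a
    show "ennreal (\<bar>e \<bullet> w\<bar> powr p) * indicator (ball 0 1) w \<le> indicator (ball 0 1) w"
    proof (cases "w \<in> ball 0 1")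
      case True
      then have "\<bar>e \<bullet> w\<bar> \<le> 1" using Cauchy_Schwarz_ineq2[of e w] e by simp
      then have "\<bar>e \<bullet> w\<bar> powr p \<le> 1" using p by (intro powr_le1) auto
      then show ?thesis using True by (simp add: ennreal_le_1)
    qed simp
  qed
  also have "\<dots> < top" using emeasure_lborel_ball_finite[of "0::'a" 1] by simp
  finally show "ball_average p e \<noteq> top" by simp
  \<comment> \<open>This ball lies inside the unit ball, and on it \<open>e \<bullet> w\<close> is
    at least \<open>1 / 2 - 1 / 4\<close>.\<close>
  let ?b = "ball ((1 / 2) *\<^sub>R e) (1 / 4)"
  have "ennreal ((1 / 4) powr p) * vol ?b = (\<integral>\<^sup>+w. ennreal ((1 / 4) powr p) * indicator ?b w \<partial>lborel)"
    by (simp add: nn_integral_cmult_indicator)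
  also have "\<dots> \<le> ball_average p e"
    unfolding ball_average_def
  proof (intro nn_integral_mono)
    fix w
    show "ennreal ((1 / 4) powr p) * indicator ?b w \<le> ennreal (\<bar>e \<bullet> w\<bar> powr p) * indicator (ball 0 1) w"
    proof (cases "w \<in> ?b")
      case True
      then have d: "norm (w - (1 / 2) *\<^sub>R e) < 1 / 4" by (simp add: dist_norm norm_minus_commute)
      have "norm w < 1"
        using norm_triangle_ineq[of "w - (1 / 2) *\<^sub>R e" "(1 / 2) *\<^sub>R e"] d e by simp
      moreover have "\<bar>e \<bullet> (w - (1 / 2) *\<^sub>R e)\<bar> < 1 / 4"
        using Cauchy_Schwarz_ineq2[of e "w - (1 / 2) *\<^sub>R e"] d e by simp
      then have "\<bar>e \<bullet> w - 1 / 2\<bar> < 1 / 4" using e by (simp add: inner_diff_right dot_square_norm)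
      then have "1 / 4 \<le> \<bar>e \<bullet> w\<bar>" by linarith
      then have "(1 / 4) powr p \<le> \<bar>e \<bullet> w\<bar> powr p" using p by (intro powr_mono2) auto
      ultimately show ?thesis using True by (simp add: ennreal_leI)
    qed simp
  qed
  finally show "ball_average p e \<noteq> 0"
    using emeasure_lborel_ball_pos[of "1 / 4" "(1 / 2) *\<^sub>R e"] by (auto simp: ennreal_zero_less_mult_iff)
qed

text \<open>Integrating the hypothesis over \<open>w\<close> in the unit ball and applying Fubini
  gives the claim times a constant. Its value is irrelevant: being positive and finite, it
  cancels.\<close>

lemma nn_integral_norm_powr_le_of_projections:
  fixes P Q :: "'a::euclidean_space measure"
  assumes "prob_space P" "prob_space Q" and sets [measurable_cong]: "sets P = sets borel" "sets Q = sets borel"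
    and p: "1 \<le> p"
    and proj: "\<And>w. (\<integral>\<^sup>+z. ennreal (\<bar>(z - y) \<bullet> w\<bar> powr p) \<partial>P) \<le> (\<integral>\<^sup>+z. ennreal (\<bar>(z - y) \<bullet> w\<bar> powr p) \<partial>Q)"
  shows "(\<integral>\<^sup>+z. ennreal (norm (z - y) powr p) \<partial>P) \<le> (\<integral>\<^sup>+z. ennreal (norm (z - y) powr p) \<partial>Q)"
proof -
  obtain e :: 'a where e: "norm e = 1" using norm_Basis[OF SOME_Basis] by blast
  let ?C = "ball_average p e"
  have swap: "?C * (\<integral>\<^sup>+z. ennreal (norm (z - y) powr p) \<partial>M) =
      (\<integral>\<^sup>+w. (\<integral>\<^sup>+z. ennreal (\<bar>(z - y) \<bullet> w\<bar> powr p) \<partial>M) * indicator (ball 0 1) w \<partial>lborel)"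
    if M: "prob_space M" and [measurable_cong]: "sets M = sets borel" for M
  proof -
    interpret prob_space M by fact
    interpret P: pair_sigma_finite M "lborel :: 'a measure" ..
    have "?C * (\<integral>\<^sup>+z. ennreal (norm (z - y) powr p) \<partial>M) = (\<integral>\<^sup>+z. ball_average p (z - y) \<partial>M)"
      by (simp add: ball_average_eq[OF e, of p "_ - y"] nn_integral_multc mult.commute[of ?C])
    also have "\<dots> = (\<integral>\<^sup>+w. (\<integral>\<^sup>+z. ennreal (\<bar>(z - y) \<bullet> w\<bar> powr p) * indicator (ball 0 1) w \<partial>M) \<partial>lborel)"
      unfolding ball_average_def by (rule P.Fubini'[symmetric]) measurable
    also have "\<dots> = (\<integral>\<^sup>+w. (\<integral>\<^sup>+z. ennreal (\<bar>(z - y) \<bullet> w\<bar> powr p) \<partial>M) * indicator (ball 0 1) w \<partial>lborel)"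
      by (intro nn_integral_cong nn_integral_multc) measurable
    finally show ?thesis .
  qed
  have "?C * (\<integral>\<^sup>+z. ennreal (norm (z - y) powr p) \<partial>P) \<le> ?C * (\<integral>\<^sup>+z. ennreal (norm (z - y) powr p) \<partial>Q)"
    unfolding swap[OF assms(1) sets(1)] swap[OF assms(2) sets(2)]
    by (intro nn_integral_mono mult_right_mono proj) simp
  then show ?thesis
    using ball_average_unit[OF e p] by (subst (asm) ennreal_mult_le_mult_iff) auto
qed

lemma continuous_on_abs_powr: "continuous_on UNIV g \<Longrightarrow> 0 < p \<Longrightarrow> continuous_on UNIV (\<lambda>z. \<bar>g z\<bar> powr (p::real))"
  by (intro continuous_on_powr' continuous_intros) auto

lemma continuous_on_norm_powr: "0 < p \<Longrightarrow> continuous_on UNIV (\<lambda>z::'a::real_normed_vector. norm (z - y) powr p)"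
  by (intro continuous_on_powr' continuous_intros) auto

lemma convex_on_affine:
  fixes f :: "real \<Rightarrow> real"
  assumes "convex_on UNIV f"
  shows "convex_on UNIV (\<lambda>x. f (a * x + b))"
proof (rule convex_onI)
  fix u x y :: real assume u: "0 < u" "u < 1"
  have "a * ((1 - u) *\<^sub>R x + u *\<^sub>R y) + b = (1 - u) * (a * x + b) + u * (a * y + b)"
    by (simp add: algebra_simps)
  then show "f (a * ((1 - u) *\<^sub>R x + u *\<^sub>R y) + b) \<le> (1 - u) * f (a * x + b) + u * f (a * y + b)"
    using convex_onD[OF assms, of u "a * x + b" "a * y + b"] u by simp
qed simp

lemma norm_powr_convex_combination:
  fixes x y c :: "'a::real_normed_vector"
  assumes "1 \<le> p" "0 \<le> t" "t \<le> 1"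
  shows "norm (c + t *\<^sub>R (x - c) - y) powr p \<le> t * norm (x - y) powr p + (1 - t) * norm (c - y) powr p"
proof -
  have "c + t *\<^sub>R (x - c) - y = t *\<^sub>R (x - y) + (1 - t) *\<^sub>R (c - y)" by (simp add: algebra_simps)
  then have "norm (c + t *\<^sub>R (x - c) - y) \<le> norm (t *\<^sub>R (x - y)) + norm ((1 - t) *\<^sub>R (c - y))"
    using norm_triangle_ineq by metis
  then have "norm (c + t *\<^sub>R (x - c) - y) \<le> (1 - t) * norm (c - y) + t * norm (x - y)"
    using assms by simp
  then have "norm (c + t *\<^sub>R (x - c) - y) powr p \<le> \<bar>(1 - t) * norm (c - y) + t * norm (x - y)\<bar> powr p"
    using assms by (intro powr_mono2) auto
  also have "\<dots> \<le> (1 - t) * norm (c - y) powr p + t * norm (x - y) powr p"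
    using convex_onD[OF convex_on_abs_powr[OF assms(1)], of t "norm (c - y)" "norm (x - y)"] assms by simp
  finally show ?thesis by simp
qed

lemma AE_frontier_in_closed:
  assumes "closed K" "AE z in Q. z \<in> frontier K"
  shows "AE z in Q. z \<in> K"
  using assms(2) frontier_subset_closed[OF assms(1)] by (auto elim: eventually_mono)

section \<open>The two cases and the passage to random pairs\<close>

lemma planar_norm_powr_le:
  fixes K :: "'a::euclidean_space set"
  assumes dim: "DIM('a) = 2" and K: "convex_body K"
    and P: "P = uniform_measure lborel K" and Q: "Q = uniform_measure (hausdorff_measure 1) (frontier K)"
    and prob: "prob_space P" "prob_space Q" and mean: "(\<integral>z. z \<partial>P) = (\<integral>z. z \<partial>Q)"
    and p: "1 \<le> p"
  shows "(\<integral>\<^sup>+z. ennreal (norm (z - y) powr p) \<partial>P) \<le> (\<integral>\<^sup>+z. ennreal (norm (z - y) powr p) \<partial>Q)"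
proof -
  have compact: "compact K" using K by (simp add: convex_body_def)
  then have cl: "closed K" by (rule compact_imp_closed)
  have sets: "sets P = sets borel" "sets Q = sets borel" by (simp_all add: P Q)
  have supp: "AE z in P. z \<in> K" "AE z in Q. z \<in> K"
    unfolding P Q using cl
    by (intro AE_uniform_measure_in AE_frontier_in_closed[OF cl]; simp)+
  have "(\<integral>\<^sup>+z. ennreal (\<bar>(z - y) \<bullet> w\<bar> powr p) \<partial>P) \<le> (\<integral>\<^sup>+z. ennreal (\<bar>(z - y) \<bullet> w\<bar> powr p) \<partial>Q)" for w
  proof (cases "w = 0")
    case False
    \<comment> \<open>The projection result takes a unit direction, so the length of
      \<open>w\<close> and the shift by \<open>y\<close> are absorbed into the convex
      function.\<close>
    define \<phi> where "\<phi> r = \<bar>norm w * r + - (y \<bullet> w)\<bar> powr p" for r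
    have \<phi>: "convex_on UNIV \<phi>"
      unfolding \<phi>_def by (rule convex_on_affine[OF convex_on_abs_powr[OF p]])
    have eq: "\<phi> (z \<bullet> sgn w) = \<bar>(z - y) \<bullet> w\<bar> powr p" for z
    proof -
      have "norm w * (z \<bullet> sgn w) = z \<bullet> w"
        using False by (simp add: sgn_div_norm mult.assoc[symmetric])
      then show ?thesis by (simp add: \<phi>_def inner_diff_left)
    qed
    have cont: "continuous_on UNIV (\<lambda>z. \<bar>(z - y) \<bullet> w\<bar> powr p)"
      using p by (intro continuous_on_abs_powr continuous_intros) auto
    have int: "integrable P (\<lambda>z. \<bar>(z - y) \<bullet> w\<bar> powr p)" "integrable Q (\<lambda>z. \<bar>(z - y) \<bullet> w\<bar> powr p)"
      using integrable_continuous_compact_support[OF prob(1) sets(1) supp(1) compact cont]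
        integrable_continuous_compact_support[OF prob(2) sets(2) supp(2) compact cont] by auto
    have "norm (sgn w) = 1" using False by (simp add: norm_sgn)
    from planar_projection_convex_le[OF dim K this P Q prob mean \<phi>]
    have "(\<integral>z. \<bar>(z - y) \<bullet> w\<bar> powr p \<partial>P) \<le> (\<integral>z. \<bar>(z - y) \<bullet> w\<bar> powr p \<partial>Q)" by (simp only: eq)
    then show ?thesis using int by (simp add: nn_integral_eq_integral ennreal_leI)
  qed simp
  then show ?thesis
    using nn_integral_norm_powr_le_of_projections[OF prob sets p] by blast
qed

lemma circumscribed_norm_powr_le:
  fixes K :: "'a::euclidean_space set"
  assumes K: "convex_body K" and circ: "circumscribed_polytope_with_center K c"
    and P: "P = uniform_measure lborel K" and Q: "Q = uniform_measure (hausdorff_measure k) (frontier K)"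
    and prob: "prob_space Q" and mean: "c = (\<integral>z. z \<partial>Q)"
    and p: "1 \<le> p"
  shows "(\<integral>\<^sup>+z. ennreal (norm (z - y) powr p) \<partial>P) \<le> (\<integral>\<^sup>+z. ennreal (norm (z - y) powr p) \<partial>Q)"
proof -
  have compact: "compact K" and convex: "convex K" using K by (auto simp: convex_body_def)
  have fr: "frontier K \<in> sets (hausdorff_measure k)" by simp
  obtain r where r: "inscribed_sphere K c r" and poly: "polytope K" "interior K \<noteq> {}"
    using circ by (auto simp: circumscribed_polytope_with_center_def)
  obtain N where N: "finite N" "\<And>a. a \<in> N \<Longrightarrow> norm a = 1"
    "\<And>a. a \<in> N \<Longrightarrow> K \<subseteq> {x. a \<bullet> (x - c) \<le> r}"
    "frontier K \<subseteq> (\<Union>a\<in>N. {x. a \<bullet> (x - c) = r})"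
    "\<And>a. a \<in> N \<Longrightarrow> \<exists>x0 e. 0 < e \<and> a \<bullet> (x0 - c) = r \<and> ball x0 e \<inter> {x. a \<bullet> (x - c) = r} \<subseteq> K"
    using circumscribed_polytope_normals[OF poly r] by blast
  have "0 < r" "sphere c r \<subseteq> K" using r by (auto simp: inscribed_sphere_def)
  then have "cball c r \<subseteq> K" by (intro cball_subset_convex_sphere convex)
  then have c: "c \<in> interior K"
    using \<open>0 < r\<close> by (intro interiorI[of "ball c r"]) auto
  interpret circumscribed K c r N k
  proof
    show "a \<bullet> (x - c) \<le> r" if "a \<in> N" "x \<in> K" for a x using N(3)[OF that(1)] that(2) by blast
    show "H k (frontier K) \<noteq> 0" "H k (frontier K) < \<infinity>"
      using emeasure_if_prob_space_uniform_measure[OF prob[unfolded Q] fr] fr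
      by (simp_all add: emeasure_hausdorff_measure less_top)
    show "\<exists>x0 e. 0 < e \<and> a \<bullet> (x0 - c) = r \<and> ball x0 e \<inter> {x. a \<bullet> (x - c) = r} \<subseteq> K" if "a \<in> N" for a
      by (rule N(5)[OF that])
  qed (fact compact \<open>0 < r\<close> c N)+
  interpret Q: prob_space Q by fact
  have setsQ: "sets Q = sets borel" by (simp add: Q)
  have supp: "AE z in Q. z \<in> K"
    unfolding Q by (auto intro!: AE_frontier_in_closed[OF K_closed] AE_uniform_measure_in)
  note intQ = integrable_continuous_compact_support[OF prob setsQ supp compact]
  have cont: "continuous_on UNIV (\<lambda>z::'a. norm (z - y) powr p)"
    using p by (intro continuous_on_norm_powr) auto
  \<comment> \<open>Jensen in two stages, first for the norm of a vector integral and then for the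
    power on the line. The absolute value matches the power function that is convex on all
    reals.\<close>
  have "norm (c - y) = norm (\<integral>z. z - y \<partial>Q)"
    using intQ[OF continuous_on_id] mean by (simp add: Q.prob_space)
  also have "\<dots> \<le> (\<integral>z. norm (z - y) \<partial>Q)"
    by (rule integral_norm_bound)
  finally have "norm (c - y) powr p \<le> \<bar>\<integral>z. norm (z - y) \<partial>Q\<bar> powr p"
    using p by (intro powr_mono2) auto
  also have "\<dots> \<le> (\<integral>z. \<bar>norm (z - y)\<bar> powr p \<partial>Q)"
  proof (rule Q.jensens_inequality[where I = UNIV])
    show "integrable Q (\<lambda>z. norm (z - y))" by (intro intQ continuous_intros)
    show "integrable Q (\<lambda>z. \<bar>norm (z - y)\<bar> powr p)" using intQ[OF cont] by simp
  qed (use convex_on_abs_powr[OF p] in auto)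
  finally have "ennreal (norm (c - y) powr p) \<le> ennreal (\<integral>z. norm (z - y) powr p \<partial>Q)"
    by (simp add: ennreal_leI)
  also have "\<dots> = (\<integral>\<^sup>+z. ennreal (norm (z - y) powr p) \<partial>Q)"
    using intQ[OF cont] by (simp add: nn_integral_eq_integral)
  finally show ?thesis
    unfolding P Q using p borel_measurable_continuous_onI[OF cont]
    by (intro nn_integral_uniform_le norm_powr_convex_combination) auto
qed

lemma nn_integral_distance_mono:
  fixes P Q :: "'a::euclidean_space measure"
  assumes "prob_space P" "prob_space Q" and [measurable_cong]: "sets P = sets borel" "sets Q = sets borel"
    and le: "\<And>y. (\<integral>\<^sup>+z. ennreal (norm (z - y) powr p) \<partial>P) \<le> (\<integral>\<^sup>+z. ennreal (norm (z - y) powr p) \<partial>Q)"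
  shows "(\<integral>\<^sup>+x. \<integral>\<^sup>+y. ennreal (norm (x - y) powr p) \<partial>P \<partial>P) \<le> (\<integral>\<^sup>+x. \<integral>\<^sup>+y. ennreal (norm (x - y) powr p) \<partial>Q \<partial>Q)"
proof -
  interpret P: prob_space P by fact
  interpret Q: prob_space Q by fact
  interpret QP: pair_sigma_finite Q P ..
  have "(\<integral>\<^sup>+x. \<integral>\<^sup>+y. ennreal (norm (x - y) powr p) \<partial>P \<partial>P) \<le> (\<integral>\<^sup>+x. \<integral>\<^sup>+y. ennreal (norm (x - y) powr p) \<partial>Q \<partial>P)"
    using le by (intro nn_integral_mono) (simp add: norm_minus_commute)
  \<comment> \<open>After the exchange the inner point is again the one uniform in \<open>K\<close>,
    so the pointwise inequality can be applied a second time.\<close>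
  also have "\<dots> = (\<integral>\<^sup>+y. \<integral>\<^sup>+x. ennreal (norm (x - y) powr p) \<partial>P \<partial>Q)"
    by (rule QP.Fubini') measurable
  also have "\<dots> \<le> (\<integral>\<^sup>+y. \<integral>\<^sup>+x. ennreal (norm (x - y) powr p) \<partial>Q \<partial>Q)"
    using le by (intro nn_integral_mono)
  also have "\<dots> = (\<integral>\<^sup>+x. \<integral>\<^sup>+y. ennreal (norm (x - y) powr p) \<partial>Q \<partial>Q)"
    by (simp add: norm_minus_commute)
  finally show ?thesis .
qed

lemma (in prob_space) nn_integral_indep_distance:
  fixes X Y :: "'a \<Rightarrow> 'b::euclidean_space"
  assumes "indep_var borel X borel Y"
  shows "(\<integral>\<^sup>+\<omega>. ennreal (norm (X \<omega> - Y \<omega>) powr p) \<partial>M) =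
    (\<integral>\<^sup>+x. \<integral>\<^sup>+y. ennreal (norm (x - y) powr p) \<partial>distr M borel Y \<partial>distr M borel X)"
proof -
  have [measurable]: "X \<in> borel_measurable M" "Y \<in> borel_measurable M"
    and eq: "distr M borel X \<Otimes>\<^sub>M distr M borel Y = distr M (borel \<Otimes>\<^sub>M borel) (\<lambda>\<omega>. (X \<omega>, Y \<omega>))"
    using assms unfolding indep_var_distribution_eq by auto
  interpret Y: prob_space "distr M borel Y" by (rule prob_space_distr) measurable
  have "(\<integral>\<^sup>+\<omega>. ennreal (norm (X \<omega> - Y \<omega>) powr p) \<partial>M) =
      (\<integral>\<^sup>+z. ennreal (norm (fst z - snd z) powr p) \<partial>distr M (borel \<Otimes>\<^sub>M borel) (\<lambda>\<omega>. (X \<omega>, Y \<omega>)))"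
    by (subst nn_integral_distr) auto
  also have "\<dots> = (\<integral>\<^sup>+x. \<integral>\<^sup>+y. ennreal (norm (x - y) powr p) \<partial>distr M borel Y \<partial>distr M borel X)"
    unfolding eq[symmetric] by (subst Y.nn_integral_fst[symmetric]) auto
  finally show ?thesis .
qed

theorem corollary1:
  fixes K :: "'a::euclidean_space set"
    and M :: "'w measure"
    and I B I\<^sub>1 I\<^sub>2 B\<^sub>1 B\<^sub>2 :: "'w \<Rightarrow> 'a"
    and p :: real
  assumes "convex_body K"
    and "prob_space M"
    and "uniform_in M I K"
    and "uniform_on_boundary M B K"
    and "(DIM('a) = 2 \<and> integral\<^sup>L M I = integral\<^sup>L M B) \<or>
         (\<exists>c. circumscribed_polytope_with_center K c \<and>
              c = integral\<^sup>L M I \<and> integral\<^sup>L M I = integral\<^sup>L M B)"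
    and "uniform_in M I\<^sub>1 K" and "uniform_in M I\<^sub>2 K"
    and "prob_space.indep_var M borel I\<^sub>1 borel I\<^sub>2"
    and "uniform_on_boundary M B\<^sub>1 K" and "uniform_on_boundary M B\<^sub>2 K"
    and "prob_space.indep_var M borel B\<^sub>1 borel B\<^sub>2"
    and "1 \<le> p"
  shows "(\<integral>\<omega>. norm (I\<^sub>1 \<omega> - I\<^sub>2 \<omega>) powr p \<partial>M) \<le> (\<integral>\<omega>. norm (B\<^sub>1 \<omega> - B\<^sub>2 \<omega>) powr p \<partial>M)"
proof -
  interpret prob_space M by fact
  define P where "P = uniform_measure lborel K"
  define Q where "Q = uniform_measure (hausdorff_measure (DIM('a) - 1)) (frontier K)"
  have [measurable]: "I \<in> borel_measurable M" "I\<^sub>1 \<in> borel_measurable M" "I\<^sub>2 \<in> borel_measurable M"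
      "B \<in> borel_measurable M" "B\<^sub>1 \<in> borel_measurable M" "B\<^sub>2 \<in> borel_measurable M"
    and P: "distr M borel I = P" "distr M borel I\<^sub>1 = P" "distr M borel I\<^sub>2 = P"
    and Q: "distr M borel B = Q" "distr M borel B\<^sub>1 = Q" "distr M borel B\<^sub>2 = Q"
    using assms by (simp_all add: uniform_in_def uniform_on_boundary_def P_def Q_def)
  have prob: "prob_space P" "prob_space Q"
    unfolding P(1)[symmetric] Q(1)[symmetric] by (intro prob_space_distr; measurable)+
  have sets: "sets P = sets borel" "sets Q = sets borel" by (simp_all add: P_def Q_def)
  have mean: "integral\<^sup>L M I = (\<integral>z. z \<partial>P)" "integral\<^sup>L M B = (\<integral>z. z \<partial>Q)"
    unfolding P(1)[symmetric] Q(1)[symmetric] by (simp_all add: integral_distr)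
  have le: "(\<integral>\<^sup>+z. ennreal (norm (z - y) powr p) \<partial>P) \<le> (\<integral>\<^sup>+z. ennreal (norm (z - y) powr p) \<partial>Q)" for y
    using assms(5)
  proof
    assume "DIM('a) = 2 \<and> integral\<^sup>L M I = integral\<^sup>L M B"
    then show ?thesis
      using mean P_def Q_def by (intro planar_norm_powr_le[OF _ assms(1) P_def _ prob _ assms(12)]) auto
  next
    assume "\<exists>c. circumscribed_polytope_with_center K c \<and> c = integral\<^sup>L M I \<and> integral\<^sup>L M I = integral\<^sup>L M B"
    then obtain c where "circumscribed_polytope_with_center K c" "c = (\<integral>z. z \<partial>Q)" using mean by auto
    then show ?thesis
      by (rule circumscribed_norm_powr_le[OF assms(1) _ P_def Q_def prob(2) _ assms(12)])
  qed
  have "(\<integral>\<^sup>+\<omega>. ennreal (norm (I\<^sub>1 \<omega> - I\<^sub>2 \<omega>) powr p) \<partial>M) \<le> (\<integral>\<^sup>+\<omega>. ennreal (norm (B\<^sub>1 \<omega> - B\<^sub>2 \<omega>) powr p) \<partial>M)"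
    unfolding nn_integral_indep_distance[OF assms(8)] nn_integral_indep_distance[OF assms(11)] P Q
    by (rule nn_integral_distance_mono[OF prob sets le])
  \<comment> \<open>Passing back to Bochner integrals goes through \<open>enn2real\<close>, which
    sends \<open>top\<close> to 0; monotonicity therefore requires a finite right-hand side.\<close>
  moreover have "(\<integral>\<^sup>+\<omega>. ennreal (norm (B\<^sub>1 \<omega> - B\<^sub>2 \<omega>) powr p) \<partial>M) < top"
  proof -
    have compact: "compact K" using assms(1) by (simp add: convex_body_def)
    obtain R where R: "\<And>z. z \<in> K \<Longrightarrow> norm z \<le> R"
      using compact_imp_bounded[OF compact] unfolding bounded_iff by blast
    have "AE z in Q. z \<in> K"
      unfolding Q_def using compact
      by (auto intro!: AE_frontier_in_closed AE_uniform_measure_in compact_imp_closed)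
    then have "AE \<omega> in M. B\<^sub>1 \<omega> \<in> K" "AE \<omega> in M. B\<^sub>2 \<omega> \<in> K"
      using AE_distrD[of B\<^sub>1 M borel "\<lambda>z. z \<in> K", unfolded Q(2)]
        AE_distrD[of B\<^sub>2 M borel "\<lambda>z. z \<in> K", unfolded Q(3)] by simp_all
    then have "AE \<omega> in M. ennreal (norm (B\<^sub>1 \<omega> - B\<^sub>2 \<omega>) powr p) \<le> ennreal ((2 * R) powr p)"
    proof eventually_elim
      case (elim \<omega>)
      have "norm (B\<^sub>1 \<omega> - B\<^sub>2 \<omega>) \<le> 2 * R"
        using norm_triangle_ineq4[of "B\<^sub>1 \<omega>" "B\<^sub>2 \<omega>"] R[OF elim(1)] R[OF elim(2)] by simp
      then show ?case using assms(12) by (intro ennreal_leI powr_mono2) auto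
    qed
    then have "(\<integral>\<^sup>+\<omega>. ennreal (norm (B\<^sub>1 \<omega> - B\<^sub>2 \<omega>) powr p) \<partial>M) \<le> (\<integral>\<^sup>+\<omega>. ennreal ((2 * R) powr p) \<partial>M)"
      by (rule nn_integral_mono_AE)
    also have "\<dots> < top" by (simp add: emeasure_space_1)
    finally show ?thesis .
  qed
  ultimately show ?thesis
    by (simp add: integral_eq_nn_integral enn2real_mono)
qed

end
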